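(* Let $M$ be a Polish space, $\pi\in\mathcal P(M)$, let $\{W_n\}_{n\in\mathbb N}$ be a stable sequence of symmetric measurable functions $W_n:M^n\to(-\infty,\infty]$, and let $W:\mathcal P(M)\to(-\infty,\infty]$ be a measurable function. Let $\{\beta_n\}_{n\in\mathbb N}$ be a sequence of positive numbers converging to some $\beta\in(0,\infty]$. If $\beta<\infty$, suppose that $W$ is the positive temperature macroscopic limit of $\{W_n\}_{n\in\mathbb N}$. If $\beta=\infty$, suppose that $W$ is the zero temperature macroscopic limit of $\{W_n\}_{n\in\mathbb N}$ and that $\{W_n\}_{n\in\mathbb N}$ is a confining sequence. Define the measures $\gamma_n$ on $M^n$ by $d\gamma_n=e^{-n\beta_nW_n}\,d\pi^{\otimes n}$ and the free energy $F:\mathcal P(M)\to(-\infty,\infty]$ by $F=W+\frac1\beta D(\cdot\|\pi)$ (with $\frac1\infty=0$ and the convention $0\times\infty=0$, so $F=W$ if $\beta=\infty$). Then for every bounded continuous function $f:\mathcal P(M)\to\mathbb R$, $$\frac{1}{n\beta_n}\log\int_{M^n}e^{-n\beta_n f\circ i_n}\,d\gamma_n\ \xrightarrow[n\to\infty]{}\ -\inf_{\mu\in\mathcal P(M)}\{f(\mu)+F(\mu)\}.$$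
   Context: $M$ carries its Borel $\sigma$-algebra; $\mathcal P(M)$ is the space of Borel probability measures on $M$ with the weak topology (the smallest topology making $\mu\mapsto\int f\,d\mu$ continuous for all bounded continuous $f:M\to\mathbb R$). $i_n:M^n\to\mathcal P(M)$ is $i_n(x_1,\dots,x_n)=\frac1n\sum_{i=1}^n\delta_{x_i}$. $D(\mu\|\nu)=\int_M\frac{d\mu}{d\nu}\log\frac{d\mu}{d\nu}\,d\nu$ if $\mu\ll\nu$ and $D(\mu\|\nu)=\infty$ otherwise. For symmetric measurable $W_n:M^n\to(-\infty,\infty]$ define $\tilde W_n:\mathcal P(M)\to(-\infty,\infty]$ by $\tilde W_n(\mu)=W_n(x_1,\dots,x_n)$ if $\mu=\frac1n\sum_{i=1}^n\delta_{x_i}$ for some $(x_1,\dots,x_n)\in M^n$, and $\tilde W_n(\mu)=\infty$ otherwise. Stable sequence: there is $C\in\mathbb R$ with $W_n\ge C$ for all $n$. Confining sequence: for every increasing sequence $\{n_j\}$ of natural numbers and every sequence $\{\mu_j\}$ in $\mathcal P(M)$, if there is a real constant $A$ with $\tilde W_{n_j}(\mu_j)\le A$ for all $j$, then $\{\mu_j\}$ is relatively compact in $\mathcal P(M)$. Lower limit assumption (A1): whenever $\mu_n\to\mu$ in $\mathcal P(M)$, $\liminf_{n\to\infty}\tilde W_n(\mu_n)\ge W(\mu)$. Upper limit assumption (A2): for each $\mu\in\mathcal P(M)$, $\limsup_{n\to\infty}\mathbb E_{\mu^{\otimes n}}[W_n]\le W(\mu)$. Regularity assumption (A2'): let $\mathcal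 N=\{\mu\in\mathcal P(M):D(\mu\|\pi)<\infty\text{ and }\limsup_{n\to\infty}\mathbb E_{\mu^{\otimes n}}[W_n]\le W(\mu)\}$; for every $\mu\in\mathcal P(M)$ with $W(\mu)<\infty$ there is a sequence $\{\mu_n\}$ in $\mathcal N$ with $\mu_n\to\mu$ and $\limsup_{n\to\infty}W(\mu_n)\le W(\mu)$. For a stable sequence $\{W_n\}$, a measurable $W:\mathcal P(M)\to(-\infty,\infty]$ is the positive temperature macroscopic limit of $\{W_n\}$ if (A1) and (A2) hold, and the zero temperature macroscopic limit if (A1) and (A2') hold. *)

theory Defs
  imports "HOL-Probability.Probability" "HOL-Combinatorics.Combinatorics"
begin

text \<open>
  Sequences indexed by the positive integers are functions on \<open>nat\<close>; every pointwise
  hypothesis is restricted to \<open>n \<ge> 1\<close>, and the value at \<open>0\<close> is never used.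
\<close>

subsection \<open>The space of probability measures with the weak topology\<close>

abbreviation prob_measures :: "'a::topological_space measure set" where
  "prob_measures \<equiv> space (prob_algebra borel)"

lemma prob_measures_iff: "\<mu> \<in> prob_measures \<longleftrightarrow> sets \<mu> = sets borel \<and> prob_space \<mu>"
  by (simp add: space_prob_algebra)

definition weak_topology :: "'a::topological_space measure topology" where
  "weak_topology = topology_generated_by
     {{\<mu> \<in> prob_measures. (\<integral>x. f x \<partial>\<mu>) \<in> U} | (f :: 'a \<Rightarrow> real) U.
        continuous_on UNIV f \<and> bounded (range f) \<and> open U}"

lemma topspace_weak_topology [simp]: "topspace weak_topology = prob_measures"
proof -
  have "\<exists>(f :: 'a \<Rightarrow> real) U. prob_measures = {\<mu> \<in> prob_measures. (\<integral>x. f x \<partial>\<mu>) \<in> U} \<and>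
        continuous_on UNIV f \<and> bounded (range f) \<and> open U"
    by (rule exI[of _ "\<lambda>_. 0"], rule exI[of _ UNIV]) auto
  then show ?thesis
    unfolding weak_topology_def topology_generated_by_topspace by blast
qed

lemma continuous_map_weak_topology_integral:
  fixes f :: "'a::topological_space \<Rightarrow> real"
  assumes "continuous_on UNIV f" "bounded (range f)"
  shows "continuous_map weak_topology euclidean (\<lambda>\<mu>. \<integral>x. f x \<partial>\<mu>)"
  unfolding continuous_map_def topspace_weak_topology
proof (intro conjI allI impI)
  fix U :: "real set" assume "openin euclidean U"
  then show "openin weak_topology {\<mu> \<in> prob_measures. (\<integral>x. f x \<partial>\<mu>) \<in> U}"
    unfolding weak_topology_def using assms
    by (intro topology_generated_by_Basis) auto
qed auto

definition borel_of :: "'b topology \<Rightarrow> 'b measure" where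
  "borel_of X = sigma (topspace X) {U. openin X U}"

definition relatively_compact_in :: "'b topology \<Rightarrow> 'b set \<Rightarrow> bool" where
  "relatively_compact_in X S \<longleftrightarrow> S \<subseteq> topspace X \<and> compactin X (X closure_of S)"

subsection \<open>Extended-valued exponential, logarithm and integral\<close>

definition eexp :: "ereal \<Rightarrow> ennreal" where
  "eexp x = (if x = \<infinity> then \<infinity> else if x = -\<infinity> then 0 else ennreal (exp (real_of_ereal x)))"

definition elog :: "ennreal \<Rightarrow> ereal" where
  "elog x = (if x = 0 then -\<infinity> else if x = \<infinity> then \<infinity> else ereal (ln (enn2real x)))"

text \<open>
  The integral of the positive part minus that of the negative part. It is only used for
  probability measures and integrands bounded below, so \<open>\<infinity> - \<infinity>\<close> does not occur.
\<close>
definition eintegral :: "'b measure \<Rightarrow> ('b \<Rightarrow> ereal) \<Rightarrow> ereal" where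
  "eintegral N g =
     enn2ereal (\<integral>\<^sup>+x. e2ennreal (g x) \<partial>N) - enn2ereal (\<integral>\<^sup>+x. e2ennreal (- g x) \<partial>N)"

text \<open>
  The library's \<open>KL_divergence\<close> is real-valued (\<open>0\<close> in the non-integrable case), hence not
  usable here. Note \<open>0 * ln 0 = 0\<close>.
\<close>
definition relative_entropy :: "'b measure \<Rightarrow> 'b measure \<Rightarrow> ereal" where
  "relative_entropy \<mu> \<nu> =
     (if absolutely_continuous \<nu> \<mu>
      then eintegral \<nu> (\<lambda>x. let d = enn2real (RN_deriv \<nu> \<mu> x) in ereal (d * ln d))
      else \<infinity>)"

subsection \<open>Configurations and empirical measures\<close>

text \<open>
  Configurations in \<open>M\<^sup>n\<close> are extensional functions on \<open>{..<n}\<close>: \<open>power_measure n borel\<close>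
  provides the measurable space \<open>M\<^sup>n\<close>, and \<open>power_measure n \<mu>\<close> is the product measure.
\<close>
abbreviation power_measure :: "nat \<Rightarrow> 'a measure \<Rightarrow> (nat \<Rightarrow> 'a) measure" where
  "power_measure n \<mu> \<equiv> Pi\<^sub>M {..<n} (\<lambda>_. \<mu>)"

abbreviation configs :: "nat \<Rightarrow> (nat \<Rightarrow> 'a::topological_space) set" where
  "configs n \<equiv> space (power_measure n borel)"

definition empirical :: "nat \<Rightarrow> (nat \<Rightarrow> 'a::topological_space) \<Rightarrow> 'a measure" where
  "empirical n x = measure_of UNIV (sets borel)
     (\<lambda>A. (\<Sum>i<n. emeasure (return borel (x i)) A) / of_nat n)"

definition symmetric_fun :: "nat \<Rightarrow> ((nat \<Rightarrow> 'a::topological_space) \<Rightarrow> ereal) \<Rightarrow> bool" where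
  "symmetric_fun n w \<longleftrightarrow> (\<forall>p x. p permutes {..<n} \<longrightarrow> x \<in> configs n \<longrightarrow> w (x \<circ> p) = w x)"

definition W_tilde ::
  "(nat \<Rightarrow> (nat \<Rightarrow> 'a::topological_space) \<Rightarrow> ereal) \<Rightarrow> nat \<Rightarrow> 'a measure \<Rightarrow> ereal" where
  "W_tilde Wn n \<mu> = (if \<exists>x\<in>configs n. \<mu> = empirical n x
     then Wn n (SOME x. x \<in> configs n \<and> \<mu> = empirical n x) else \<infinity>)"

lemma sets_empirical [simp]: "sets (empirical n x) = sets borel"
  unfolding empirical_def using sets.sigma_sets_eq[of borel] by simp

lemma emeasure_empirical:
  assumes "A \<in> sets borel"
  shows "emeasure (empirical n x) A = (\<Sum>i<n. emeasure (return borel (x i)) A) / of_nat n"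
proof -
  let ?f = "\<lambda>A. (\<Sum>i<n. emeasure (return borel (x i)) A) / of_nat n"
  have "countably_additive (sets borel) ?f"
  proof (rule countably_additiveI)
    fix A :: "nat \<Rightarrow> 'a set"
    assume A: "range A \<subseteq> sets borel" "disjoint_family A" "\<Union> (range A) \<in> sets borel"
    have "(\<Sum>j. ?f (A j)) = (\<Sum>j. \<Sum>i<n. emeasure (return borel (x i)) (A j)) / of_nat n"
      by (simp add: divide_ennreal_def)
    also have "(\<Sum>j. \<Sum>i<n. emeasure (return borel (x i)) (A j)) =
        (\<Sum>i<n. \<Sum>j. emeasure (return borel (x i)) (A j))"
      by (intro suminf_sum) auto
    also have "\<dots> = (\<Sum>i<n. emeasure (return borel (x i)) (\<Union> (range A)))"
      using A by (intro sum.cong refl suminf_emeasure) auto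
    finally show "(\<Sum>j. ?f (A j)) = ?f (\<Union> (range A))" .
  qed
  moreover have "positive (sets borel) ?f" by (simp add: positive_def)
  ultimately show ?thesis
    using assms sets.sigma_algebra_axioms[of borel]
    by (intro emeasure_measure_of_sigma[of UNIV "sets borel" ?f A, folded empirical_def]) auto
qed

lemma empirical_in_prob_measures:
  assumes "n \<ge> 1"
  shows "empirical n x \<in> prob_measures"
proof -
  have "space (empirical n x) = UNIV"
    using sets_eq_imp_space_eq[OF sets_empirical] by simp
  then have "emeasure (empirical n x) (space (empirical n x)) = 1"
    using assms by (simp add: emeasure_empirical ennreal_divide_self of_nat_less_top)
  then show ?thesis by (auto simp: prob_measures_iff intro: prob_spaceI)
qed

lemma W_tilde_empirical:
  fixes x :: "nat \<Rightarrow> 'a::t2_space"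
  assumes n: "n \<ge> 1" and sym: "symmetric_fun n (Wn n)" and x: "x \<in> configs n"
  shows "W_tilde Wn n (empirical n x) = Wn n x"
proof -
  define y where "y = (SOME y. y \<in> configs n \<and> empirical n x = empirical n y)"
  have y: "y \<in> configs n" "empirical n x = empirical n y"
    using someI[of "\<lambda>y. y \<in> configs n \<and> empirical n x = empirical n y" x] x
    by (auto simp: y_def)
  have count: "(\<Sum>i<n. emeasure (return borel (z i)) {a}) =
      ennreal (real (card {i\<in>{..<n}. z i = a}))" for z :: "nat \<Rightarrow> 'a" and a
    by (simp add: indicator_def sum.If_cases Int_def conj_commute ennreal_of_nat_eq_real_of_nat)
  have "card {i\<in>{..<n}. x i = a} = card {i\<in>{..<n}. y i = a}" for a
  proof -
    have "ennreal (real (card {i\<in>{..<n}. x i = a})) / of_nat n =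
        ennreal (real (card {i\<in>{..<n}. y i = a})) / of_nat n"
      using emeasure_empirical[of "{a}" n x] emeasure_empirical[of "{a}" n y] y(2)
      by (simp add: count del: emeasure_return)
    then show ?thesis
      using n by (simp add: divide_ennreal ennreal_of_nat_eq_real_of_nat)
  qed
  moreover have "count (mset (map z [0..<n])) a = card {i\<in>{..<n}. z i = a}"
    for z :: "nat \<Rightarrow> 'a" and a
  proof -
    have "count (mset (map z [0..<n])) a = length (filter (\<lambda>b. a = b) (map z [0..<n]))"
      by (simp only: count_mset count_list_eq_length_filter)
    also have "\<dots> = card {i. i < n \<and> a = map z [0..<n] ! i}"
      by (simp only: length_filter_conv_card length_map length_upt diff_zero)
    also have "{i. i < n \<and> a = map z [0..<n] ! i} = {i\<in>{..<n}. z i = a}"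
      by auto
    finally show ?thesis .
  qed
  ultimately have "mset (map y [0..<n]) = mset (map x [0..<n])"
    by (intro multiset_eqI) metis
  then obtain p where p: "p permutes {..<length (map x [0..<n])}"
      "permute_list p (map x [0..<n]) = map y [0..<n]"
    by (rule mset_eq_permutation)
  then have pn: "p permutes {..<n}" by simp
  have "y i = x (p i)" for i
  proof (cases "i < n")
    case True
    then have "p i < n" using permutes_in_image[OF pn, of i] by simp
    then show ?thesis
      using True arg_cong[OF p(2), of "\<lambda>l. l ! i"] permute_list_nth[OF p(1), of i] by simp
  next
    case False
    then show ?thesis
      using x y(1) permutes_not_in[OF pn, of i] by (auto simp: space_PiM PiE_def extensional_def)
  qed
  then have "y = x \<circ> p" by auto
  then have "Wn n y = Wn n x" using sym x pn by (auto simp: symmetric_fun_def)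
  then show ?thesis using x unfolding W_tilde_def y_def by auto
qed

subsection \<open>Assumptions on the sequence of energies\<close>

definition stable :: "(nat \<Rightarrow> (nat \<Rightarrow> 'a::topological_space) \<Rightarrow> ereal) \<Rightarrow> bool" where
  "stable Wn \<longleftrightarrow> (\<exists>C::real. \<forall>n\<ge>1. \<forall>x\<in>configs n. ereal C \<le> Wn n x)"

definition confining :: "(nat \<Rightarrow> (nat \<Rightarrow> 'a::topological_space) \<Rightarrow> ereal) \<Rightarrow> bool" where
  "confining Wn \<longleftrightarrow> (\<forall>(nj :: nat \<Rightarrow> nat) \<mu>j.
     strict_mono nj \<and> (\<forall>j. nj j \<ge> 1) \<and> (\<forall>j. \<mu>j j \<in> prob_measures) \<and>
     (\<exists>A::real. \<forall>j. W_tilde Wn (nj j) (\<mu>j j) \<le> ereal A)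
     \<longrightarrow> relatively_compact_in weak_topology (range \<mu>j))"

definition lower_limit ::
  "(nat \<Rightarrow> (nat \<Rightarrow> 'a::topological_space) \<Rightarrow> ereal) \<Rightarrow> ('a measure \<Rightarrow> ereal) \<Rightarrow> bool" where
  "lower_limit Wn W \<longleftrightarrow> (\<forall>\<mu>n \<mu>.
     (\<forall>n. \<mu>n n \<in> prob_measures) \<and> limitin weak_topology \<mu>n \<mu> sequentially
     \<longrightarrow> W \<mu> \<le> liminf (\<lambda>n. W_tilde Wn n (\<mu>n n)))"

definition upper_limit ::
  "(nat \<Rightarrow> (nat \<Rightarrow> 'a::topological_space) \<Rightarrow> ereal) \<Rightarrow> ('a measure \<Rightarrow> ereal) \<Rightarrow> bool" where
  "upper_limit Wn W \<longleftrightarrow>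
     (\<forall>\<mu>\<in>prob_measures. limsup (\<lambda>n. eintegral (power_measure n \<mu>) (Wn n)) \<le> W \<mu>)"

definition regular_measures ::
  "'a::topological_space measure \<Rightarrow> (nat \<Rightarrow> (nat \<Rightarrow> 'a) \<Rightarrow> ereal) \<Rightarrow> ('a measure \<Rightarrow> ereal)
    \<Rightarrow> 'a measure set" where
  "regular_measures \<pi> Wn W = {\<mu> \<in> prob_measures. relative_entropy \<mu> \<pi> < \<infinity> \<and>
     limsup (\<lambda>n. eintegral (power_measure n \<mu>) (Wn n)) \<le> W \<mu>}"

definition regularity ::
  "'a::topological_space measure \<Rightarrow> (nat \<Rightarrow> (nat \<Rightarrow> 'a) \<Rightarrow> ereal) \<Rightarrow> ('a measure \<Rightarrow> ereal)
    \<Rightarrow> bool" where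
  "regularity \<pi> Wn W \<longleftrightarrow> (\<forall>\<mu>\<in>prob_measures. W \<mu> < \<infinity> \<longrightarrow>
     (\<exists>\<mu>n. (\<forall>n. \<mu>n n \<in> regular_measures \<pi> Wn W) \<and>
        limitin weak_topology \<mu>n \<mu> sequentially \<and> limsup (\<lambda>n. W (\<mu>n n)) \<le> W \<mu>))"

definition positive_temperature_limit ::
  "(nat \<Rightarrow> (nat \<Rightarrow> 'a::topological_space) \<Rightarrow> ereal) \<Rightarrow> ('a measure \<Rightarrow> ereal) \<Rightarrow> bool" where
  "positive_temperature_limit Wn W \<longleftrightarrow> lower_limit Wn W \<and> upper_limit Wn W"

definition zero_temperature_limit ::
  "'a::topological_space measure \<Rightarrow> (nat \<Rightarrow> (nat \<Rightarrow> 'a) \<Rightarrow> ereal) \<Rightarrow> ('a measure \<Rightarrow> ereal)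
    \<Rightarrow> bool" where
  "zero_temperature_limit \<pi> Wn W \<longleftrightarrow> lower_limit Wn W \<and> regularity \<pi> Wn W"

subsection \<open>Gibbs measures and free energy\<close>

definition gibbs_measure ::
  "'a::topological_space measure \<Rightarrow> (nat \<Rightarrow> (nat \<Rightarrow> 'a) \<Rightarrow> ereal) \<Rightarrow> (nat \<Rightarrow> real) \<Rightarrow> nat
    \<Rightarrow> (nat \<Rightarrow> 'a) measure" where
  "gibbs_measure \<pi> Wn \<beta>n n =
     density (power_measure n \<pi>) (\<lambda>x. eexp (- (ereal (real n * \<beta>n n) * Wn n x)))"

text \<open>In \<open>ereal\<close>, \<open>1 / \<infinity> = 0\<close> and \<open>0 * \<infinity> = 0\<close>, so this is \<open>W\<close> when \<open>\<beta> = \<infinity>\<close>.\<close>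
definition free_energy ::
  "'a::topological_space measure \<Rightarrow> ('a measure \<Rightarrow> ereal) \<Rightarrow> ereal \<Rightarrow> 'a measure \<Rightarrow> ereal" where
  "free_energy \<pi> W \<beta> \<mu> = W \<mu> + 1 / \<beta> * relative_entropy \<mu> \<pi>"

lemma free_energy_infinity: "free_energy \<pi> W \<infinity> \<mu> = W \<mu>"
  by (simp add: free_energy_def)

end

theory Submission
  imports Defs "HOL-Real_Asymp.Real_Asymp" "HOL-Library.Discrete_Functions"
begin

text \<open>
  Write \<open>Z\<^sub>n\<close> for the integral in the theorem. The lower bound for \<open>Z\<^sub>n\<close> is the Gibbs
  variational inequality with a product measure \<open>\<mu>\<^sup>n\<close> as trial measure, together with the weak
  law of large numbers \<open>i\<^sub>n \<rightarrow> \<mu>\<close> in probability.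

  For the upper bound, take a countable base \<open>E\<^sub>0, E\<^sub>1, \<dots>\<close> of open sets closed under finite
  unions, and let \<open>H\<^sub>m(\<nu>)\<close> be the entropy of \<open>\<nu>\<close> relative to \<open>\<pi>\<close> on the finite partition
  generated by \<open>E\<^sub>0, \<dots>, E\<^bsub>m-1\<^esub>\<close>. By the method of types, the integral of \<open>exp (n H\<^sub>m(i\<^sub>n))\<close> against
  \<open>\<pi>\<^sup>n\<close> is at most \<open>(n + 1)\<close> to the power \<open>2\<^sup>m\<close>, which is negligible on the exponential scale if
  \<open>4\<^sup>m \<le> n\<close>. Hence some configuration \<open>x\<^sub>n\<close> has \<open>f + W\<^sub>n + H\<^sub>m / \<beta>\<^sub>n\<close> almost as small as
  \<open>- (n \<beta>\<^sub>n)\<^sup>-\<^sup>1 log Z\<^sub>n\<close>. If \<open>\<beta> < \<infinity>\<close>, the bound on \<open>H\<^sub>m\<close> replaces tightness: along a diagonal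
  subsequence the masses of all cells converge, the limiting densities with respect to \<open>\<pi>\<close> are
  Cauchy in \<open>L\<^sup>1\<close> as the partition is refined, and their limit is the density of a measure to
  which the empirical measures converge weakly. If \<open>\<beta> = \<infinity>\<close>, compactness comes from the
  confinement assumption. In both cases the lower limit assumption concludes.
\<close>

section \<open>The weak topology\<close>

text \<open>An empirical measure usually has infinite entropy relative to \<open>\<pi>\<close>,
  while its entropy on a finite partition is finite off a null set of configurations. The partition
  cannot stay fixed: configurations selected at one level would yield a limit depending on that
  level, whereas the free energy needs one measure satisfying the bounds of all levels. The level
  therefore grows with \<open>n\<close>, and monotonicity under refinement returns the bound to
  every fixed level. Counting types limits the growth: as 1 / \<open>\<beta>n n\<close> is bounded,
  the cost is of order log (n + 1) / sqrt n when 2 ^ m is at most sqrt n.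

  Limits of cell masses alone need not come from a measure, because mass can disappear as the cells
  shrink. Bounded entropy excludes this: its increments dominate squared Hellinger distances of
  successive densities, which become summable along suitable levels.

  Both regimes share the parameter \<open>\<tau>\<close>, the limit of 1 /
  \<open>\<beta>n n\<close>. At \<open>\<tau>\<close> = 0 a trial measure pays nothing for its
  entropy as long as it is finite.\<close>

lemma limitin_weak_topologyI:
  fixes \<mu> :: "'a::topological_space measure"
  assumes \<mu>: "\<mu> \<in> prob_measures" and \<nu>: "\<And>k. \<nu> k \<in> prob_measures"
    and lim: "\<And>g :: 'a \<Rightarrow> real. continuous_on UNIV g \<Longrightarrow> bounded (range g) \<Longrightarrow>
      ((\<lambda>k. \<integral>x. g x \<partial>\<nu> k) \<longlongrightarrow> (\<integral>x. g x \<partial>\<mu>)) F"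
  shows "limitin weak_topology \<nu> \<mu> F"
  unfolding limitin_def topspace_weak_topology
proof (intro conjI allI impI \<mu>; elim conjE)
  fix U :: "'a measure set"
  \<comment> \<open>Eventual membership survives finite intersections and, through one member
    containing \<open>\<mu>\<close>, arbitrary unions; hence only subbasic sets have to be
    examined.\<close>
  assume "openin weak_topology U" "\<mu> \<in> U"
  then have "generate_topology_on {{\<mu> \<in> prob_measures. (\<integral>x. f x \<partial>\<mu>) \<in> U} | (f :: 'a \<Rightarrow> real) U.
        continuous_on UNIV f \<and> bounded (range f) \<and> open U} U" "\<mu> \<in> U"
    by (auto simp: weak_topology_def openin_topology_generated_by_iff)
  then show "\<forall>\<^sub>F k in F. \<nu> k \<in> U"
  proof (induction rule: generate_topology_on.induct)
    case Empty
    then show ?case by simp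
  next
    case (Int a b)
    then show ?case by (simp add: eventually_conj)
  next
    case (UN K)
    then obtain k where "k \<in> K" "\<mu> \<in> k" by auto
    with UN.IH[of k] show ?case by (auto elim: eventually_mono)
  next
    case (Basis s)
    then obtain f :: "'a \<Rightarrow> real" and V where s: "s = {\<mu> \<in> prob_measures. (\<integral>x. f x \<partial>\<mu>) \<in> V}"
      and f: "continuous_on UNIV f" "bounded (range f)" "open V"
      by auto
    with Basis(2) have "(\<integral>x. f x \<partial>\<mu>) \<in> V" by simp
    from topological_tendstoD[OF lim[OF f(1,2)] f(3) this] show ?case
      using \<nu> by (simp add: s)
  qed
qed

text \<open>
  The laws of a bounded continuous \<open>g\<close> converge weakly on the real line because the sets
  \<open>{g < t}\<close> and \<open>{g > t}\<close> are open.
\<close>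
lemma limitin_weak_topology_openI:
  fixes \<mu> :: "'a::topological_space measure"
  assumes \<mu>: "\<mu> \<in> prob_measures" and \<nu>: "\<And>k. \<nu> k \<in> prob_measures"
    and lower: "\<And>U c. open U \<Longrightarrow> c < measure \<mu> U \<Longrightarrow> \<forall>\<^sub>F k in sequentially. c < measure (\<nu> k) U"
  shows "limitin weak_topology \<nu> \<mu> sequentially"
proof (rule limitin_weak_topologyI[OF \<mu> \<nu>])
  fix g :: "'a \<Rightarrow> real"
  assume g: "continuous_on UNIV g" "bounded (range g)"
  have [measurable]: "g \<in> borel_measurable borel"
    by (rule borel_measurable_continuous_onI[OF g(1)])
  obtain B where B: "\<And>x. \<bar>g x\<bar> \<le> B"
    using g(2) by (auto simp: bounded_iff)
  then have "0 \<le> B" using order_trans[OF abs_ge_zero] by blast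
  have sets [measurable_cong]: "sets \<mu> = sets borel" "\<And>k. sets (\<nu> k) = sets borel"
    using \<mu> \<nu> by (auto simp: prob_measures_iff)
  note space = sets_eq_imp_space_eq[OF sets(1)] sets_eq_imp_space_eq[OF sets(2)]
  interpret M: prob_space \<mu> using \<mu> by (simp add: prob_measures_iff)
  interpret N: prob_space "\<nu> k" for k using \<nu> by (simp add: prob_measures_iff)
  interpret D: real_distribution "distr \<mu> borel g" by simp
  have lt: "open {x. g x < t}" and gt: "open {x. t < g x}" for t
    using g(1) by (auto intro!: open_Collect_less)
  have mM: "measure (distr \<mu> borel g) A = measure \<mu> (g -` A)" if "A \<in> sets borel" for A
    using that by (subst measure_distr) (auto simp: space)
  have mN: "measure (distr (\<nu> k) borel g) A = measure (\<nu> k) (g -` A)" if "A \<in> sets borel" for A k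
    using that by (subst measure_distr) (auto simp: space)
  have conv: "weak_conv_m (\<lambda>k. distr (\<nu> k) borel g) (distr \<mu> borel g)"
    unfolding weak_conv_m_def weak_conv_def
  proof (intro allI impI)
    fix t
    \<comment> \<open>At a continuity point the level set {g = t} is null, so the open set {g < t}
      bounds the distribution function from below and {t < g} bounds it from above.\<close>
    assume "isCont (cdf (distr \<mu> borel g)) t"
    then have "measure (distr \<mu> borel g) {t} = 0" by (simp add: D.isCont_cdf)
    moreover have "{..t} = {..<t} \<union> {t}" by auto
    ultimately have "measure (distr \<mu> borel g) {..t} = measure (distr \<mu> borel g) {..<t}"
      using D.finite_measure_Union[of "{..<t}" "{t}"] by simp
    then have eq: "cdf (distr \<mu> borel g) t = measure \<mu> {x. g x < t}"
      by (simp add: cdf_def mM vimage_def)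
    have cN: "cdf (distr (\<nu> k) borel g) t = measure (\<nu> k) {x. g x \<le> t}" for k
      by (simp add: cdf_def mN vimage_def)
    have cM: "cdf (distr \<mu> borel g) t = measure \<mu> {x. g x \<le> t}"
      by (simp add: cdf_def mM vimage_def)
    have compl: "measure \<mu> {x. t < g x} = 1 - measure \<mu> {x. g x \<le> t}"
      "measure (\<nu> k) {x. t < g x} = 1 - measure (\<nu> k) {x. g x \<le> t}" for k
      using M.prob_compl[of "{x. g x \<le> t}"] N.prob_compl[of "{x. g x \<le> t}" k]
      by (simp_all add: space Compl_eq_Diff_UNIV[symmetric] Collect_neg_eq[symmetric] not_le sets)
    show "(\<lambda>k. cdf (distr (\<nu> k) borel g) t) \<longlonglongrightarrow> cdf (distr \<mu> borel g) t"
    proof (rule order_tendstoI)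
      fix c assume "c < cdf (distr \<mu> borel g) t"
      from lower[OF lt this[unfolded eq]]
      show "\<forall>\<^sub>F k in sequentially. c < cdf (distr (\<nu> k) borel g) t"
      proof eventually_elim
        case (elim k)
        also have "measure (\<nu> k) {x. g x < t} \<le> measure (\<nu> k) {x. g x \<le> t}"
          by (rule N.finite_measure_mono) (auto simp: sets)
        finally show ?case by (simp add: cN)
      qed
    next
      fix c assume "cdf (distr \<mu> borel g) t < c"
      then have "1 - c < measure \<mu> {x. t < g x}" by (simp add: cM compl)
      from lower[OF gt this]
      show "\<forall>\<^sub>F k in sequentially. cdf (distr (\<nu> k) borel g) t < c"
        by eventually_elim (simp add: cN compl)
    qed
  qed
  \<comment> \<open>The identity is clamped to [-B, B] to give a bounded continuous test function on
    the line; on the range of \<open>g\<close> the clamping has no effect.\<close>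
  have "(\<lambda>k. integral\<^sup>L (distr (\<nu> k) borel g) (\<lambda>y. max (-B) (min B y)))
      \<longlonglongrightarrow> integral\<^sup>L (distr \<mu> borel g) (\<lambda>y. max (-B) (min B y))"
    by (rule weak_conv_imp_integral_bdd_continuous_conv[OF _ D.real_distribution_axioms conv, where B = B])
      (use \<open>0 \<le> B\<close> in \<open>auto intro!: continuous_intros\<close>)
  moreover have "max (-B) (min B (g x)) = g x" for x
    using B[of x] by auto
  ultimately show "(\<lambda>k. \<integral>x. g x \<partial>\<nu> k) \<longlonglongrightarrow> (\<integral>x. g x \<partial>\<mu>)"
    by (simp add: integral_distr)
qed

text \<open>Finite unions of members of a countable base form such a sequence. Exhausting an open
  set by single members of an increasing sequence makes continuity from below directly
  applicable.\<close>

lemma open_set_sequence: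
  obtains E :: "nat \<Rightarrow> 'a::second_countable_topology set"
  where "\<And>i. open (E i)"
    "\<And>U. open U \<Longrightarrow> \<exists>s. incseq (\<lambda>n. E (s n)) \<and> U = (\<Union>n. E (s n))"
proof -
  obtain B :: "'a set set" where B: "countable B" "topological_basis B"
    using ex_countable_basis by blast
  define A where "A = Union ` {F. finite F \<and> F \<subseteq> B}"
  have A: "countable A" "A \<noteq> {}"
    unfolding A_def using B(1) by (auto intro!: countable_image countable_Collect_finite_subset)
  show thesis
  proof (rule that[of "from_nat_into A"])
    fix i
    have "from_nat_into A i \<in> A" using A(2) by (rule from_nat_into)
    then obtain F where "F \<subseteq> B" "from_nat_into A i = \<Union>F" by (auto simp: A_def)
    then show "open (from_nat_into A i)"
      using topological_basis_open[OF B(2)] open_Union[of F] by auto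
  next
    fix U :: "'a set" assume "open U"
    then obtain B' where B': "B' \<subseteq> B" "U = \<Union>B'"
      using B(2) by (metis topological_basis_def)
    \<comment> \<open>Adding the empty set keeps the range nonempty when \<open>U\<close> is empty;
      it is discarded again in the finite unions.\<close>
    define b where "b = from_nat_into (insert {} B')"
    have b: "range b = insert {} B'"
      unfolding b_def using countable_subset[OF B'(1) B(1)] by (intro range_from_nat_into) auto
    define C where "C n = \<Union>(b ` {..<n})" for n
    have "C n \<in> A" for n
    proof -
      have "C n = \<Union>(b ` {..<n} - {{}})" by (auto simp: C_def)
      moreover have "b ` {..<n} - {{}} \<subseteq> B" using b B'(1) by auto
      ultimately show ?thesis unfolding A_def by (intro image_eqI) auto
    qed
    then have "\<exists>j. from_nat_into A j = C n" for n
      using from_nat_into_surj[OF A(1)] by blast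
    then obtain s where s: "from_nat_into A (s n) = C n" for n
      by metis
    have "incseq C" unfolding incseq_def C_def by (fastforce intro: order_less_le_trans)
    moreover have "U = (\<Union>n. C n)"
    proof -
      have "(\<Union>n. C n) = \<Union>(range b)" by (auto simp: C_def)
      then show ?thesis using b B'(2) by simp
    qed
    ultimately show "\<exists>s. incseq (\<lambda>n. from_nat_into A (s n)) \<and> U = (\<Union>n. from_nat_into A (s n))"
      by (intro exI[of _ s]) (simp add: s)
  qed
qed

text \<open>By continuity from below, a base member inside an open set already carries more than any
  mass \<open>c\<close> below that of the open set.\<close>

lemma limitin_weak_topology_baseI:
  fixes \<mu> :: "'a::second_countable_topology measure"
  assumes \<mu>: "\<mu> \<in> prob_measures" and \<nu>: "\<And>k. \<nu> k \<in> prob_measures"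
    and E: "\<And>i. open (E i)"
      "\<And>U. open U \<Longrightarrow> \<exists>s. incseq (\<lambda>n. E (s n)) \<and> U = (\<Union>n. E (s n))"
    and lower: "\<And>i c. c < measure \<mu> (E i) \<Longrightarrow> \<forall>\<^sub>F k in sequentially. c < measure (\<nu> k) (E i)"
  shows "limitin weak_topology \<nu> \<mu> sequentially"
proof (rule limitin_weak_topology_openI[OF \<mu> \<nu>])
  fix U :: "'a set" and c assume U: "open U" and c: "c < measure \<mu> U"
  obtain s where s: "incseq (\<lambda>n. E (s n))" "U = (\<Union>n. E (s n))"
    using E(2)[OF U] by blast
  have sets: "sets \<mu> = sets borel" "\<And>k. sets (\<nu> k) = sets borel"
    using \<mu> \<nu> by (auto simp: prob_measures_iff)
  interpret M: prob_space \<mu> using \<mu> by (simp add: prob_measures_iff)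
  interpret N: prob_space "\<nu> k" for k using \<nu> by (simp add: prob_measures_iff)
  have "(\<lambda>n. measure \<mu> (E (s n))) \<longlonglongrightarrow> measure \<mu> U"
    unfolding s(2) using E(1) s(1) by (intro M.finite_Lim_measure_incseq) (auto simp: sets)
  from order_tendstoD(1)[OF this c] obtain n where "c < measure \<mu> (E (s n))"
    by (auto simp: eventually_sequentially)
  from lower[OF this] show "\<forall>\<^sub>F k in sequentially. c < measure (\<nu> k) U"
  proof eventually_elim
    case (elim k)
    also have "measure (\<nu> k) (E (s n)) \<le> measure (\<nu> k) U"
      by (rule N.finite_measure_mono) (use U s(2) in \<open>auto simp: sets\<close>)
    finally show ?case .
  qed
qed

text \<open>If every point of the compact closure had a neighbourhood that the sequence eventually
  avoids, finitely many of them would cover the closure and the sequence would eventually avoid it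
  altogether. In a general topology this yields only a cluster point; a convergent subsequence must
  be found by other means.\<close>

lemma relatively_compact_in_cluster_point:
  fixes \<nu> :: "nat \<Rightarrow> 'b"
  assumes "relatively_compact_in X S" and \<nu>: "range \<nu> \<subseteq> S"
  obtains \<mu> where "\<mu> \<in> topspace X"
    "\<And>U. openin X U \<Longrightarrow> \<mu> \<in> U \<Longrightarrow> \<exists>\<^sub>F k in sequentially. \<nu> k \<in> U"
proof -
  let ?K = "X closure_of S"
  have "S \<subseteq> topspace X" and K: "compactin X ?K"
    using assms by (simp_all add: relatively_compact_in_def)
  then have sub: "range \<nu> \<subseteq> ?K" using \<nu> closure_of_subset by blast
  have "\<exists>\<mu>\<in>?K. \<forall>U. openin X U \<longrightarrow> \<mu> \<in> U \<longrightarrow> (\<exists>\<^sub>F k in sequentially. \<nu> k \<in> U)"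
  proof (rule ccontr)
    assume "\<not> ?thesis"
    then have "\<forall>\<mu>\<in>?K. \<exists>U. openin X U \<and> \<mu> \<in> U \<and> (\<forall>\<^sub>F k in sequentially. \<nu> k \<notin> U)"
      by (simp add: frequently_def)
    then obtain U where U: "\<And>\<mu>. \<mu> \<in> ?K \<Longrightarrow> openin X (U \<mu>)" "\<And>\<mu>. \<mu> \<in> ?K \<Longrightarrow> \<mu> \<in> U \<mu>"
      "\<And>\<mu>. \<mu> \<in> ?K \<Longrightarrow> \<forall>\<^sub>F k in sequentially. \<nu> k \<notin> U \<mu>"
      by metis
    then have "\<exists>F. finite F \<and> F \<subseteq> U ` ?K \<and> ?K \<subseteq> \<Union>F"
      using K[unfolded compactin_def, THEN conjunct2, rule_format, of "U ` ?K"] U(1,2) by blast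
    then obtain F where F: "finite F" "F \<subseteq> U ` ?K" "?K \<subseteq> \<Union>F" by blast
    then have "\<forall>\<^sub>F k in sequentially. \<forall>V\<in>F. \<nu> k \<notin> V"
      using U(3) by (intro eventually_ball_finite) auto
    then obtain k where "\<forall>V\<in>F. \<nu> k \<notin> V"
      by (auto simp: eventually_sequentially)
    with F(3) sub show False by blast
  qed
  then show thesis
    using that compactin_subset_topspace[OF K] by blast
qed

text \<open>A countable power of [-1, 1] is compact by Tychonoff and metrizable, hence sequentially
  compact; this packages the diagonal argument.\<close>

lemma bounded_sequences_convergent_subsequence:
  fixes a :: "nat \<Rightarrow> 'i::countable \<Rightarrow> real"
  assumes "\<And>k i. \<bar>a k i\<bar> \<le> 1"
  obtains r l where "strict_mono r" "\<And>i. (\<lambda>k. a (r k) i) \<longlonglongrightarrow> l i"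
proof -
  have "compact (PiE UNIV (\<lambda>_::'i. {-1..1::real}))"
    using compactin_PiE[where X = "\<lambda>_. euclidean" and I = "UNIV :: 'i set" and S = "\<lambda>_. {-1..1::real}"]
    by (simp add: euclidean_product_topology)
  then have "seq_compact (PiE UNIV (\<lambda>_::'i. {-1..1::real}))"
    by (simp add: compact_eq_seq_compact_metric)
  moreover have "\<forall>k. a k \<in> PiE UNIV (\<lambda>_. {-1..1})"
    using assms by (auto simp: abs_le_iff minus_le_iff)
  ultimately obtain l r where r: "strict_mono r" "(a \<circ> r) \<longlonglongrightarrow> l"
    unfolding seq_compact_def by metis
  show thesis
  proof (rule that[OF r(1)])
    fix i
    show "(\<lambda>k. a (r k) i) \<longlonglongrightarrow> l i"
      using continuous_on_tendsto_compose[OF continuous_on_product_coordinates[of i] r(2)]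
      by simp
  qed
qed

text \<open>
  The integrals of the functions \<open>min 1 (m d(x, - E i))\<close> converge along a diagonal subsequence,
  and any cluster point of it must then be its limit.
\<close>
lemma relatively_compact_in_weak_topology_subsequence:
  fixes \<nu> :: "nat \<Rightarrow> 'a::{metric_space, second_countable_topology} measure"
  assumes rc: "relatively_compact_in weak_topology (range \<nu>)"
  obtains r \<mu> where "strict_mono r" "\<mu> \<in> prob_measures"
    "limitin weak_topology (\<nu> \<circ> r) \<mu> sequentially"
proof -
  have \<nu>: "\<nu> k \<in> prob_measures" for k
    using rc by (auto simp: relatively_compact_in_def)
  interpret N: prob_space "\<nu> k" for k using \<nu> by (simp add: prob_measures_iff)
  have sets\<nu> [measurable_cong]: "sets (\<nu> k) = sets borel" for k
    using \<nu> by (simp add: prob_measures_iff)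
  obtain E :: "nat \<Rightarrow> 'a set" where E: "\<And>i. open (E i)"
    "\<And>U. open U \<Longrightarrow> \<exists>s. incseq (\<lambda>n. E (s n)) \<and> U = (\<Union>n. E (s n))"
    using open_set_sequence by blast
  have [measurable]: "E i \<in> sets borel" for i using E(1) by simp
  \<comment> \<open>As \<open>m\<close> grows, these continuous functions increase to the indicator
    of \<open>E i\<close>, unless \<open>E i\<close> is the whole space.\<close>
  define \<phi> where "\<phi> i m x = min 1 (real m * infdist x (- E i))" for i m x
  have \<phi>_cont: "continuous_on UNIV (\<phi> i m)" for i m
    unfolding \<phi>_def by (intro continuous_intros)
  have \<phi>_range: "0 \<le> \<phi> i m x" "\<phi> i m x \<le> 1" for i m x
    unfolding \<phi>_def by (auto simp: infdist_nonneg)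
  have \<phi>_bdd: "bounded (range (\<phi> i m))" for i m
    using \<phi>_range by (auto simp: bounded_iff intro!: exI[of _ 1])
  have [measurable]: "\<phi> i m \<in> borel_measurable borel" for i m
    by (rule borel_measurable_continuous_onI[OF \<phi>_cont])
  define a where "a k = (\<lambda>(i, m). \<integral>x. \<phi> i m x \<partial>\<nu> k)" for k
  have "\<bar>a k im\<bar> \<le> 1" for k im
  proof -
    obtain i m where im: "im = (i, m)" by force
    have "\<integral>x. \<phi> i m x \<partial>\<nu> k \<le> (\<integral>x. 1 \<partial>\<nu> k)"
      using \<phi>_range by (intro integral_mono N.integrable_const_bound[where B=1]) auto
    moreover have "0 \<le> (\<integral>x. \<phi> i m x \<partial>\<nu> k)"
      using \<phi>_range by (intro Bochner_Integration.integral_nonneg) auto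
    ultimately show ?thesis by (simp add: a_def im N.prob_space)
  qed
  then obtain r l where r: "strict_mono r" and l: "\<And>im. (\<lambda>k. a (r k) im) \<longlonglongrightarrow> l im"
    using bounded_sequences_convergent_subsequence[of a] by metis
  have "range (\<nu> \<circ> r) \<subseteq> range \<nu>" by auto
  then obtain \<mu> where "\<mu> \<in> topspace weak_topology" and
    cluster: "\<And>U. openin weak_topology U \<Longrightarrow> \<mu> \<in> U \<Longrightarrow> \<exists>\<^sub>F k in sequentially. (\<nu> \<circ> r) k \<in> U"
    using relatively_compact_in_cluster_point[OF rc] by metis
  then have \<mu>: "\<mu> \<in> prob_measures" by simp
  interpret M: prob_space \<mu> using \<mu> by (simp add: prob_measures_iff)
  have sets\<mu> [measurable_cong]: "sets \<mu> = sets borel"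
    using \<mu> by (simp add: prob_measures_iff)
  have l_eq: "l (i, m) = (\<integral>x. \<phi> i m x \<partial>\<mu>)" for i m
  proof (rule ccontr)
    assume ne: "\<not> ?thesis"
    define e where "e = \<bar>l (i, m) - (\<integral>x. \<phi> i m x \<partial>\<mu>)\<bar> / 2"
    then have "e > 0" using ne by simp
    let ?U = "{\<nu> \<in> prob_measures. (\<integral>x. \<phi> i m x \<partial>\<nu>) \<in> ball (\<integral>x. \<phi> i m x \<partial>\<mu>) e}"
    have "openin weak_topology ?U"
      using openin_continuous_map_preimage[OF continuous_map_weak_topology_integral[OF \<phi>_cont \<phi>_bdd]]
      by (metis open_ball open_openin topspace_weak_topology)
    from cluster[OF this] \<mu> \<open>e > 0\<close> have "\<exists>\<^sub>F k in sequentially. (\<nu> \<circ> r) k \<in> ?U" by simp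
    moreover have "\<forall>\<^sub>F k in sequentially. dist (a (r k) (i, m)) (l (i, m)) < e"
      using l[of "(i, m)"] \<open>e > 0\<close> by (simp add: tendsto_iff)
    ultimately have "\<exists>\<^sub>F k in sequentially. (\<nu> \<circ> r) k \<in> ?U \<and> dist (a (r k) (i, m)) (l (i, m)) < e"
      by (rule frequently_eventually_frequently)
    then obtain k where "(\<nu> \<circ> r) k \<in> ?U" "dist (a (r k) (i, m)) (l (i, m)) < e"
      by (auto dest: frequently_ex)
    then have "\<bar>(\<integral>x. \<phi> i m x \<partial>\<mu>) - a (r k) (i, m)\<bar> < e" "\<bar>a (r k) (i, m) - l (i, m)\<bar> < e"
      by (simp_all add: a_def dist_real_def)
    moreover have "\<bar>l (i, m) - (\<integral>x. \<phi> i m x \<partial>\<mu>)\<bar> = 2 * e" by (simp add: e_def)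
    ultimately show False by linarith
  qed
  have \<nu>r: "(\<nu> \<circ> r) k \<in> prob_measures" for k using \<nu> by simp
  have "limitin weak_topology (\<nu> \<circ> r) \<mu> sequentially"
  proof (rule limitin_weak_topology_baseI[OF \<mu> \<nu>r E])
    fix i c assume c: "c < measure \<mu> (E i)"
    show "\<forall>\<^sub>F k in sequentially. c < measure ((\<nu> \<circ> r) k) (E i)"
    proof (cases "E i = UNIV")
      \<comment> \<open>\<open>infdist\<close> to the empty set is 0, so the functions
        \<open>\<phi> i m\<close> vanish when \<open>E i\<close> is the whole space; this case
        compares total masses instead.\<close>
      case True
      then show ?thesis
        using c M.prob_space N.prob_space sets_eq_imp_space_eq[OF sets\<mu>] sets_eq_imp_space_eq[OF sets\<nu>]
        by (simp add: o_def)
    next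
      case False
      have \<phi>_le: "\<phi> i m x \<le> indicator (E i) x" for m x
        using \<phi>_range(2)[of i m x] by (cases "x \<in> E i") (auto simp: \<phi>_def)
      have "(\<lambda>m. \<integral>x. \<phi> i m x \<partial>\<mu>) \<longlonglongrightarrow> (\<integral>x. indicator (E i) x \<partial>\<mu>)"
      proof (rule integral_dominated_convergence[where w = "\<lambda>_. 1"])
        show "AE x in \<mu>. (\<lambda>m. \<phi> i m x) \<longlonglongrightarrow> indicator (E i) x"
        proof (rule AE_I2)
          fix x
          show "(\<lambda>m. \<phi> i m x) \<longlonglongrightarrow> indicator (E i) x"
          proof (cases "x \<in> E i")
            case True
            then have "infdist x (- E i) \<noteq> 0"
              using False E(1)[of i] in_closed_iff_infdist_zero[of "- E i" x] by auto
            then have "infdist x (- E i) > 0" by (simp add: less_le infdist_nonneg)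
            then obtain N where N: "1 < real N * infdist x (- E i)"
              using reals_Archimedean3 by blast
            have "\<phi> i m x = 1" if "m \<ge> N" for m
            proof -
              have "real N * infdist x (- E i) \<le> real m * infdist x (- E i)"
                using that by (intro mult_right_mono) (simp_all add: infdist_nonneg)
              then show ?thesis using N by (simp add: \<phi>_def)
            qed
            then show ?thesis
              using True by (intro tendsto_eventually) (auto simp: eventually_sequentially)
          next
            case False
            then have "\<phi> i m x = 0" for m by (simp add: \<phi>_def)
            then show ?thesis using False by simp
          qed
        qed
      qed (use \<phi>_range in auto)
      also have "(\<integral>x. indicator (E i) x \<partial>\<mu>) = measure \<mu> (E i)"
        using E(1) by (simp add: sets\<mu> sets_eq_imp_space_eq[OF sets\<mu>])
      finally have "(\<lambda>m. \<integral>x. \<phi> i m x \<partial>\<mu>) \<longlonglongrightarrow> measure \<mu> (E i)" .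
      from order_tendstoD(1)[OF this c] obtain m where "c < (\<integral>x. \<phi> i m x \<partial>\<mu>)"
        by (auto simp: eventually_sequentially)
      with order_tendstoD(1)[OF l[of "(i, m)"]] have "\<forall>\<^sub>F k in sequentially. c < a (r k) (i, m)"
        by (simp add: l_eq)
      then show ?thesis
      proof eventually_elim
        case (elim k)
        also have "a (r k) (i, m) \<le> (\<integral>x. indicator (E i) x \<partial>\<nu> (r k))"
          unfolding a_def prod.case using \<phi>_range E(1) \<phi>_le
          by (intro integral_mono N.integrable_const_bound[where B=1]) auto
        also have "\<dots> = measure (\<nu> (r k)) (E i)"
          using E(1) by (simp add: sets\<nu> sets_eq_imp_space_eq[OF sets\<nu>])
        finally show ?case by simp
      qed
    qed
  qed
  then show thesis using that r \<mu> by blast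
qed

section \<open>Empirical measures\<close>

text \<open>As the law of \<open>x\<close> at a uniformly chosen index, the empirical measure
  inherits the rules for image measures, and integrals and masses become averages.\<close>

lemma empirical_eq_distr:
  assumes "n \<ge> 1"
  shows "empirical n x = distr (measure_pmf (pmf_of_set {..<n})) borel x"
proof (rule measure_eqI)
  fix A assume "A \<in> sets (empirical n x)"
  then have A: "A \<in> sets borel" by simp
  have "(\<Sum>i<n. emeasure (return borel (x i)) A) = of_nat (card ({..<n} \<inter> x -` A))"
    using A by (simp add: indicator_def sum.If_cases Int_def vimage_def)
  then show "emeasure (empirical n x) A = emeasure (distr (measure_pmf (pmf_of_set {..<n})) borel x) A"
    using A assms
    by (simp add: emeasure_empirical emeasure_distr emeasure_pmf_of_set lessThan_empty_iff
        ennreal_of_nat_eq_real_of_nat divide_ennreal)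
qed simp

lemma integral_empirical:
  fixes g :: "'a::topological_space \<Rightarrow> real"
  assumes "n \<ge> 1" and [measurable]: "g \<in> borel_measurable borel"
  shows "(\<integral>y. g y \<partial>empirical n x) = (\<Sum>i<n. g (x i)) / real n"
  using assms
  by (simp add: empirical_eq_distr integral_distr integral_pmf_of_set lessThan_empty_iff)

lemma measure_empirical:
  assumes "n \<ge> 1" "A \<in> sets borel"
  shows "measure (empirical n x) A = real (card {i\<in>{..<n}. x i \<in> A}) / real n"
  using assms
  by (simp add: empirical_eq_distr measure_distr measure_pmf_of_set lessThan_empty_iff
      Int_def vimage_def conj_commute)

text \<open>Configurations converging coordinatewise have weakly converging empirical measures,
  since integrals against \<open>empirical n x\<close> are finite averages. Second countability
  identifies the Borel sets of the product space with the product \<sigma>-algebra.\<close>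

lemma borel_measurable_empirical:
  fixes f :: "'a::{metric_space, second_countable_topology} measure \<Rightarrow> real"
  assumes n: "n \<ge> 1" and f: "continuous_map weak_topology euclidean f" and M: "sets M = sets borel"
  shows "(\<lambda>x. f (empirical n x)) \<in> borel_measurable (power_measure n M)"
proof -
  have emp_cong: "empirical n x = empirical n y" if "\<And>i. i < n \<Longrightarrow> x i = y i" for x y :: "nat \<Rightarrow> 'a"
    using that by (intro measure_eqI) (simp_all add: emeasure_empirical)
  have "continuous_on UNIV (\<lambda>x. f (empirical n x))"
    unfolding continuous_on_sequentially
  proof (intro allI ballI impI; elim conjE)
    fix u :: "nat \<Rightarrow> nat \<Rightarrow> 'a" and x assume u: "u \<longlonglongrightarrow> x"
    then have coord: "(\<lambda>k. u k i) \<longlonglongrightarrow> x i" for i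
      using continuous_on_tendsto_compose[OF continuous_on_product_coordinates[of i] u] by simp
    have "limitin weak_topology (\<lambda>k. empirical n (u k)) (empirical n x) sequentially"
    proof (rule limitin_weak_topologyI)
      fix g :: "'a \<Rightarrow> real" assume g: "continuous_on UNIV g"
      have [measurable]: "g \<in> borel_measurable borel" by (rule borel_measurable_continuous_onI[OF g])
      have "(\<lambda>k. g (u k i)) \<longlonglongrightarrow> g (x i)" for i
        using continuous_on_tendsto_compose[OF g coord] by simp
      then show "(\<lambda>k. \<integral>y. g y \<partial>empirical n (u k)) \<longlonglongrightarrow> (\<integral>y. g y \<partial>empirical n x)"
        using n by (auto simp: integral_empirical intro!: tendsto_intros)
    qed (use n in \<open>auto simp: empirical_in_prob_measures\<close>)
    from continuous_map_limit[OF f this]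
    show "((\<lambda>x. f (empirical n x)) \<circ> u) \<longlonglongrightarrow> f (empirical n x)" by (simp add: o_def)
  qed
  then have "(\<lambda>x. f (empirical n x)) \<in> borel_measurable (borel :: (nat \<Rightarrow> 'a) measure)"
    by (rule borel_measurable_continuous_onI)
  then have 1 [measurable]: "(\<lambda>x. f (empirical n x)) \<in> borel_measurable (PiM UNIV (\<lambda>_. borel))"
    using measurable_cong_sets[OF sets_PiM_equal_borel refl] by blast
  have [measurable_cong]: "sets M = sets borel" by (rule M)
  \<comment> \<open>Continuity was shown on total functions; filling the coordinates from
    \<open>n\<close> on with a fixed point transfers it to \<open>power_measure n M\<close>, because
    \<open>empirical n\<close> reads only the first \<open>n\<close>.\<close>
  have "(\<lambda>x i. if i < n then x i else (SOME y. True)) \<in> measurable (power_measure n M) (PiM UNIV (\<lambda>_. borel))"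
  proof (rule measurable_PiM_single')
    fix i
    show "(\<lambda>x. if i < n then x i else (SOME y. True)) \<in> measurable (power_measure n M) borel"
      by (cases "i < n") simp_all
  qed auto
  from measurable_compose[OF this 1]
  show ?thesis
    by (rule measurable_cong[THEN iffD1, rotated]) (auto intro!: arg_cong[of _ _ f] emp_cong)
qed

section \<open>The weak law of large numbers for empirical measures\<close>

lemma indep_vars_coordinates:
  assumes "prob_space \<mu>" "n \<ge> 1"
  shows "prob_space.indep_vars (power_measure n \<mu>) (\<lambda>_. \<mu>) (\<lambda>i x. x i) {..<n}"
proof -
  interpret prob_space \<mu> by fact
  interpret P: prob_space "power_measure n \<mu>" by (intro prob_space_PiM prob_space_axioms)
  have "distr (power_measure n \<mu>) (power_measure n \<mu>) (\<lambda>x. \<lambda>i\<in>{..<n}. x i) = power_measure n \<mu>"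
    by (subst distr_cong[OF refl refl, of _ _ "\<lambda>x. x"])
      (auto simp: space_PiM PiE_def extensional_restrict distr_id2)
  also have "\<dots> = PiM {..<n} (\<lambda>i. distr (power_measure n \<mu>) \<mu> (\<lambda>x. x i))"
    by (intro PiM_cong refl, subst distr_PiM_component) (auto intro: prob_space_axioms)
  finally show ?thesis
    using assms(2) by (subst P.indep_vars_iff_distr_eq_PiM') (auto simp: lessThan_empty_iff)
qed

text \<open>Hoeffding's inequality for the independent variables \<open>g (x i)\<close> with values
  in [-B, B]: the squared ranges sum to 4 n B^2, and a deviation n \<epsilon> of the sum gives the
  exponent - n \<epsilon>^2 / (2 B^2).\<close>

lemma empirical_deviation_bound:
  fixes g :: "'a::topological_space \<Rightarrow> real"
  assumes \<mu>: "prob_space \<mu>" "sets \<mu> = sets borel" and n: "n \<ge> 1"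
    and g: "g \<in> borel_measurable borel" "\<And>x. \<bar>g x\<bar> \<le> B" and "B > 0" "\<epsilon> > 0"
  shows "measure (power_measure n \<mu>)
      {x\<in>space (power_measure n \<mu>). \<epsilon> \<le> \<bar>(\<integral>y. g y \<partial>empirical n x) - (\<integral>y. g y \<partial>\<mu>)\<bar>}
    \<le> 2 * exp (- (\<epsilon>\<^sup>2 / (2 * B\<^sup>2)) * real n)"
proof -
  interpret prob_space \<mu> by fact
  interpret P: prob_space "power_measure n \<mu>" by (intro prob_space_PiM prob_space_axioms)
  have [measurable]: "g \<in> borel_measurable \<mu>"
    using g(1) measurable_cong_sets[OF \<mu>(2) refl] by blast
  have distr: "distr (power_measure n \<mu>) borel (\<lambda>x. g (x i)) = distr \<mu> borel g" if "i < n" for i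
  proof -
    have "distr (power_measure n \<mu>) borel (\<lambda>x. g (x i))
        = distr (distr (power_measure n \<mu>) \<mu> (\<lambda>x. x i)) borel g"
      using that by (subst distr_distr) (auto simp: o_def)
    also have "distr (power_measure n \<mu>) \<mu> (\<lambda>x. x i) = \<mu>"
      using that by (intro distr_PiM_component) (auto intro: prob_space_axioms)
    finally show ?thesis .
  qed
  have E: "P.expectation (\<lambda>x. g (x i)) = (\<integral>y. g y \<partial>\<mu>)" if "i < n" for i
    using that arg_cong[OF distr[OF that], of "\<lambda>M. integral\<^sup>L M (\<lambda>x. x)"]
    by (simp add: integral_distr)
  interpret H: Hoeffding_ineq "power_measure n \<mu>" "{..<n}" "\<lambda>i x. g (x i)" "\<lambda>_. -B" "\<lambda>_. B"
    "\<Sum>i<n. P.expectation (\<lambda>x. g (x i))"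
  proof unfold_locales
    show "P.indep_vars (\<lambda>_. borel) (\<lambda>i x. g (x i)) {..<n}"
      by (rule P.indep_vars_compose2[OF indep_vars_coordinates[OF \<mu>(1) n]]) simp
  qed (use g(2) in \<open>auto simp: abs_le_iff minus_le_iff\<close>)
  have eq: "\<epsilon> \<le> \<bar>(\<integral>y. g y \<partial>empirical n x) - (\<integral>y. g y \<partial>\<mu>)\<bar> \<longleftrightarrow>
      real n * \<epsilon> \<le> \<bar>(\<Sum>i<n. g (x i)) - (\<Sum>i<n. P.expectation (\<lambda>x. g (x i)))\<bar>" for x
  proof -
    have "(\<Sum>i<n. g (x i)) - (\<Sum>i<n. P.expectation (\<lambda>x. g (x i))) =
        real n * ((\<integral>y. g y \<partial>empirical n x) - (\<integral>y. g y \<partial>\<mu>))"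
      using n by (simp add: integral_empirical[OF n g(1)] E right_diff_distrib)
    then show ?thesis using n by (simp add: abs_mult)
  qed
  have pos: "0 < (\<Sum>i<n. (B - - B)\<^sup>2)" using n \<open>B > 0\<close> by simp
  have "- 2 * (real n * \<epsilon>)\<^sup>2 / (\<Sum>i<n. (B - - B)\<^sup>2) = - (\<epsilon>\<^sup>2 / (2 * B\<^sup>2)) * real n"
    using n \<open>B > 0\<close> by (simp add: field_simps power2_eq_square)
  with H.Hoeffding_ineq_abs_ge[of "real n * \<epsilon>", OF _ pos] \<open>\<epsilon> > 0\<close> show ?thesis
    by (simp add: eq)
qed

text \<open>Induction on the generation of \<open>U\<close>: intersections add exceptional sets,
  unions inherit one, and subbasic sets use the deviation bound. Carrying measurable sets
  \<open>B n\<close> along avoids any discussion of the measurability of the event that the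
  empirical measure lies in \<open>U\<close>.\<close>

lemma weak_law_empirical:
  fixes \<mu> :: "'a::topological_space measure"
  assumes \<mu>: "\<mu> \<in> prob_measures" and U: "openin weak_topology U" "\<mu> \<in> U"
  obtains B where "\<And>n. B n \<in> sets (power_measure n \<mu>)"
    "(\<lambda>n. measure (power_measure n \<mu>) (B n)) \<longlonglongrightarrow> 0"
    "\<And>n x. n \<ge> 1 \<Longrightarrow> x \<in> space (power_measure n \<mu>) \<Longrightarrow> x \<notin> B n \<Longrightarrow> empirical n x \<in> U"
proof -
  define good where "good U B \<longleftrightarrow> (\<forall>n. B n \<in> sets (power_measure n \<mu>)) \<and>
    (\<lambda>n. measure (power_measure n \<mu>) (B n)) \<longlonglongrightarrow> 0 \<and>
    (\<forall>n x. n \<ge> 1 \<longrightarrow> x \<in> space (power_measure n \<mu>) \<longrightarrow> x \<notin> B n \<longrightarrow> empirical n x \<in> U)" for U B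
  interpret prob_space \<mu> using \<mu> by (simp add: prob_measures_iff)
  have sets: "sets \<mu> = sets borel" using \<mu> by (simp add: prob_measures_iff)
  interpret P: prob_space "power_measure n \<mu>" for n by (intro prob_space_PiM prob_space_axioms)
  have "generate_topology_on {{\<mu> \<in> prob_measures. (\<integral>x. f x \<partial>\<mu>) \<in> U} | (f :: 'a \<Rightarrow> real) U.
        continuous_on UNIV f \<and> bounded (range f) \<and> open U} U"
    using U by (auto simp: weak_topology_def openin_topology_generated_by_iff)
  then have "\<exists>B. good U B" using U(2)
  proof (induction rule: generate_topology_on.induct)
    case Empty
    then show ?case by simp
  next
    case (Int a b)
    then obtain A B where A: "good a A" and B: "good b B" by auto
    have "good (a \<inter> b) (\<lambda>n. A n \<union> B n)"
      unfolding good_def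
    proof (intro conjI allI impI)
      show "(\<lambda>n. P.prob n (A n \<union> B n)) \<longlonglongrightarrow> 0"
      proof (rule tendsto_sandwich[OF _ _ tendsto_const])
        show "(\<lambda>n. P.prob n (A n) + P.prob n (B n)) \<longlonglongrightarrow> 0"
          using tendsto_add[of _ 0 _ _ 0] A B by (auto simp: good_def)
        show "\<forall>\<^sub>F n in sequentially. P.prob n (A n \<union> B n) \<le> P.prob n (A n) + P.prob n (B n)"
          using A B by (intro always_eventually allI measure_Un_le) (auto simp: good_def)
      qed simp
    qed (use A B in \<open>auto simp: good_def\<close>)
    then show ?case by blast
  next
    case (UN K)
    then obtain k where k: "k \<in> K" "\<mu> \<in> k" by auto
    from UN.IH[OF k] obtain B where B: "good k B" ..
    have "good (\<Union>K) B"
      using B unfolding good_def by (intro conjI allI impI UnionI[OF k(1)]) simp_all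
    then show ?case by blast
  next
    case (Basis s)
    then obtain f :: "'a \<Rightarrow> real" and V where s: "s = {\<mu> \<in> prob_measures. (\<integral>x. f x \<partial>\<mu>) \<in> V}"
      and f: "continuous_on UNIV f" "bounded (range f)" "open V"
      by auto
    with Basis(2) have "(\<integral>x. f x \<partial>\<mu>) \<in> V" by simp
    then obtain e where e: "e > 0" "ball (\<integral>x. f x \<partial>\<mu>) e \<subseteq> V"
      using f(3) open_contains_ball by blast
    have meas: "f \<in> borel_measurable borel" by (rule borel_measurable_continuous_onI[OF f(1)])
    then have [measurable]: "f \<in> borel_measurable \<mu>"
      using measurable_cong_sets[OF sets refl] by blast
    obtain C where "C > 0" and C: "\<And>x. \<bar>f x\<bar> \<le> C"
      using f(2) by (auto simp: bounded_pos)
    \<comment> \<open>The explicit average makes measurability evident for all \<open>n\<close>,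
      including 0, where \<open>empirical\<close> gives no probability measure.\<close>
    define B where "B n = {x\<in>space (power_measure n \<mu>).
      e \<le> \<bar>(if n = 0 then 0 else (\<Sum>i<n. f (x i)) / real n) - (\<integral>y. f y \<partial>\<mu>)\<bar>}" for n
    have B: "B n = {x\<in>space (power_measure n \<mu>). e \<le> \<bar>(\<integral>y. f y \<partial>empirical n x) - (\<integral>y. f y \<partial>\<mu>)\<bar>}"
      if "n \<ge> 1" for n
      using that by (simp add: B_def integral_empirical[OF that meas])
    have "good s B"
      unfolding good_def
    proof (intro conjI allI impI)
      show "B n \<in> sets (power_measure n \<mu>)" for n unfolding B_def by measurable
      show "(\<lambda>n. P.prob n (B n)) \<longlonglongrightarrow> 0"
      proof (rule tendsto_sandwich[OF _ _ tendsto_const])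
        have "(\<lambda>n. 2 * exp (- c * real n)) \<longlonglongrightarrow> 0" if "c > 0" for c :: real
          using that by real_asymp
        from this[of "e\<^sup>2 / (2 * C\<^sup>2)"] e \<open>C > 0\<close> show "(\<lambda>n. 2 * exp (- (e\<^sup>2 / (2 * C\<^sup>2)) * real n)) \<longlonglongrightarrow> 0"
          by simp
        show "\<forall>\<^sub>F n in sequentially. P.prob n (B n) \<le> 2 * exp (- (e\<^sup>2 / (2 * C\<^sup>2)) * real n)"
          using eventually_ge_at_top[of 1]
        proof eventually_elim
          case (elim n)
          then show ?case
            using empirical_deviation_bound[OF prob_space_axioms sets elim meas C \<open>C > 0\<close> e(1)]
            by (simp add: B)
        qed
      qed simp
      fix n x assume n: "1 \<le> n" and x: "x \<in> space (power_measure n \<mu>)" "x \<notin> B n"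
      then have "(\<integral>y. f y \<partial>empirical n x) \<in> ball (\<integral>x. f x \<partial>\<mu>) e"
        by (auto simp: B dist_real_def abs_minus_commute)
      then show "empirical n x \<in> s"
        using e(2) empirical_in_prob_measures[OF n] by (auto simp: s)
    qed
    then show ?case by blast
  qed
  then obtain B where "good U B" ..
  then show thesis using that[of B] by (simp add: good_def)
qed

text \<open>Off an exceptional event \<open>f\<close> changes by less than e / 2, and on it by at
  most 2 C; making its probability smaller than e / (4 C) keeps the total error below e.\<close>

lemma tendsto_expectation_empirical:
  fixes f :: "'a::{metric_space, second_countable_topology} measure \<Rightarrow> real"
  assumes \<mu>: "\<mu> \<in> prob_measures" and f: "continuous_map weak_topology euclidean f"
    and bdd: "bounded (f ` prob_measures)"
  shows "(\<lambda>n. \<integral>x. f (empirical n x) \<partial>power_measure n \<mu>) \<longlonglongrightarrow> f \<mu>"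
proof -
  interpret prob_space \<mu> using \<mu> by (simp add: prob_measures_iff)
  have sets: "sets \<mu> = sets borel" using \<mu> by (simp add: prob_measures_iff)
  interpret P: prob_space "power_measure n \<mu>" for n by (intro prob_space_PiM prob_space_axioms)
  obtain C where "C > 0" and C: "\<And>\<nu>. \<nu> \<in> prob_measures \<Longrightarrow> \<bar>f \<nu>\<bar> \<le> C"
    using bdd by (auto simp: bounded_pos)
  show ?thesis
  proof (rule LIMSEQ_I)
    fix e :: real assume "e > 0"
    let ?U = "{\<nu> \<in> prob_measures. f \<nu> \<in> ball (f \<mu>) (e / 2)}"
    have "openin weak_topology ?U"
      using openin_continuous_map_preimage[OF f] by (metis open_ball open_openin topspace_weak_topology)
    moreover have "\<mu> \<in> ?U" using \<mu> \<open>e > 0\<close> by simp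
    ultimately obtain B where B [measurable]: "\<And>n. B n \<in> sets (power_measure n \<mu>)"
      and B0: "(\<lambda>n. P.prob n (B n)) \<longlonglongrightarrow> 0"
      and BU: "\<And>n x. n \<ge> 1 \<Longrightarrow> x \<in> space (power_measure n \<mu>) \<Longrightarrow> x \<notin> B n \<Longrightarrow> empirical n x \<in> ?U"
      by (rule weak_law_empirical[OF \<mu>]) blast
    have "\<forall>\<^sub>F n in sequentially. P.prob n (B n) < e / (4 * C)"
      using order_tendstoD(2)[OF B0, of "e / (4 * C)"] \<open>e > 0\<close> \<open>C > 0\<close> by simp
    then have "\<forall>\<^sub>F n in sequentially. norm (P.expectation n (\<lambda>x. f (empirical n x)) - f \<mu>) < e"
      using eventually_ge_at_top[of 1]
    proof eventually_elim
      case (elim n)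
      have [measurable]: "(\<lambda>x. f (empirical n x)) \<in> borel_measurable (power_measure n \<mu>)"
        by (rule borel_measurable_empirical[OF elim(2) f sets])
      have fb: "\<bar>f (empirical n x)\<bar> \<le> C" for x
        by (rule C[OF empirical_in_prob_measures[OF elim(2)]])
      have int: "integrable (power_measure n \<mu>) (\<lambda>x. f (empirical n x))"
        using fb by (intro P.integrable_const_bound[where B = C]) auto
      have intB: "integrable (power_measure n \<mu>) (\<lambda>x. indicator (B n) x :: real)"
        by (rule integrable_real_indicator) (simp_all add: P.emeasure_finite less_top[symmetric])
      have "\<bar>P.expectation n (\<lambda>x. f (empirical n x)) - f \<mu>\<bar>
          = \<bar>P.expectation n (\<lambda>x. f (empirical n x) - f \<mu>)\<bar>"
        using int by (simp add: P.prob_space)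
      also have "\<dots> \<le> P.expectation n (\<lambda>x. \<bar>f (empirical n x) - f \<mu>\<bar>)"
        by (rule integral_abs_bound)
      also have "\<dots> \<le> P.expectation n (\<lambda>x. e / 2 + 2 * C * indicator (B n) x)"
      proof (rule integral_mono)
        fix x assume x: "x \<in> space (power_measure n \<mu>)"
        show "\<bar>f (empirical n x) - f \<mu>\<bar> \<le> e / 2 + 2 * C * indicator (B n) x"
        proof (cases "x \<in> B n")
          case True
          then show ?thesis using fb[of x] C[OF \<mu>] \<open>e > 0\<close> by simp
        next
          case False
          then show ?thesis
            using BU[OF elim(2) x] by (simp add: dist_real_def abs_minus_commute)
        qed
      qed (use int intB in auto)
      also have "\<dots> = e / 2 + 2 * C * P.prob n (B n)"
        using intB by (subst Bochner_Integration.integral_add) (auto simp: P.prob_space)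
      also have "\<dots> < e / 2 + 2 * C * (e / (4 * C))"
        using elim(1) \<open>C > 0\<close> by (intro add_strict_left_mono mult_strict_left_mono) auto
      also have "\<dots> = e" using \<open>C > 0\<close> by simp
      finally show ?case by simp
    qed
    then show "\<exists>N. \<forall>n\<ge>N. norm (P.expectation n (\<lambda>x. f (empirical n x)) - f \<mu>) < e"
      by (simp add: eventually_sequentially)
  qed
qed

section \<open>Relative entropy and the Gibbs variational inequality\<close>

lemma eintegral_ereal:
  assumes "integrable N r"
  shows "eintegral N (\<lambda>x. ereal (r x)) = ereal (\<integral>x. r x \<partial>N)"
proof -
  have fin: "(\<integral>\<^sup>+x. ennreal (r x) \<partial>N) \<noteq> \<infinity>" "(\<integral>\<^sup>+x. ennreal (- r x) \<partial>N) \<noteq> \<infinity>"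
    using assms by (simp_all add: real_integrable_def)
  have conv: "enn2ereal x = ereal (enn2real x)" if "x \<noteq> \<infinity>" for x
    using that by (cases x) (simp_all add: enn2ereal_ennreal)
  show ?thesis
    using fin by (simp add: eintegral_def conv real_lebesgue_integral_def[OF assms] e2ennreal_ereal)
qed

lemma eintegral_cong_AE:
  assumes "AE x in N. g x = g' x"
  shows "eintegral N g = eintegral N g'"
proof -
  have "(\<integral>\<^sup>+x. e2ennreal (g x) \<partial>N) = (\<integral>\<^sup>+x. e2ennreal (g' x) \<partial>N)"
    by (rule nn_integral_cong_AE) (use assms in \<open>auto elim: eventually_mono\<close>)
  moreover have "(\<integral>\<^sup>+x. e2ennreal (- g x) \<partial>N) = (\<integral>\<^sup>+x. e2ennreal (- g' x) \<partial>N)"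
    by (rule nn_integral_cong_AE) (use assms in \<open>auto elim: eventually_mono\<close>)
  ultimately show ?thesis by (simp add: eintegral_def)
qed

text \<open>The lower bound makes the negative part integrable, so a value below \<infinity> forces
  the positive part to be integrable as well and cannot be an artefact of \<infinity> -
  \<infinity>.\<close>

lemma eintegral_bounded_below:
  assumes N: "finite_measure N" and [measurable]: "g \<in> borel_measurable N"
    and C: "\<And>x. x \<in> space N \<Longrightarrow> ereal C \<le> g x" and fin: "eintegral N g < \<infinity>"
  shows "AE x in N. g x \<noteq> \<infinity>" "integrable N (\<lambda>x. real_of_ereal (g x))"
    "eintegral N g = ereal (\<integral>x. real_of_ereal (g x) \<partial>N)"
proof -
  interpret finite_measure N by fact
  have "(\<integral>\<^sup>+x. e2ennreal (- g x) \<partial>N) \<le> (\<integral>\<^sup>+x. ennreal \<bar>C\<bar> \<partial>N)"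
  proof (rule nn_integral_mono)
    fix x assume "x \<in> space N"
    then have "- g x \<le> ereal (- C)" using C[of x] by (cases "g x") auto
    also have "\<dots> \<le> ereal \<bar>C\<bar>" by simp
    finally have "e2ennreal (- g x) \<le> e2ennreal (ereal \<bar>C\<bar>)" by (rule e2ennreal_mono)
    then show "e2ennreal (- g x) \<le> ennreal \<bar>C\<bar>" by (simp add: e2ennreal_ereal)
  qed
  also have "\<dots> < \<infinity>" using emeasure_finite[of "space N"] by (simp add: ennreal_mult_eq_top_iff less_top[symmetric])
  finally have neg: "(\<integral>\<^sup>+x. e2ennreal (- g x) \<partial>N) < \<infinity>" .
  have pos: "(\<integral>\<^sup>+x. e2ennreal (g x) \<partial>N) \<noteq> \<infinity>"
  proof
    assume "(\<integral>\<^sup>+x. e2ennreal (g x) \<partial>N) = \<infinity>"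
    moreover have "enn2ereal (\<integral>\<^sup>+x. e2ennreal (- g x) \<partial>N) \<noteq> \<infinity>"
      using neg by (cases "\<integral>\<^sup>+x. e2ennreal (- g x) \<partial>N") (auto simp: enn2ereal_ennreal)
    ultimately show False using fin by (simp add: eintegral_def)
  qed
  have "AE x in N. e2ennreal (g x) \<noteq> \<infinity>"
    using pos by (intro nn_integral_noteq_infinite) auto
  then have fin': "AE x in N. g x \<noteq> \<infinity>" by eventually_elim auto
  then have real: "AE x in N. ereal (real_of_ereal (g x)) = g x"
    using AE_space
  proof eventually_elim
    case (elim x)
    then show ?case using C[of x] by (cases "g x") auto
  qed
  have 1: "(\<integral>\<^sup>+x. ennreal (real_of_ereal (g x)) \<partial>N) = (\<integral>\<^sup>+x. e2ennreal (g x) \<partial>N)"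
  proof (rule nn_integral_cong_AE)
    show "AE x in N. ennreal (real_of_ereal (g x)) = e2ennreal (g x)"
      using real by eventually_elim (metis e2ennreal_ereal)
  qed
  have 2: "(\<integral>\<^sup>+x. ennreal (- real_of_ereal (g x)) \<partial>N) = (\<integral>\<^sup>+x. e2ennreal (- g x) \<partial>N)"
  proof (rule nn_integral_cong_AE)
    show "AE x in N. ennreal (- real_of_ereal (g x)) = e2ennreal (- g x)"
      using real
    proof eventually_elim
      case (elim x)
      have "e2ennreal (- g x) = e2ennreal (ereal (- real_of_ereal (g x)))"
        using elim by (metis uminus_ereal.simps(1))
      then show ?case by (simp add: e2ennreal_ereal)
    qed
  qed
  show int: "integrable N (\<lambda>x. real_of_ereal (g x))"
    using pos neg by (simp add: real_integrable_def 1 2)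
  show "AE x in N. g x \<noteq> \<infinity>" by (rule fin')
  have "eintegral N g = eintegral N (\<lambda>x. ereal (real_of_ereal (g x)))"
    by (rule eintegral_cong_AE) (use real in \<open>auto elim: eventually_mono\<close>)
  then show "eintegral N g = ereal (\<integral>x. real_of_ereal (g x) \<partial>N)"
    by (simp add: eintegral_ereal[OF int])
qed

text \<open>Tangent line at 1 of the convex function t ln t. It bounds entropy integrands below by
  -1.\<close>

lemma mult_ln_ge: "t - 1 \<le> t * ln t" if "0 \<le> t" for t :: real
proof (cases "t = 0")
  case False
  with that have "t > 0" by simp
  have "ln (1 / t) \<le> 1 / t - 1" using \<open>t > 0\<close> by (intro ln_le_minus_one) simp
  then have "t * (1 - 1 / t) \<le> t * ln t"
    using \<open>t > 0\<close> by (intro mult_left_mono) (simp_all add: ln_div)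
  then show ?thesis using \<open>t > 0\<close> by (simp add: right_diff_distrib)
qed simp

lemma relative_entropy_density:
  fixes h :: "'b \<Rightarrow> real"
  assumes \<pi>: "prob_space \<pi>" and [measurable]: "h \<in> borel_measurable \<pi>" and h: "\<And>x. 0 \<le> h x"
    and int: "integrable \<pi> (\<lambda>x. h x * ln (h x))"
  shows "relative_entropy (density \<pi> (\<lambda>x. ennreal (h x))) \<pi> = ereal (\<integral>x. h x * ln (h x) \<partial>\<pi>)"
proof -
  interpret prob_space \<pi> by fact
  let ?\<mu> = "density \<pi> (\<lambda>x. ennreal (h x))"
  have "AE x in \<pi>. ennreal (h x) = RN_deriv \<pi> ?\<mu> x"
    by (rule RN_deriv_unique) auto
  then have "AE x in \<pi>. ereal (enn2real (RN_deriv \<pi> ?\<mu> x) * ln (enn2real (RN_deriv \<pi> ?\<mu> x)))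
      = ereal (h x * ln (h x))"
  proof eventually_elim
    case (elim x)
    show ?case unfolding elim[symmetric] by (simp add: h)
  qed
  from eintegral_cong_AE[OF this] show ?thesis
    by (simp add: relative_entropy_def Let_def absolutely_continuousI_density eintegral_ereal[OF int])
qed

text \<open>Since h ln h is at least -1, finite entropy makes it integrable, and the extended
  integral turns into an ordinary one for a real version of the density.\<close>

lemma relative_entropy_finiteE:
  assumes \<pi>: "prob_space \<pi>" and \<mu>: "prob_space \<mu>" "sets \<mu> = sets \<pi>"
    and fin: "relative_entropy \<mu> \<pi> < \<infinity>"
  obtains h :: "'b \<Rightarrow> real" where "h \<in> borel_measurable \<pi>" "\<And>x. 0 \<le> h x"
    "\<mu> = density \<pi> (\<lambda>x. ennreal (h x))" "integrable \<pi> (\<lambda>x. h x * ln (h x))"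
    "relative_entropy \<mu> \<pi> = ereal (\<integral>x. h x * ln (h x) \<partial>\<pi>)"
proof -
  interpret P: prob_space \<pi> by fact
  interpret M: prob_space \<mu> by fact
  define h where "h x = enn2real (RN_deriv \<pi> \<mu> x)" for x
  have ac: "absolutely_continuous \<pi> \<mu>"
    using fin by (auto simp: relative_entropy_def split: if_splits)
  have h [measurable]: "h \<in> borel_measurable \<pi>" unfolding h_def by measurable
  have h0: "0 \<le> h x" for x by (simp add: h_def)
  have "AE x in \<pi>. RN_deriv \<pi> \<mu> x \<noteq> \<infinity>"
    by (rule P.RN_deriv_finite) (use ac \<mu> M.sigma_finite_measure_axioms in auto)
  then have "AE x in \<pi>. RN_deriv \<pi> \<mu> x = ennreal (h x)"
    by eventually_elim (auto simp: h_def less_top)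
  then have "density \<pi> (RN_deriv \<pi> \<mu>) = density \<pi> (\<lambda>x. ennreal (h x))"
    by (intro density_cong) auto
  then have \<mu>h: "\<mu> = density \<pi> (\<lambda>x. ennreal (h x))"
    using P.density_RN_deriv[OF ac \<mu>(2)] by simp
  have re: "relative_entropy \<mu> \<pi> = eintegral \<pi> (\<lambda>x. ereal (h x * ln (h x)))"
    using ac by (simp add: relative_entropy_def h_def Let_def)
  have "ereal (- 1) \<le> ereal (h x * ln (h x))" for x
    using mult_ln_ge[OF h0[of x]] h0[of x] unfolding ereal_less_eq by linarith
  then have "integrable \<pi> (\<lambda>x. h x * ln (h x))"
    using eintegral_bounded_below(2)[of \<pi> "\<lambda>x. ereal (h x * ln (h x))" "-1"] fin P.finite_measure_axioms
    by (simp add: re)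
  then show thesis
    using that[of h] h h0 \<mu>h eintegral_ereal re by metis
qed

text \<open>Both measures agree on boxes, where the integral of the product density
  factorises.\<close>

lemma power_measure_density:
  assumes \<pi>: "prob_space \<pi>" and [measurable]: "h \<in> borel_measurable \<pi>"
    and \<mu>: "prob_space (density \<pi> h)"
  shows "power_measure n (density \<pi> h) = density (power_measure n \<pi>) (\<lambda>x. \<Prod>i<n. h (x i))"
proof -
  interpret P: product_sigma_finite "\<lambda>_::nat. \<pi>"
    using \<pi> by (simp add: product_sigma_finite_def prob_space_imp_sigma_finite)
  interpret Q: product_sigma_finite "\<lambda>_::nat. density \<pi> h"
    using \<mu> by (simp add: product_sigma_finite_def prob_space_imp_sigma_finite)
  have "density (power_measure n \<pi>) (\<lambda>x. \<Prod>i<n. h (x i)) = power_measure n (density \<pi> h)"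
  proof (rule Q.PiM_eqI)
    show "sets (density (power_measure n \<pi>) (\<lambda>x. \<Prod>i<n. h (x i))) = sets (power_measure n (density \<pi> h))"
      by (simp cong: sets_PiM_cong)
  next
    fix A assume "\<And>i. i \<in> {..<n} \<Longrightarrow> A i \<in> sets (density \<pi> h)"
    then have A [measurable]: "A i \<in> sets \<pi>" if "i < n" for i using that by simp
    have box: "PiE {..<n} A \<in> sets (power_measure n \<pi>)"
      by (intro sets_PiM_I_finite) (use A in auto)
    have "emeasure (density (power_measure n \<pi>) (\<lambda>x. \<Prod>i<n. h (x i))) (PiE {..<n} A) =
        (\<integral>\<^sup>+x. (\<Prod>i<n. h (x i)) * indicator (PiE {..<n} A) x \<partial>power_measure n \<pi>)"
      using box by (subst emeasure_density) simp_all
    also have "\<dots> = (\<integral>\<^sup>+x. (\<Prod>i<n. h (x i) * indicator (A i) (x i)) \<partial>power_measure n \<pi>)"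
    proof (rule nn_integral_cong)
      fix x assume "x \<in> space (power_measure n \<pi>)"
      then have "indicator (PiE {..<n} A) x = (\<Prod>i<n. indicator (A i) (x i) :: ennreal)"
        by (auto simp: indicator_def space_PiM PiE_def Pi_def prod_zero_iff)
      then show "(\<Prod>i<n. h (x i)) * indicator (PiE {..<n} A) x = (\<Prod>i<n. h (x i) * indicator (A i) (x i))"
        by (simp add: prod.distrib)
    qed
    also have "\<dots> = (\<Prod>i<n. \<integral>\<^sup>+y. h y * indicator (A i) y \<partial>\<pi>)"
      by (rule P.product_nn_integral_prod) (use A in auto)
    also have "\<dots> = (\<Prod>i<n. emeasure (density \<pi> h) (A i))"
      by (intro prod.cong refl) (use A in \<open>simp add: emeasure_density\<close>)
    finally show "emeasure (density (power_measure n \<pi>) (\<lambda>x. \<Prod>i<n. h (x i))) (PiE {..<n} A) =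
        (\<Prod>i\<in>{..<n}. emeasure (density \<pi> h) (A i))" .
  qed simp
  then show ?thesis by simp
qed

text \<open>Jensen's inequality, obtained by integrating the tangent of the exponential at the mean.
  With a nonnegative integral on the right, the case of a non-integrable exponential is
  trivial.\<close>

lemma (in prob_space) exp_expectation_le:
  assumes "integrable M f"
  shows "ennreal (exp (expectation f)) \<le> (\<integral>\<^sup>+x. ennreal (exp (f x)) \<partial>M)"
proof (cases "(\<integral>\<^sup>+x. ennreal (exp (f x)) \<partial>M) = \<infinity>")
  case False
  have [measurable]: "f \<in> borel_measurable M" using assms by auto
  have int: "integrable M (\<lambda>x. exp (f x))"
    using False by (intro integrableI_nonneg) (auto simp: less_top)
  let ?c = "expectation f"
  have "exp ?c = expectation (\<lambda>x. exp ?c * (1 + (f x - ?c)))"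
    using assms by (simp add: prob_space)
  also have "\<dots> \<le> expectation (\<lambda>x. exp (f x))"
  proof (rule integral_mono)
    fix x
    have "exp ?c * (1 + (f x - ?c)) \<le> exp ?c * exp (f x - ?c)"
      by (intro mult_left_mono exp_ge_add_one_self) simp
    then show "exp ?c * (1 + (f x - ?c)) \<le> exp (f x)" by (simp flip: exp_add)
  qed (use assms int in auto)
  finally show ?thesis
    using int by (subst nn_integral_eq_integral) auto
qed simp

text \<open>
  Change the measure from \<open>\<pi>\<^sup>n\<close> to \<open>\<mu>\<^sup>n\<close>, with
  \<open>d\<mu> = h d\<pi>\<close>, and apply Jensen's inequality to the exponential.
\<close>
lemma gibbs_variational_lower:
  fixes h :: "'b \<Rightarrow> real"
  assumes \<pi>: "prob_space \<pi>" and [measurable]: "h \<in> borel_measurable \<pi>" and h: "\<And>x. 0 \<le> h x"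
    and \<mu>: "\<mu> = density \<pi> (\<lambda>x. ennreal (h x))" "prob_space \<mu>"
    and int: "integrable \<pi> (\<lambda>x. h x * ln (h x))"
    and G [measurable]: "G \<in> borel_measurable (power_measure n \<pi>)"
    and T: "integrable (power_measure n \<mu>) T"
    and TG: "AE x in power_measure n \<mu>. ennreal (exp (T x)) \<le> G x"
  shows "ennreal (exp ((\<integral>x. T x \<partial>power_measure n \<mu>) - real n * (\<integral>x. h x * ln (h x) \<partial>\<pi>)))
    \<le> (\<integral>\<^sup>+x. G x \<partial>power_measure n \<pi>)"
proof -
  interpret M: prob_space \<mu> by fact
  interpret Q: prob_space "power_measure n \<mu>" by (intro prob_space_PiM M.prob_space_axioms)
  define S where "S x = (\<Sum>i<n. ln (h (x i)))" for x :: "nat \<Rightarrow> 'b"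
  have sets: "sets \<mu> = sets \<pi>" by (simp add: \<mu>)
  have h\<mu> [measurable]: "h \<in> borel_measurable \<mu>"
    by (simp add: measurable_cong_sets[OF sets refl])
  have ln_int: "integrable \<mu> (\<lambda>x. ln (h x))"
    unfolding \<mu>(1) using h int by (subst integrable_density) auto
  have ln_eq: "(\<integral>x. ln (h x) \<partial>\<mu>) = (\<integral>x. h x * ln (h x) \<partial>\<pi>)"
    unfolding \<mu>(1) using h by (subst integral_density) auto
  have comp: "distr (power_measure n \<mu>) \<mu> (\<lambda>x. x i) = \<mu>" if "i < n" for i
    using that by (intro distr_PiM_component) (auto intro: M.prob_space_axioms)
  have coord_int: "integrable (power_measure n \<mu>) (\<lambda>x. ln (h (x i)))" if "i < n" for i
    using that ln_int by (subst (asm) comp[OF that, symmetric], subst (asm) integrable_distr_eq) auto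
  have coord_eq: "(\<integral>x. ln (h (x i)) \<partial>power_measure n \<mu>) = (\<integral>x. ln (h x) \<partial>\<mu>)" if "i < n" for i
    using that by (subst (2) comp[OF that, symmetric], subst integral_distr) auto
  have S_int: "integrable (power_measure n \<mu>) S"
    unfolding S_def using coord_int by (intro Bochner_Integration.integrable_sum) auto
  have S_eq: "(\<integral>x. S x \<partial>power_measure n \<mu>) = real n * (\<integral>x. h x * ln (h x) \<partial>\<pi>)"
    unfolding S_def using coord_int
    by (subst Bochner_Integration.integral_sum) (auto simp: coord_eq ln_eq)
  have [measurable]: "S \<in> borel_measurable (power_measure n \<pi>)"
    unfolding S_def by measurable
  \<comment> \<open>The density of \<open>power_measure n \<mu>\<close> times exp (- S) is 1 where
    all factors are positive and 0 where one vanishes. The default value of \<open>ln\<close> at 0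
    is thus harmless, and only mass not charged by \<open>\<mu>\<close> is lost.\<close>
  have prod: "(\<Prod>i<n. ennreal (h (x i))) * ennreal (exp (- S x)) \<le> 1" for x
  proof (cases "\<exists>i<n. h (x i) = 0")
    case True
    then obtain i where "i < n" "h (x i) = 0" by blast
    then have z: "(\<Prod>i<n. ennreal (h (x i))) = 0" by (intro prod_zero bexI[of _ i]) simp_all
    show ?thesis unfolding z by simp
  next
    case False
    then have pos: "0 < h (x i)" if "i < n" for i
      using that h[of "x i"] by (auto simp: less_le)
    have "(\<Prod>i<n. h (x i)) = exp (S x)"
      using pos by (simp add: S_def exp_sum)
    then show ?thesis
      using h by (simp add: prod_ennreal flip: ennreal_mult exp_add)
  qed
  have Q: "power_measure n \<mu> = density (power_measure n \<pi>) (\<lambda>x. \<Prod>i<n. ennreal (h (x i)))"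
    unfolding \<mu>(1) by (rule power_measure_density) (use \<pi> \<mu> in auto)
  have "ennreal (exp ((\<integral>x. T x \<partial>power_measure n \<mu>) - real n * (\<integral>x. h x * ln (h x) \<partial>\<pi>)))
      = ennreal (exp (Q.expectation (\<lambda>x. T x - S x)))"
    using T S_int by (simp add: S_eq)
  also have "\<dots> \<le> (\<integral>\<^sup>+x. ennreal (exp (T x - S x)) \<partial>power_measure n \<mu>)"
    by (rule Q.exp_expectation_le) (use T S_int in auto)
  also have "\<dots> \<le> (\<integral>\<^sup>+x. ennreal (exp (- S x)) * G x \<partial>power_measure n \<mu>)"
  proof (rule nn_integral_mono_AE)
    show "AE x in power_measure n \<mu>. ennreal (exp (T x - S x)) \<le> ennreal (exp (- S x)) * G x"
      using TG
    proof eventually_elim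
      case (elim x)
      have "ennreal (exp (T x - S x)) = ennreal (exp (- S x)) * ennreal (exp (T x))"
        by (simp flip: ennreal_mult exp_add)
      also have "\<dots> \<le> ennreal (exp (- S x)) * G x" by (intro mult_left_mono elim) simp
      finally show ?case .
    qed
  qed
  also have "\<dots> = (\<integral>\<^sup>+x. (\<Prod>i<n. ennreal (h (x i))) * (ennreal (exp (- S x)) * G x) \<partial>power_measure n \<pi>)"
    unfolding Q by (subst nn_integral_density) auto
  also have "\<dots> \<le> (\<integral>\<^sup>+x. G x \<partial>power_measure n \<pi>)"
  proof (rule nn_integral_mono)
    fix x
    show "(\<Prod>i<n. ennreal (h (x i))) * (ennreal (exp (- S x)) * G x) \<le> G x"
      using mult_right_mono[OF prod[of x], of "G x"] by (simp add: mult.assoc)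
  qed
  finally show ?thesis .
qed

section \<open>Entropy along a refining sequence of finite partitions\<close>

text \<open>
  The cells of the partition generated by \<open>E\<^sub>0, \<dots>, E\<^bsub>m-1\<^esub>\<close> are numbered by the binary code of the
  sets containing the point, so that cell \<open>j < 2\<^sup>m\<close> splits into the cells \<open>j\<close> and \<open>j + 2\<^sup>m\<close> of the
  next level.
\<close>
definition label :: "(nat \<Rightarrow> 'a set) \<Rightarrow> nat \<Rightarrow> 'a \<Rightarrow> nat" where
  "label E m x = (\<Sum>i<m. if x \<in> E i then 2 ^ i else 0)"

definition cells :: "(nat \<Rightarrow> 'a set) \<Rightarrow> 'a measure \<Rightarrow> nat \<Rightarrow> nat \<Rightarrow> real" where
  "cells E \<nu> m j = measure \<nu> {x. label E m x = j}"

text \<open>The consistency relations satisfied by the cell masses of a probability measure. They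
  pass to limits of cell masses before any limiting measure is known to exist.\<close>

definition dyadic :: "(nat \<Rightarrow> nat \<Rightarrow> real) \<Rightarrow> bool" where
  "dyadic q \<longleftrightarrow> q 0 0 = 1 \<and> (\<forall>m j. 0 \<le> q m j) \<and>
     (\<forall>m. \<forall>j<2 ^ m. q m j = q (Suc m) j + q (Suc m) (j + 2 ^ m))"

text \<open>Where \<open>p m j\<close> is 0, division by zero and \<open>ln\<close> at 0 make the
  term 0, whatever \<open>q m j\<close> is. This is the true relative entropy only if
  \<open>q\<close> vanishes wherever \<open>p\<close> does, hence the domination hypotheses
  below.\<close>

definition cell_entropy :: "(nat \<Rightarrow> nat \<Rightarrow> real) \<Rightarrow> (nat \<Rightarrow> nat \<Rightarrow> real) \<Rightarrow> nat \<Rightarrow> real" where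
  "cell_entropy p q m = (\<Sum>j<2 ^ m. q m j * ln (q m j / p m j))"

lemma label_0 [simp]: "label E 0 x = 0"
  by (simp add: label_def)

lemma label_Suc: "label E (Suc m) x = label E m x + (if x \<in> E m then 2 ^ m else 0)"
  by (simp add: label_def)

lemma label_less: "label E m x < 2 ^ m"
  by (induction m) (auto simp: label_Suc)

text \<open>Refinement only adds higher binary digits to the code.\<close>

lemma label_mod:
  assumes "m \<le> m'"
  shows "label E m' x mod 2 ^ m = label E m x"
  using assms
proof (induction rule: dec_induct)
  case base
  then show ?case by (simp add: label_less)
next
  case (step k)
  have "(2::nat) ^ m dvd 2 ^ k" using step by (intro le_imp_power_dvd) auto
  then have "(if x \<in> E k then 2 ^ k else 0) mod (2::nat) ^ m = 0" by simp
  then have "label E (Suc k) x mod 2 ^ m = label E k x mod 2 ^ m"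
    unfolding label_Suc by (metis add.right_neutral mod_add_right_eq)
  then show ?case using step.IH by simp
qed

lemma measurable_label [measurable]:
  assumes "\<And>i. E i \<in> sets M"
  shows "label E m \<in> measurable M (count_space UNIV)"
proof (induction m)
  case 0
  then show ?case by (simp add: label_def)
next
  case (Suc m)
  note [measurable] = assms Suc
  show ?case unfolding label_Suc by measurable
qed

lemma sets_label:
  fixes E :: "nat \<Rightarrow> 'a::topological_space set"
  assumes "\<And>i. E i \<in> sets borel"
  shows "{x. label E m x = j} \<in> sets borel"
  using measurable_sets[OF measurable_label[where m = m, OF assms], of "{j}"] by (simp add: vimage_def)

lemma sum_lessThan_add:
  fixes f :: "nat \<Rightarrow> 'b::comm_monoid_add"
  shows "(\<Sum>j<a + b. f j) = (\<Sum>j<a. f j) + (\<Sum>j<b. f (j + a))"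
  by (induction b) (simp_all add: ac_simps)

lemma dyadic_root: "dyadic q \<Longrightarrow> q 0 0 = 1"
  and dyadic_nonneg: "dyadic q \<Longrightarrow> 0 \<le> q m j"
  and dyadic_split: "dyadic q \<Longrightarrow> j < 2 ^ m \<Longrightarrow> q (Suc m) j + q (Suc m) (j + 2 ^ m) = q m j"
  unfolding dyadic_def by (blast, blast, metis)

lemma dyadicI:
  assumes "q 0 0 = 1" "\<And>m j. 0 \<le> q m j"
    "\<And>m j. j < 2 ^ m \<Longrightarrow> q m j = q (Suc m) j + q (Suc m) (j + 2 ^ m)"
  shows "dyadic q"
  unfolding dyadic_def using assms by blast

text \<open>Iterated splitting of cells: \<open>q m\<close> is the image of \<open>q m'\<close>
  under reduction modulo 2 ^ m, which sends a cell to the coarser cell containing it.\<close>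

lemma dyadic_sum_mod:
  assumes q: "dyadic q" and "m \<le> m'"
  shows "(\<Sum>j<2 ^ m'. q m' j * G (j mod 2 ^ m)) = (\<Sum>j<2 ^ m. q m j * (G j :: real))"
  using assms(2)
proof (induction rule: dec_induct)
  case base
  then show ?case by simp
next
  case (step k)
  have "(j + 2 ^ k) mod 2 ^ m = j mod (2::nat) ^ m" for j
  proof -
    have "(2::nat) ^ m dvd 2 ^ k" using step by (intro le_imp_power_dvd) auto
    then have "(2::nat) ^ k mod 2 ^ m = 0" by simp
    then show ?thesis by (metis add.right_neutral mod_add_right_eq)
  qed
  then have "(\<Sum>j<2 ^ Suc k. q (Suc k) j * G (j mod 2 ^ m)) =
      (\<Sum>j<2 ^ k. (q (Suc k) j + q (Suc k) (j + 2 ^ k)) * G (j mod 2 ^ m))"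
    by (simp add: mult_2 sum_lessThan_add distrib_right sum.distrib)
  also have "\<dots> = (\<Sum>j<2 ^ k. q k j * G (j mod 2 ^ m))"
    by (intro sum.cong refl) (simp add: dyadic_split[OF q])
  finally show ?case using step.IH by simp
qed

lemma dyadic_sum: "dyadic q \<Longrightarrow> (\<Sum>j<2 ^ m. q m j) = 1"
  using dyadic_sum_mod[of q 0 m "\<lambda>_. 1"] by (simp add: dyadic_root)

lemma dyadic_le_mod:
  assumes "dyadic q" "m \<le> m'" "j < 2 ^ m'"
  shows "q m' j \<le> q m (j mod 2 ^ m)"
proof -
  let ?G = "\<lambda>i. if i = j mod 2 ^ m then 1 else (0 :: real)"
  have "q m' j * ?G (j mod 2 ^ m) \<le> (\<Sum>i<2 ^ m'. q m' i * ?G (i mod 2 ^ m))"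
    using assms by (intro member_le_sum) (auto simp: dyadic_nonneg)
  also have "\<dots> = (\<Sum>i<2 ^ m. q m i * ?G i)"
    by (rule dyadic_sum_mod) (use assms in auto)
  also have "\<dots> = q m (j mod 2 ^ m)"
    by (simp add: if_distrib[of "\<lambda>x. _ * x"] sum.delta cong: if_cong)
  finally show ?thesis by simp
qed

lemma dyadic_cells:
  fixes \<nu> :: "'a::topological_space measure"
  assumes \<nu>: "\<nu> \<in> prob_measures" and E: "\<And>i. E i \<in> sets borel"
  shows "dyadic (cells E \<nu>)"
proof -
  interpret prob_space \<nu> using \<nu> by (simp add: prob_measures_iff)
  have sets: "sets \<nu> = sets borel" using \<nu> by (simp add: prob_measures_iff)
  have space: "space \<nu> = UNIV" using sets_eq_imp_space_eq[OF sets] by simp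
  show ?thesis
  proof (rule dyadicI)
    have "{x. label E 0 x = 0} = space \<nu>" by (simp add: space)
    then show "cells E \<nu> 0 0 = 1" by (simp only: cells_def prob_space)
  next
    fix m j :: nat assume j: "j < 2 ^ m"
    let ?A = "{x. label E (Suc m) x = j}" and ?B = "{x. label E (Suc m) x = j + 2 ^ m}"
    have "{x. label E m x = j} = ?A \<union> ?B"
    proof (rule set_eqI)
      fix x show "x \<in> {x. label E m x = j} \<longleftrightarrow> x \<in> ?A \<union> ?B"
        using j label_less[of E m x] by (auto simp: label_Suc)
    qed
    moreover have "measure \<nu> (?A \<union> ?B) = measure \<nu> ?A + measure \<nu> ?B"
      by (rule finite_measure_Union) (auto simp: sets sets_label[OF E])
    ultimately show "cells E \<nu> m j = cells E \<nu> (Suc m) j + cells E \<nu> (Suc m) (j + 2 ^ m)"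
      by (simp only: cells_def)
  qed (simp add: cells_def)
qed

lemma
  fixes \<pi> :: "'a::topological_space measure" and F :: "nat \<Rightarrow> real"
  assumes \<pi>: "\<pi> \<in> prob_measures" and E: "\<And>i. E i \<in> sets borel"
  shows integrable_label: "integrable \<pi> (\<lambda>x. F (label E m x))"
    and integral_label: "(\<integral>x. F (label E m x) \<partial>\<pi>) = (\<Sum>j<2 ^ m. cells E \<pi> m j * F j)"
proof -
  interpret prob_space \<pi> using \<pi> by (simp add: prob_measures_iff)
  have sets: "sets \<pi> = sets borel" using \<pi> by (simp add: prob_measures_iff)
  have space: "space \<pi> = UNIV" using sets_eq_imp_space_eq[OF sets] by simp
  have S [measurable]: "{x. label E m x = j} \<in> sets \<pi>" for j
    using sets_label[OF E] sets by simp
  have int: "integrable \<pi> (\<lambda>x. F j * indicator {x. label E m x = j} x)" for j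
    by (intro integrable_mult_right integrable_real_indicator S) (simp add: emeasure_finite less_top[symmetric])
  have eq: "F (label E m x) = (\<Sum>j<2 ^ m. F j * indicator {x. label E m x = j} x)" for x
    using label_less[of E m x] by (simp add: indicator_def if_distrib[of "\<lambda>x. _ * x"] sum.delta' cong: if_cong)
  show "integrable \<pi> (\<lambda>x. F (label E m x))"
    unfolding eq by (intro Bochner_Integration.integrable_sum int)
  show "(\<integral>x. F (label E m x) \<partial>\<pi>) = (\<Sum>j<2 ^ m. cells E \<pi> m j * F j)"
    unfolding eq using int
    by (subst Bochner_Integration.integral_sum) (auto simp: cells_def space mult.commute)
qed

text \<open>Apply ln t \<le> t - 1 to t = sqrt (b / a): the entropy term is at least 2 a - 2 sqrt (a
  b), and the linear terms complete the square.\<close>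

lemma sqrt_diff_square_le_entropy:
  fixes a b :: real
  assumes "0 \<le> a" "0 \<le> b" "b = 0 \<Longrightarrow> a = 0"
  shows "(sqrt a - sqrt b)\<^sup>2 \<le> a * (ln a - ln b) - a + b"
proof (cases "a = 0")
  case True
  then show ?thesis using assms by simp
next
  case False
  then have pos: "a > 0" "b > 0" using assms by (auto simp: less_le)
  define t where "t = sqrt b / sqrt a"
  have t: "t > 0" using pos by (simp add: t_def)
  have "ln t = (ln b - ln a) / 2"
    using pos by (simp add: t_def ln_div ln_sqrt diff_divide_distrib)
  moreover have "ln t \<le> t - 1" by (rule ln_le_minus_one[OF t])
  ultimately have "2 * (1 - t) \<le> ln a - ln b" by (simp add: field_simps)
  then have "a * (2 * (1 - t)) \<le> a * (ln a - ln b)" using pos by (intro mult_left_mono) auto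
  moreover have "a * t = sqrt a * sqrt b"
    using pos by (simp add: t_def field_simps)
  ultimately show ?thesis
    using pos by (simp add: power2_diff algebra_simps)
qed

text \<open>
  The increment of the entropy along a refinement of the partition is the entropy of the finer
  conditional density relative to the coarser one, and so controls their Hellinger distance.
\<close>
lemma cell_entropy_hellinger:
  assumes p: "dyadic p" and q: "dyadic q" and dom: "\<And>m j. p m j = 0 \<Longrightarrow> q m j = 0" and "m \<le> m'"
  shows "(\<Sum>j<2 ^ m'. p m' j * (sqrt (q m' j / p m' j) -
      sqrt (q m (j mod 2 ^ m) / p m (j mod 2 ^ m)))\<^sup>2) \<le> cell_entropy p q m' - cell_entropy p q m"
proof -
  define a where "a j = q m' j / p m' j" for j
  define b where "b j = q m j / p m j" for j
  have pa: "p m' j * a j = q m' j" for j using dom[of m' j] by (simp add: a_def)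
  have pb: "p m j * b j = q m j" for j using dom[of m j] by (simp add: b_def)
  have "(\<Sum>j<2 ^ m'. p m' j * (sqrt (a j) - sqrt (b (j mod 2 ^ m)))\<^sup>2) \<le>
      (\<Sum>j<2 ^ m'. q m' j * ln (a j) - q m' j * ln (b (j mod 2 ^ m)) - q m' j + p m' j * b (j mod 2 ^ m))"
  proof (rule sum_mono)
    fix j :: nat assume "j \<in> {..<2 ^ m'}"
    then have j: "j < 2 ^ m'" by simp
    \<comment> \<open>A vanishing coarse density means that the coarse cell, and with it each of its
      subcells, has no mass under \<open>q\<close>; this excludes the default value of the logarithm
      at 0.\<close>
    have "a j = 0" if "b (j mod 2 ^ m) = 0"
    proof -
      have "q m (j mod 2 ^ m) = 0" using that pb[of "j mod 2 ^ m"] by simp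
      then have "q m' j = 0"
        using dyadic_le_mod[OF q \<open>m \<le> m'\<close> j] dyadic_nonneg[OF q, of m' j] by simp
      then show ?thesis by (simp add: a_def)
    qed
    then have "(sqrt (a j) - sqrt (b (j mod 2 ^ m)))\<^sup>2
        \<le> a j * (ln (a j) - ln (b (j mod 2 ^ m))) - a j + b (j mod 2 ^ m)"
      by (intro sqrt_diff_square_le_entropy) (auto simp: a_def b_def dyadic_nonneg p q)
    then have "p m' j * (sqrt (a j) - sqrt (b (j mod 2 ^ m)))\<^sup>2
        \<le> p m' j * (a j * (ln (a j) - ln (b (j mod 2 ^ m))) - a j + b (j mod 2 ^ m))"
      by (rule mult_left_mono) (rule dyadic_nonneg[OF p])
    also have "\<dots> = (p m' j * a j) * ln (a j) - (p m' j * a j) * ln (b (j mod 2 ^ m))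
        - p m' j * a j + p m' j * b (j mod 2 ^ m)"
      by (simp add: algebra_simps)
    finally show "p m' j * (sqrt (a j) - sqrt (b (j mod 2 ^ m)))\<^sup>2
        \<le> q m' j * ln (a j) - q m' j * ln (b (j mod 2 ^ m)) - q m' j + p m' j * b (j mod 2 ^ m)"
      by (simp add: pa)
  qed
  \<comment> \<open>Functions of the coarse cell are summed at the coarse level. The two linear
    terms both have total 1 and cancel, leaving the entropy difference.\<close>
  also have "\<dots> = (\<Sum>j<2 ^ m'. q m' j * ln (a j)) - (\<Sum>j<2 ^ m. q m j * ln (b j))
      - (\<Sum>j<2 ^ m'. q m' j) + (\<Sum>j<2 ^ m. p m j * b j)"
    using dyadic_sum_mod[OF q \<open>m \<le> m'\<close>, of "\<lambda>j. ln (b j)"] dyadic_sum_mod[OF p \<open>m \<le> m'\<close>, of b]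
    by (simp add: sum.distrib sum_subtractf)
  also have "(\<Sum>j<2 ^ m. p m j * b j) = 1"
    by (simp add: pb dyadic_sum[OF q])
  finally have "(\<Sum>j<2 ^ m'. p m' j * (sqrt (a j) - sqrt (b (j mod 2 ^ m)))\<^sup>2) \<le>
      (\<Sum>j<2 ^ m'. q m' j * ln (a j)) - (\<Sum>j<2 ^ m. q m j * ln (b j))"
    by (simp add: dyadic_sum[OF q])
  also have "\<dots> = cell_entropy p q m' - cell_entropy p q m"
    by (simp add: cell_entropy_def a_def b_def)
  finally show ?thesis by (simp add: a_def b_def)
qed

lemma cell_entropy_mono:
  assumes p: "dyadic p" and q: "dyadic q" and dom: "\<And>m j. p m j = 0 \<Longrightarrow> q m j = 0" and "m \<le> m'"
  shows "cell_entropy p q m \<le> cell_entropy p q m'"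
proof -
  have "0 \<le> (\<Sum>j<2 ^ m'. p m' j * (sqrt (q m' j / p m' j) -
      sqrt (q m (j mod 2 ^ m) / p m (j mod 2 ^ m)))\<^sup>2)"
    by (intro sum_nonneg mult_nonneg_nonneg dyadic_nonneg[OF p]) simp
  with cell_entropy_hellinger[OF assms] show ?thesis by linarith
qed

text \<open>The entropy on the trivial partition at level 0 is 1 ln (1 / 1) = 0, and refinement
  cannot decrease it.\<close>

lemma cell_entropy_nonneg:
  assumes p: "dyadic p" and q: "dyadic q" and dom: "\<And>m j. p m j = 0 \<Longrightarrow> q m j = 0"
  shows "0 \<le> cell_entropy p q m"
  using cell_entropy_mono[OF assms, of 0 m] p q by (simp add: cell_entropy_def dyadic_root)

text \<open>The only delicate point is 0, where t ln t is squeezed between 2 t - 2 sqrt t and t^2 -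
  t; the lower bound is \<open>mult_ln_ge\<close> at sqrt t.\<close>

lemma tendsto_mult_ln:
  fixes a :: "'b \<Rightarrow> real"
  assumes a: "(a \<longlongrightarrow> l) F" and nn: "\<And>k. 0 \<le> a k"
  shows "((\<lambda>k. a k * ln (a k)) \<longlongrightarrow> l * ln l) F"
proof (cases "l = 0")
  case False
  then show ?thesis by (intro tendsto_intros a)
next
  case True
  have up: "t * ln t \<le> t * t - t" if "0 \<le> t" for t :: real
  proof (cases "t = 0")
    case False
    then have "t * ln t \<le> t * (t - 1)"
      using that by (intro mult_left_mono ln_le_minus_one) auto
    then show ?thesis by (simp add: right_diff_distrib)
  qed simp
  have low: "2 * t - 2 * sqrt t \<le> t * ln t" if "0 \<le> t" for t :: real
  proof (cases "t = 0")
    case False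
    then have "2 * sqrt t * (sqrt t - 1) \<le> 2 * sqrt t * (sqrt t * ln (sqrt t))"
      using that by (intro mult_left_mono mult_ln_ge) auto
    moreover have "2 * sqrt t * (sqrt t * ln (sqrt t)) = t * ln t"
      using that False by (simp add: ln_sqrt)
    ultimately show ?thesis using that by (simp add: right_diff_distrib mult.assoc)
  qed simp
  have "((\<lambda>k. 2 * a k - 2 * sqrt (a k)) \<longlongrightarrow> 2 * l - 2 * sqrt l) F"
    "((\<lambda>k. a k * a k - a k) \<longlongrightarrow> l * l - l) F"
    by (intro tendsto_intros a)+
  then have "((\<lambda>k. 2 * a k - 2 * sqrt (a k)) \<longlongrightarrow> 0) F" "((\<lambda>k. a k * a k - a k) \<longlongrightarrow> 0) F"
    by (simp_all add: True)
  then have "((\<lambda>k. a k * ln (a k)) \<longlongrightarrow> 0) F"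
    by (rule tendsto_sandwich[OF always_eventually always_eventually, rotated 2])
      (intro allI up low nn)+
  then show ?thesis by (simp add: True)
qed

text \<open>Factor a - b through the square roots and apply Young's inequality with weight
  \<open>c\<close>. The weight is kept free in order to balance the two terms later.\<close>

lemma abs_diff_le_hellinger:
  fixes a b c :: real
  assumes "0 \<le> a" "0 \<le> b" "0 < c"
  shows "\<bar>a - b\<bar> \<le> c / 2 * (sqrt a - sqrt b)\<^sup>2 + (a + b) / c"
proof -
  let ?x = "sqrt a - sqrt b" and ?y = "sqrt a + sqrt b"
  have "a - b = ?x * ?y" using assms by (simp add: algebra_simps)
  then have "\<bar>a - b\<bar> = \<bar>?x\<bar> * ?y" using assms by (simp add: abs_mult)
  also have "\<dots> \<le> c / 2 * ?x\<^sup>2 + ?y\<^sup>2 / (2 * c)"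
  proof -
    have "0 \<le> (c * \<bar>?x\<bar> - ?y)\<^sup>2" by simp
    then have "2 * c * (\<bar>?x\<bar> * ?y) \<le> c * c * ?x\<^sup>2 + ?y\<^sup>2"
      by (simp add: power2_diff power_mult_distrib power2_eq_square[of c] mult_ac)
    then show ?thesis using \<open>0 < c\<close> by (simp add: field_simps)
  qed
  also have "?y\<^sup>2 / (2 * c) \<le> 2 * (a + b) / (2 * c)"
  proof (rule divide_right_mono)
    have "0 \<le> ?x\<^sup>2" by simp
    then show "?y\<^sup>2 \<le> 2 * (a + b)" using assms by (simp add: power2_diff power2_sum)
  qed (use assms in simp)
  also have "2 * (a + b) / (2 * c) = (a + b) / c" using assms by (simp add: field_simps)
  finally show ?thesis by simp
qed


text \<open>
  The densities \<open>q\<^sub>m / p\<^sub>m\<close> are Cauchy in \<open>L\<^sup>1\<close> by the Hellinger bound, hence converge almost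
  everywhere along a subsequence; Fatou's lemma bounds the entropy of the limit.
\<close>
lemma dyadic_density:
  fixes \<pi> :: "'a::topological_space measure"
  assumes \<pi>: "\<pi> \<in> prob_measures" and E: "\<And>i. E i \<in> sets borel" and q: "dyadic q"
    and dom: "\<And>m j. cells E \<pi> m j = 0 \<Longrightarrow> q m j = 0"
    and L: "\<And>m. cell_entropy (cells E \<pi>) q m \<le> L"
  obtains h :: "'a \<Rightarrow> real" where "h \<in> borel_measurable \<pi>" "\<And>x. 0 \<le> h x" "integrable \<pi> h"
    "\<And>m j. j < 2 ^ m \<Longrightarrow> (\<integral>x. h x * indicator {x. label E m x = j} x \<partial>\<pi>) = q m j"
    "integrable \<pi> (\<lambda>x. h x * ln (h x))" "(\<integral>x. h x * ln (h x) \<partial>\<pi>) \<le> L"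
proof -
  interpret prob_space \<pi> using \<pi> by (simp add: prob_measures_iff)
  have sets: "sets \<pi> = sets borel" using \<pi> by (simp add: prob_measures_iff)
  define p where "p = cells E \<pi>"
  have p: "dyadic p" unfolding p_def by (rule dyadic_cells[OF \<pi> E])
  have dom: "p m j = 0 \<Longrightarrow> q m j = 0" for m j using dom by (simp add: p_def)
  have S [measurable]: "{x. label E m x = j} \<in> sets \<pi>" for m j
    using sets_label[OF E] sets by simp
  have [measurable]: "label E m \<in> measurable \<pi> (count_space UNIV)" for m
    by (rule measurable_label) (simp add: E sets)
  define H where "H m = cell_entropy p q m" for m
  have H_mono: "H m \<le> H m'" if "m \<le> m'" for m m'
    unfolding H_def by (rule cell_entropy_mono[OF p q dom that])
  have H_le: "H m \<le> L" for m using L by (simp add: H_def p_def)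
  have "incseq H" using H_mono by (simp add: incseq_def)
  then obtain Hl where Hl: "H \<longlonglongrightarrow> Hl" "\<And>m. H m \<le> Hl"
    using incseq_convergent[of H L] H_le by blast
  have "\<exists>N. \<forall>m\<ge>N. Hl - (1 / 4) ^ k < H m" for k
    using order_tendstoD(1)[OF Hl(1), of "Hl - (1 / 4) ^ k"] by (simp add: eventually_sequentially)
  then obtain N where N: "\<And>k m. N k \<le> m \<Longrightarrow> Hl - (1 / 4) ^ k < H m" by metis
  \<comment> \<open>The sum of all earlier thresholds makes the levels increase while passing
    \<open>N k\<close>, so that entropy increments are at most 4 ^ -k; the summand \<open>k\<close>
    makes them exhaust all levels.\<close>
  define s where "s k = k + (\<Sum>i\<le>k. N i)" for k
  have s_Suc: "s k \<le> s (Suc k)" for k by (simp add: s_def)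
  have s_ge: "k \<le> s k" for k by (simp add: s_def)
  have "N k \<le> s k" for k
    unfolding s_def by (rule trans_le_add2) (rule member_le_sum, auto)
  then have s_H: "H (s (Suc k)) - H (s k) \<le> (1 / 4) ^ k" for k
    using N[of k "s k"] Hl(2)[of "s (Suc k)"] by force
  define F where "F m j = q m j / p m j" for m j
  have F0: "0 \<le> F m j" for m j by (simp add: F_def dyadic_nonneg p q)
  have pF: "p m j * F m j = q m j" for m j using dom[of m j] by (simp add: F_def)
  have int_label: "integrable \<pi> (\<lambda>x. F (label E m x))" for F :: "nat \<Rightarrow> real" and m
    by (rule integrable_label[OF \<pi> E])
  have eq_label: "(\<integral>x. F (label E m x) \<partial>\<pi>) = (\<Sum>j<2 ^ m. p m j * F j)" for F :: "nat \<Rightarrow> real" and m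
    unfolding p_def by (rule integral_label[OF \<pi> E])
  \<comment> \<open>The density of \<open>q\<close> relative to \<open>\<pi>\<close> on the
    partition of level \<open>s k\<close>: a nonnegative martingale of mean 1.\<close>
  define u where "u k x = F (s k) (label E (s k) x)" for k x
  have u0: "0 \<le> u k x" for k x by (simp add: u_def F0)
  have u_int: "integrable \<pi> (u k)" for k unfolding u_def by (rule int_label)
  have u_one: "expectation (u k) = 1" for k
    using eq_label[of "F (s k)" "s k"] by (simp add: u_def[abs_def] pF dyadic_sum[OF q])
  have u_meas [measurable]: "u k \<in> borel_measurable \<pi>" for k
    using u_int by (rule borel_measurable_integrable)
  define D where "D k j = (sqrt (F (s (Suc k)) j) - sqrt (F (s k) (j mod 2 ^ s k)))\<^sup>2" for k j
  have hell_eq: "(\<lambda>x. (sqrt (u (Suc k) x) - sqrt (u k x))\<^sup>2) = (\<lambda>x. D k (label E (s (Suc k)) x))" for k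
    by (simp add: u_def D_def label_mod[OF s_Suc])
  have hell_int: "integrable \<pi> (\<lambda>x. (sqrt (u (Suc k) x) - sqrt (u k x))\<^sup>2)" for k
    unfolding hell_eq by (rule int_label)
  have hell: "expectation (\<lambda>x. (sqrt (u (Suc k) x) - sqrt (u k x))\<^sup>2) \<le> (1 / 4) ^ k" for k
  proof -
    have "expectation (\<lambda>x. (sqrt (u (Suc k) x) - sqrt (u k x))\<^sup>2) \<le> H (s (Suc k)) - H (s k)"
      unfolding hell_eq eq_label[of "D k" "s (Suc k)"]
      using cell_entropy_hellinger[OF p q dom s_Suc[of k]] by (simp add: D_def F_def H_def)
    then show ?thesis using s_H[of k] by linarith
  qed
  define v where "v k x = u (Suc k) x - u k x" for k x
  have v_int: "integrable \<pi> (v k)" for k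
    unfolding v_def by (intro Bochner_Integration.integrable_diff u_int)
  have v_meas [measurable]: "v k \<in> borel_measurable \<pi>" for k
    using v_int by (rule borel_measurable_integrable)
  \<comment> \<open>The weight 2 ^ k balances the Hellinger bound 4 ^ -k against the masses: 2 ^ k /
    2 * 4 ^ -k + 2 / 2 ^ k = (5 / 2) 2 ^ -k.\<close>
  have v_le: "expectation (\<lambda>x. \<bar>v k x\<bar>) \<le> 3 * (1 / 2) ^ k" for k
  proof -
    have "expectation (\<lambda>x. \<bar>v k x\<bar>) \<le> expectation (\<lambda>x. 2 ^ k / 2 *
        (sqrt (u (Suc k) x) - sqrt (u k x))\<^sup>2 + (u (Suc k) x + u k x) / 2 ^ k)"
    proof (rule integral_mono)
      show "integrable \<pi> (\<lambda>x. \<bar>v k x\<bar>)" using v_int by (rule integrable_abs)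
      show "integrable \<pi> (\<lambda>x. 2 ^ k / 2 *
        (sqrt (u (Suc k) x) - sqrt (u k x))\<^sup>2 + (u (Suc k) x + u k x) / 2 ^ k)"
        by (intro Bochner_Integration.integrable_add integrable_mult_right integrable_divide hell_int u_int)
      show "\<bar>v k x\<bar> \<le> 2 ^ k / 2 *
        (sqrt (u (Suc k) x) - sqrt (u k x))\<^sup>2 + (u (Suc k) x + u k x) / 2 ^ k" for x
        unfolding v_def by (rule abs_diff_le_hellinger) (simp_all add: u0)
    qed
    also have "\<dots> = 2 ^ k / 2 * expectation (\<lambda>x. (sqrt (u (Suc k) x) - sqrt (u k x))\<^sup>2) + 2 / 2 ^ k"
    proof -
      have "expectation (\<lambda>x. (u (Suc k) x + u k x) / 2 ^ k) = 2 / 2 ^ k"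
        using u_int by (simp add: u_one)
      then show ?thesis
        using hell_int[of k] u_int
        by (subst Bochner_Integration.integral_add) auto
    qed
    also have "\<dots> \<le> 2 ^ k / 2 * (1 / 4) ^ k + 2 / 2 ^ k"
      by (intro add_right_mono mult_left_mono hell) simp
    also have "\<dots> = (1 / 2) ^ k * (1 / 2 + 2)"
    proof -
      have "(2::real) ^ k * (1 / 4) ^ k = (1 / 2) ^ k" by (simp flip: power_mult_distrib)
      then show ?thesis by (simp add: power_one_over field_simps)
    qed
    also have "\<dots> \<le> 3 * (1 / 2) ^ k" by simp
    finally show ?thesis .
  qed
  \<comment> \<open>The total variation of the sequence \<open>u k x\<close> in \<open>k\<close>.
    Its integrability gives almost sure convergence and, added to \<open>u 0\<close>, a dominating
    function.\<close>
  define w where "w x = (\<Sum>k. ennreal \<bar>v k x\<bar>)" for x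
  have w_fin: "(\<integral>\<^sup>+x. w x \<partial>\<pi>) < \<infinity>"
  proof -
    have "(\<integral>\<^sup>+x. w x \<partial>\<pi>) = (\<Sum>k. \<integral>\<^sup>+x. ennreal \<bar>v k x\<bar> \<partial>\<pi>)"
      unfolding w_def by (rule nn_integral_suminf) simp
    also have "\<dots> \<le> (\<Sum>k. ennreal (3 * (1 / 2) ^ k))"
    proof (rule suminf_le)
      fix k
      have "(\<integral>\<^sup>+x. ennreal \<bar>v k x\<bar> \<partial>\<pi>) = ennreal (expectation (\<lambda>x. \<bar>v k x\<bar>))"
        by (rule nn_integral_eq_integral) (use v_int in auto)
      then show "(\<integral>\<^sup>+x. ennreal \<bar>v k x\<bar> \<partial>\<pi>) \<le> ennreal (3 * (1 / 2) ^ k)"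
        using v_le by (simp add: ennreal_leI)
    qed simp_all
    also have "\<dots> = ennreal (\<Sum>k. 3 * (1 / 2) ^ k)"
      by (rule suminf_ennreal2) (auto intro!: summable_mult summable_geometric)
    finally show ?thesis using order_le_less_trans by fastforce
  qed
  have w_meas [measurable]: "w \<in> borel_measurable \<pi>" unfolding w_def by measurable
  \<comment> \<open>On the null set where absolute convergence fails, the value of the sum is
    uncontrolled; the maximum with 0 keeps \<open>h\<close> nonnegative everywhere and changes
    nothing where the nonnegative \<open>u k\<close> converge.\<close>
  define h where "h x = max 0 (u 0 x + (\<Sum>k. v k x))" for x
  have h_meas [measurable]: "h \<in> borel_measurable \<pi>" unfolding h_def by measurable
  have h0: "0 \<le> h x" for x by (simp add: h_def)
  have AE_w: "AE x in \<pi>. w x \<noteq> \<infinity>"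
    using w_fin by (intro nn_integral_noteq_infinite) auto
  have u_sum: "u k x = u 0 x + (\<Sum>i<k. v i x)" for k x
    using sum_lessThan_telescope[of "\<lambda>i. u i x" k] by (simp add: v_def)
  have conv: "AE x in \<pi>. (\<lambda>k. u k x) \<longlonglongrightarrow> h x"
    using AE_w
  proof eventually_elim
    case (elim x)
    then have "summable (\<lambda>k. \<bar>v k x\<bar>)"
      unfolding w_def by (intro summable_suminf_not_top) auto
    then have "summable (\<lambda>k. v k x)" by (rule summable_rabs_cancel)
    then have "(\<lambda>k. u 0 x + (\<Sum>i<k. v i x)) \<longlonglongrightarrow> u 0 x + (\<Sum>k. v k x)"
      by (intro tendsto_intros summable_LIMSEQ)
    then have lim: "(\<lambda>k. u k x) \<longlonglongrightarrow> u 0 x + (\<Sum>k. v k x)"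
      by (simp only: u_sum[symmetric])
    moreover have "0 \<le> u 0 x + (\<Sum>k. v k x)"
      by (rule LIMSEQ_le_const[OF lim]) (simp add: u0)
    ultimately show ?case by (simp add: h_def)
  qed
  define W where "W x = u 0 x + enn2real (w x)" for x
  have W_int: "integrable \<pi> W"
    unfolding W_def
  proof (intro Bochner_Integration.integrable_add u_int)
    have "(\<integral>\<^sup>+x. ennreal (enn2real (w x)) \<partial>\<pi>) = (\<integral>\<^sup>+x. w x \<partial>\<pi>)"
      by (rule nn_integral_cong_AE) (use AE_w in eventually_elim, simp add: less_top)
    then show "integrable \<pi> (\<lambda>x. enn2real (w x))"
      using w_fin by (intro integrableI_nonneg) auto
  qed
  have u_le: "AE x in \<pi>. u k x \<le> W x" for k
    using AE_w
  proof eventually_elim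
    case (elim x)
    have "ennreal (\<Sum>i<k. \<bar>v i x\<bar>) = (\<Sum>i<k. ennreal \<bar>v i x\<bar>)" by simp
    also have "\<dots> \<le> w x" unfolding w_def by (rule sum_le_suminf) auto
    also have "w x = ennreal (enn2real (w x))" using elim by (simp add: less_top)
    finally have "(\<Sum>i<k. \<bar>v i x\<bar>) \<le> enn2real (w x)" by (simp add: ennreal_le_iff)
    moreover have "(\<Sum>i<k. v i x) \<le> (\<Sum>i<k. \<bar>v i x\<bar>)" by (rule sum_mono) simp
    ultimately show ?case by (simp add: W_def u_sum[of k x])
  qed
  have h_int: "integrable \<pi> h"
    by (rule integrable_dominated_convergence[of h \<pi> u W])
      (use W_int conv u_le u0 in auto)
  have h_cell: "(\<integral>x. h x * indicator {x. label E m x = j} x \<partial>\<pi>) = q m j" if j: "j < 2 ^ m" for m j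
  proof -
    \<comment> \<open>Once the level \<open>s k\<close> is finer than \<open>m\<close>, the density
      \<open>u k\<close> reproduces \<open>q m j\<close> exactly, so the limit is an eventually
      constant sequence.\<close>
    have u_cell: "expectation (\<lambda>x. u k x * indicator {x. label E m x = j} x) = q m j" if k: "m \<le> k" for k
    proof -
      have le: "m \<le> s k" using k s_ge[of k] by linarith
      have "expectation (\<lambda>x. u k x * indicator {x. label E m x = j} x) =
          expectation (\<lambda>x. F (s k) (label E (s k) x) * (if label E (s k) x mod 2 ^ m = j then 1 else 0))"
        by (rule Bochner_Integration.integral_cong) (auto simp: u_def label_mod[OF le] indicator_def)
      also have "\<dots> = (\<Sum>i<2 ^ s k. p (s k) i * (F (s k) i * (if i mod 2 ^ m = j then 1 else 0)))"
        by (rule eq_label)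
      also have "\<dots> = (\<Sum>i<2 ^ s k. q (s k) i * (if i mod 2 ^ m = j then 1 else 0))"
        by (simp only: mult.assoc[symmetric] pF)
      also have "\<dots> = (\<Sum>i<2 ^ m. q m i * (if i = j then 1 else 0))"
        by (rule dyadic_sum_mod[OF q le, where G = "\<lambda>i. if i = j then 1 else 0"])
      also have "\<dots> = q m j"
        using j by (simp add: if_distrib[of "\<lambda>x. _ * x"] sum.delta cong: if_cong)
      finally show ?thesis .
    qed
    have "(\<lambda>k. expectation (\<lambda>x. u k x * indicator {x. label E m x = j} x))
        \<longlonglongrightarrow> expectation (\<lambda>x. h x * indicator {x. label E m x = j} x)"
    proof (rule integral_dominated_convergence[where w = W])
      show "AE x in \<pi>. (\<lambda>k. u k x * indicator {x. label E m x = j} x)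
          \<longlonglongrightarrow> h x * indicator {x. label E m x = j} x"
        using conv by eventually_elim (intro tendsto_intros)
      show "AE x in \<pi>. norm (u k x * indicator {x. label E m x = j} x) \<le> W x" for k
        using u_le[of k]
      proof eventually_elim
        case (elim x)
        then show ?case using u0[of k x] by (simp add: indicator_def)
      qed
    qed (use W_int in measurable)
    moreover have "(\<lambda>k. expectation (\<lambda>x. u k x * indicator {x. label E m x = j} x)) \<longlonglongrightarrow> q m j"
      by (rule tendsto_eventually) (use u_cell in \<open>auto simp: eventually_sequentially\<close>)
    ultimately show ?thesis by (rule LIMSEQ_unique)
  qed
  have phi_int: "integrable \<pi> (\<lambda>x. u k x * ln (u k x))" for k
    unfolding u_def by (rule int_label[of "\<lambda>j. F (s k) j * ln (F (s k) j)"])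
  have phi_H: "expectation (\<lambda>x. u k x * ln (u k x)) = H (s k)" for k
  proof -
    have "expectation (\<lambda>x. u k x * ln (u k x)) = (\<Sum>j<2 ^ s k. p (s k) j * (F (s k) j * ln (F (s k) j)))"
      unfolding u_def by (rule eq_label[of "\<lambda>j. F (s k) j * ln (F (s k) j)"])
    also have "\<dots> = (\<Sum>j<2 ^ s k. q (s k) j * ln (F (s k) j))"
      by (simp only: mult.assoc[symmetric] pF)
    finally show ?thesis by (simp add: H_def cell_entropy_def F_def)
  qed
  \<comment> \<open>Adding 1 makes the entropy integrand nonnegative, as Fatou's lemma for
    nonnegative integrals requires.\<close>
  have phi_ge: "0 \<le> t * ln t + 1" if "0 \<le> t" for t :: real
    using mult_ln_ge[OF that] that by linarith
  have "(\<integral>\<^sup>+x. ennreal (h x * ln (h x) + 1) \<partial>\<pi>) =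
      (\<integral>\<^sup>+x. liminf (\<lambda>k. ennreal (u k x * ln (u k x) + 1)) \<partial>\<pi>)"
  proof (rule nn_integral_cong_AE)
    show "AE x in \<pi>. ennreal (h x * ln (h x) + 1) = liminf (\<lambda>k. ennreal (u k x * ln (u k x) + 1))"
      using conv
    proof eventually_elim
      case (elim x)
      have "(\<lambda>k. ennreal (u k x * ln (u k x) + 1)) \<longlonglongrightarrow> ennreal (h x * ln (h x) + 1)"
        by (intro tendsto_ennrealI tendsto_add tendsto_const tendsto_mult_ln elim u0)
      then show ?case by (simp add: lim_imp_Liminf)
    qed
  qed
  also have "\<dots> \<le> liminf (\<lambda>k. \<integral>\<^sup>+x. ennreal (u k x * ln (u k x) + 1) \<partial>\<pi>)"
    by (rule nn_integral_liminf) measurable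
  also have "\<dots> \<le> liminf (\<lambda>k::nat. ennreal (L + 1))"
  proof (rule Liminf_mono, rule always_eventually, rule allI)
    fix k
    have "(\<integral>\<^sup>+x. ennreal (u k x * ln (u k x) + 1) \<partial>\<pi>) = ennreal (expectation (\<lambda>x. u k x * ln (u k x) + 1))"
      by (rule nn_integral_eq_integral) (use phi_int phi_ge[OF u0] in auto)
    also have "expectation (\<lambda>x. u k x * ln (u k x) + 1) = H (s k) + 1"
      using phi_int by (simp add: phi_H prob_space)
    finally show "(\<integral>\<^sup>+x. ennreal (u k x * ln (u k x) + 1) \<partial>\<pi>) \<le> ennreal (L + 1)"
      using H_le by (simp add: ennreal_leI)
  qed
  finally have fatou: "(\<integral>\<^sup>+x. ennreal (h x * ln (h x) + 1) \<partial>\<pi>) \<le> ennreal (L + 1)"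
    by (simp add: Liminf_const)
  have int1: "integrable \<pi> (\<lambda>x. h x * ln (h x) + 1)"
    using phi_ge[OF h0] order_le_less_trans[OF fatou] by (intro integrableI_nonneg) auto
  have int2: "integrable \<pi> (\<lambda>x. h x * ln (h x))"
    using Bochner_Integration.integrable_diff[OF int1 integrable_const[of 1]] by simp
  \<comment> \<open>\<open>ennreal\<close> truncates negative reals to 0, so the sign is checked
    before returning to real numbers; it follows from the entropy 0 at level 0.\<close>
  have "L + 1 \<ge> 0"
    using H_le[of 0] by (simp add: H_def cell_entropy_def dyadic_root[OF p] dyadic_root[OF q])
  have "ennreal (expectation (\<lambda>x. h x * ln (h x) + 1)) \<le> ennreal (L + 1)"
    using fatou nn_integral_eq_integral[OF int1] phi_ge[OF h0] by simp
  then have "expectation (\<lambda>x. h x * ln (h x) + 1) \<le> L + 1"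
    using \<open>L + 1 \<ge> 0\<close> by (simp add: ennreal_le_iff)
  moreover have "expectation (\<lambda>x. h x * ln (h x) + 1) = expectation (\<lambda>x. h x * ln (h x)) + 1"
    using int2 by (simp add: prob_space)
  ultimately have "expectation (\<lambda>x. h x * ln (h x)) \<le> L" by linarith
  from that[OF h_meas h0 h_int h_cell int2 this] show thesis .
qed

section \<open>Bounds on the partition function\<close>

text \<open>A point lies in \<open>E i\<close> exactly when binary digit \<open>i\<close> of its
  code at level i + 1 is set, and being the leading digit it is set iff the code is at least 2 ^
  i.\<close>

lemma measure_base_eq_cells:
  fixes \<nu> :: "'a::topological_space measure"
  assumes \<nu>: "\<nu> \<in> prob_measures" and E: "\<And>i. E i \<in> sets borel"
  shows "measure \<nu> (E i) = (\<Sum>j<2 ^ Suc i. cells E \<nu> (Suc i) j * (if 2 ^ i \<le> j then 1 else 0))"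
proof -
  have sets: "sets \<nu> = sets borel" using \<nu> by (simp add: prob_measures_iff)
  have "(\<lambda>x. if 2 ^ i \<le> label E (Suc i) x then 1 else 0) = (indicator (E i) :: 'a \<Rightarrow> real)"
    using label_less[of E i] by (auto simp: label_Suc indicator_def not_le fun_eq_iff)
  then show ?thesis
    using integral_label[where E = E and F = "\<lambda>j. if 2 ^ i \<le> j then 1 else 0" and m = "Suc i", OF \<nu> E] E[of i]
    by (simp add: sets sets_eq_imp_space_eq[OF sets])
qed

text \<open>Each level has finitely many null cells and there are countably many levels. On the
  remaining configurations the empirical cell masses are dominated by those of \<open>\<pi>\<close>,
  as the entropy estimates require.\<close>

lemma AE_cells_nonzero:
  fixes \<pi> :: "'a::topological_space measure"
  assumes \<pi>: "\<pi> \<in> prob_measures" and E: "\<And>i. E i \<in> sets borel"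
  shows "AE x in power_measure n \<pi>. \<forall>i<n. \<forall>m. cells E \<pi> m (label E m (x i)) \<noteq> 0"
proof -
  interpret prob_space \<pi> using \<pi> by (simp add: prob_measures_iff)
  have "AE y in \<pi>. cells E \<pi> m (label E m y) \<noteq> 0" for m
  proof -
    let ?F = "\<lambda>j. if cells E \<pi> m j = 0 then 1 else (0 :: real)"
    have "(\<integral>y. ?F (label E m y) \<partial>\<pi>) = 0"
      by (subst integral_label[where E = E and F = ?F, OF \<pi> E]) (auto intro: sum.neutral)
    then have "AE y in \<pi>. ?F (label E m y) = 0"
      by (subst (asm) integral_nonneg_eq_0_iff_AE) (auto intro: integrable_label[where E = E and F = ?F, OF \<pi> E])
    then show ?thesis by eventually_elim (simp split: if_splits)
  qed
  then have "AE y in \<pi>. \<forall>m. cells E \<pi> m (label E m y) \<noteq> 0"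
    by (subst AE_all_countable) simp
  then have "AE x in power_measure n \<pi>. \<forall>m. cells E \<pi> m (label E m (x i)) \<noteq> 0" if "i < n" for i
    using that by (intro AE_PiM_component) (auto intro: prob_space_axioms)
  then have "AE x in power_measure n \<pi>. \<forall>i\<in>{..<n}. \<forall>m. cells E \<pi> m (label E m (x i)) \<noteq> 0"
    by (intro AE_finite_allI) auto
  then show ?thesis by eventually_elim auto
qed

lemma cells_empirical:
  fixes E :: "nat \<Rightarrow> 'a::topological_space set"
  assumes "n \<ge> 1" "\<And>i. E i \<in> sets borel"
  shows "cells E (empirical n x) m j = real (card {i\<in>{..<n}. label E m (x i) = j}) / real n"
  unfolding cells_def using measure_empirical[OF assms(1) sets_label[OF assms(2)]] by simp

text \<open>
  The method of types: \<open>e\<^bsup>n H\<^esup>\<close> is dominated by the sum, over the possible types \<open>k / n\<close>, of the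
  densities of the corresponding product measures.
\<close>
lemma nn_integral_exp_cell_entropy_le:
  fixes \<pi> :: "'a::topological_space measure"
  assumes \<pi>: "\<pi> \<in> prob_measures" and E: "\<And>i. E i \<in> sets borel" and n: "n \<ge> 1"
  shows "(\<integral>\<^sup>+x. ennreal (exp (real n * cell_entropy (cells E \<pi>) (cells E (empirical n x)) m)) \<partial>power_measure n \<pi>)
    \<le> ennreal ((real n + 1) ^ 2 ^ m)"
proof -
  interpret prob_space \<pi> using \<pi> by (simp add: prob_measures_iff)
  interpret P: product_sigma_finite "\<lambda>_::nat. \<pi>"
    by (simp add: product_sigma_finite_def sigma_finite_measure_axioms)
  have sets: "sets \<pi> = sets borel" using \<pi> by (simp add: prob_measures_iff)
  have [measurable]: "label E m \<in> measurable \<pi> (count_space UNIV)"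
    by (rule measurable_label) (simp add: E sets)
  define p where "p = cells E \<pi> m"
  have p0: "0 \<le> p j" for j by (simp add: p_def cells_def)
  \<comment> \<open>The types: occupation numbers of the 2 ^ m cells, taken extensionally so that
    they can be counted as functions into {..n}.\<close>
  define K where "K = {k \<in> PiE {..<(2::nat) ^ m} (\<lambda>_. {..n}). (\<Sum>j<2 ^ m. k j) = n}"
  have K_sub: "K \<subseteq> PiE {..<(2::nat) ^ m} (\<lambda>_. {..n})" by (auto simp: K_def)
  have K_fin: "finite (PiE {..<(2::nat) ^ m} (\<lambda>_. {..n}))" by (intro finite_PiE) auto
  have "card K \<le> card (PiE {..<(2::nat) ^ m} (\<lambda>_. {..n}))" by (rule card_mono[OF K_fin K_sub])
  then have K_card: "card K \<le> (n + 1) ^ 2 ^ m" by (simp add: card_PiE)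
  \<comment> \<open>Density relative to \<open>\<pi>\<close> of a law giving cell \<open>j\<close>
    the mass k j / n. On null cells it is 0 by division by zero, so its total mass may fall below
    1.\<close>
  define G where "G k j = real (k j) / real n / p j" for k :: "nat \<Rightarrow> nat" and j
  have G0: "0 \<le> G k j" for k j by (simp add: G_def p0)
  have dom: "ennreal (exp (real n * cell_entropy (cells E \<pi>) (cells E (empirical n x)) m))
      \<le> (\<Sum>k\<in>K. \<Prod>i<n. ennreal (G k (label E m (x i))))"
    if good: "\<forall>i<n. \<forall>m. cells E \<pi> m (label E m (x i)) \<noteq> 0" for x
  proof -
    define c where "c j = card {i\<in>{..<n}. label E m (x i) = j}" for j
    define k where "k = restrict c {..<2 ^ m}"
    have sub: "(\<lambda>i. label E m (x i)) ` {..<n} \<subseteq> {..<2 ^ m}" using label_less by auto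
    have "(\<Sum>j<2 ^ m. \<Sum>i\<in>{i\<in>{..<n}. label E m (x i) = j}. 1) = (\<Sum>i<n. (1::nat))"
      by (rule sum.group) (use sub in auto)
    then have "(\<Sum>j<2 ^ m. c j) = n" by (simp add: c_def)
    moreover have "c j \<le> n" for j
      unfolding c_def using card_mono[of "{..<n}" "{i\<in>{..<n}. label E m (x i) = j}"] by auto
    ultimately have kK: "k \<in> K" by (auto simp: K_def k_def)
    \<comment> \<open>An occupied cell has positive mass under \<open>\<pi>\<close> because
      \<open>x\<close> is good; an empty cell contributes 1 on both sides.\<close>
    have factor: "exp (real (c j) * ln (real (c j) / real n / p j)) = (real (c j) / real n / p j) ^ c j" for j
    proof (cases "c j = 0")
      case False
      then obtain i where "i < n" "label E m (x i) = j"
        unfolding c_def by (metis (mono_tags, lifting) card.empty empty_Collect_eq lessThan_iff)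
      then have "p j > 0" using good p0[of j] by (auto simp: p_def less_le)
      then have "real (c j) / real n / p j > 0" using False n by simp
      then show ?thesis by (simp add: exp_of_nat_mult)
    qed simp
    have cells_c: "cells E (empirical n x) m j = real (c j) / real n" for j
      by (simp only: cells_empirical[where E = E, OF n E] c_def)
    have "exp (real n * cell_entropy (cells E \<pi>) (cells E (empirical n x)) m) =
        exp (\<Sum>j<2 ^ m. real (c j) * ln (real (c j) / real n / p j))"
      using n by (simp add: cell_entropy_def cells_c p_def[symmetric] sum_distrib_left)
    also have "\<dots> = (\<Prod>j<2 ^ m. (real (c j) / real n / p j) ^ c j)"
      by (simp only: exp_sum[OF finite_lessThan] factor)
    also have "\<dots> = (\<Prod>j<2 ^ m. \<Prod>i\<in>{i\<in>{..<n}. label E m (x i) = j}. G k (label E m (x i)))"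
      by (rule prod.cong) (simp_all add: G_def k_def c_def)
    also have "\<dots> = (\<Prod>i<n. G k (label E m (x i)))"
      by (rule prod.group) (use sub in auto)
    finally have "ennreal (exp (real n * cell_entropy (cells E \<pi>) (cells E (empirical n x)) m))
        = (\<Prod>i<n. ennreal (G k (label E m (x i))))"
      by (simp add: prod_ennreal G0)
    also have "\<dots> \<le> (\<Sum>k\<in>K. \<Prod>i<n. ennreal (G k (label E m (x i))))"
      by (rule member_le_sum[OF kK]) (use finite_subset[OF K_sub K_fin] in auto)
    finally show ?thesis .
  qed
  have one: "(\<integral>\<^sup>+y. ennreal (G k (label E m y)) \<partial>\<pi>) \<le> 1" if "k \<in> K" for k
  proof -
    have "(\<integral>\<^sup>+y. ennreal (G k (label E m y)) \<partial>\<pi>) = ennreal (\<integral>y. G k (label E m y) \<partial>\<pi>)"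
      by (rule nn_integral_eq_integral) (auto simp: G0 intro: integrable_label[where E = E, OF \<pi> E])
    also have "(\<integral>y. G k (label E m y) \<partial>\<pi>) = (\<Sum>j<2 ^ m. p j * G k j)"
      by (simp add: integral_label[where E = E, OF \<pi> E] p_def)
    also have "\<dots> \<le> (\<Sum>j<2 ^ m. real (k j) / real n)"
      by (rule sum_mono) (simp add: G_def)
    also have "\<dots> = real (\<Sum>j<2 ^ m. k j) / real n" by (simp add: sum_divide_distrib)
    also have "\<dots> = 1" using that n by (simp add: K_def)
    finally show ?thesis by (simp add: ennreal_leI)
  qed
  have "(\<integral>\<^sup>+x. ennreal (exp (real n * cell_entropy (cells E \<pi>) (cells E (empirical n x)) m)) \<partial>power_measure n \<pi>)
      \<le> (\<integral>\<^sup>+x. (\<Sum>k\<in>K. \<Prod>i<n. ennreal (G k (label E m (x i)))) \<partial>power_measure n \<pi>)"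
    by (rule nn_integral_mono_AE) (use AE_cells_nonzero[where E = E, OF \<pi> E] dom in \<open>rule eventually_mono\<close>)
  also have "\<dots> = (\<Sum>k\<in>K. \<integral>\<^sup>+x. (\<Prod>i<n. ennreal (G k (label E m (x i)))) \<partial>power_measure n \<pi>)"
    by (rule nn_integral_sum) measurable
  also have "\<dots> = (\<Sum>k\<in>K. \<Prod>i<n. \<integral>\<^sup>+y. ennreal (G k (label E m y)) \<partial>\<pi>)"
    by (intro sum.cong refl P.product_nn_integral_prod) auto
  also have "\<dots> \<le> (\<Sum>k\<in>K. \<Prod>i<n. 1)"
    by (intro sum_mono prod_mono_ennreal one)
  also have "\<dots> = of_nat (card K)" by simp
  also have "\<dots> \<le> of_nat ((n + 1) ^ 2 ^ m)"
    using K_card by (simp only: of_nat_le_iff)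
  also have "\<dots> = ennreal ((real n + 1) ^ 2 ^ m)"
    by (subst ennreal_of_nat_eq_real_of_nat) (simp add: add.commute)
  finally show ?thesis .
qed

section \<open>Upper and lower estimates for the logarithm of the partition function\<close>

lemma elog_mono: "x \<le> y \<Longrightarrow> elog x \<le> elog y"
  unfolding elog_def
  by (cases x; cases y) (auto simp: ennreal_le_iff top_unique ennreal_eq_0_iff)

lemma elog_ennreal: "0 < t \<Longrightarrow> elog (ennreal t) = ereal (ln t)"
  by (simp add: elog_def ennreal_eq_0_iff)

lemma eexp_ereal: "eexp (ereal t) = ennreal (exp t)"
  by (simp add: eexp_def)

lemma borel_measurable_eexp [measurable]: "eexp \<in> borel_measurable borel"
  unfolding eexp_def by measurable

lemma partition_function_eq:
  fixes \<pi> :: "'a::{metric_space, second_countable_topology} measure"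
  assumes \<pi>: "\<pi> \<in> prob_measures" and n: "n \<ge> 1"
    and Wn: "Wn n \<in> borel_measurable (power_measure n borel)"
    and f: "continuous_map weak_topology euclidean f"
  shows "(\<lambda>x. eexp (- (ereal (real n * b n) * Wn n x)) *
      ennreal (exp (- (real n * b n * f (empirical n x))))) \<in> borel_measurable (power_measure n \<pi>)"
    and "(\<integral>\<^sup>+x. ennreal (exp (- (real n * b n * f (empirical n x)))) \<partial>gibbs_measure \<pi> Wn b n) =
      (\<integral>\<^sup>+x. eexp (- (ereal (real n * b n) * Wn n x)) *
        ennreal (exp (- (real n * b n * f (empirical n x)))) \<partial>power_measure n \<pi>)"
proof -
  have sets: "sets \<pi> = sets borel" using \<pi> by (simp add: prob_measures_iff)
  have [measurable]: "(\<lambda>x. f (empirical n x)) \<in> borel_measurable (power_measure n \<pi>)"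
    by (rule borel_measurable_empirical[OF n f sets])
  have setsP: "sets (power_measure n \<pi>) = sets (power_measure n borel)"
    by (rule sets_PiM_cong) (simp_all add: sets)
  have [measurable]: "Wn n \<in> borel_measurable (power_measure n \<pi>)"
    using Wn by (simp only: measurable_cong_sets[OF setsP refl])
  show "(\<lambda>x. eexp (- (ereal (real n * b n) * Wn n x)) *
      ennreal (exp (- (real n * b n * f (empirical n x))))) \<in> borel_measurable (power_measure n \<pi>)"
    by measurable
  show "(\<integral>\<^sup>+x. ennreal (exp (- (real n * b n * f (empirical n x)))) \<partial>gibbs_measure \<pi> Wn b n) =
      (\<integral>\<^sup>+x. eexp (- (ereal (real n * b n) * Wn n x)) *
        ennreal (exp (- (real n * b n * f (empirical n x)))) \<partial>power_measure n \<pi>)"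
    unfolding gibbs_measure_def by (rule nn_integral_density) measurable
qed

text \<open>For almost every configuration the integrand is at most exp (- n b J) times exp (n H),
  with H the cell entropy, and counting types bounds the integral of the second factor.
  \<open>J\<close> is thus a lower bound of the discretised free energy over admissible
  configurations.\<close>

lemma partition_function_upper:
  fixes \<pi> :: "'a::{metric_space, second_countable_topology} measure"
  assumes \<pi>: "\<pi> \<in> prob_measures" and n: "n \<ge> 1" and b: "0 < b n"
    and Wn: "Wn n \<in> borel_measurable (power_measure n borel)"
    and Wn_values: "\<And>x. x \<in> configs n \<Longrightarrow> Wn n x \<noteq> -\<infinity>"
    and f: "continuous_map weak_topology euclidean f"
    and E: "\<And>i. E i \<in> sets borel"
    and J: "\<And>x. x \<in> configs n \<Longrightarrow> (\<forall>i<n. \<forall>m. cells E \<pi> m (label E m (x i)) \<noteq> 0) \<Longrightarrow>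
      ereal J \<le> ereal (f (empirical n x) + cell_entropy (cells E \<pi>) (cells E (empirical n x)) m / b n) + Wn n x"
  shows "ereal (1 / (real n * b n)) *
      elog (\<integral>\<^sup>+x. ennreal (exp (- (real n * b n * f (empirical n x)))) \<partial>gibbs_measure \<pi> Wn b n)
    \<le> ereal (2 ^ m * ln (real n + 1) / (real n * b n) - J)"
proof -
  let ?H = "\<lambda>x. cell_entropy (cells E \<pi>) (cells E (empirical n x)) m"
  let ?nb = "real n * b n"
  have nb: "?nb > 0" using n b by simp
  have sets: "sets \<pi> = sets borel" using \<pi> by (simp add: prob_measures_iff)
  have space: "space (power_measure n \<pi>) = configs n"
    by (intro sets_eq_imp_space_eq sets_PiM_cong) (simp_all add: sets)
  have "(\<integral>\<^sup>+x. ennreal (exp (- (?nb * f (empirical n x)))) \<partial>gibbs_measure \<pi> Wn b n) \<le>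
      (\<integral>\<^sup>+x. ennreal (exp (- ?nb * J)) * ennreal (exp (real n * ?H x)) \<partial>power_measure n \<pi>)"
    unfolding partition_function_eq(2)[where Wn = Wn and b = b, OF \<pi> n Wn f]
  proof (rule nn_integral_mono_AE)
    show "AE x in power_measure n \<pi>. eexp (- (ereal ?nb * Wn n x)) * ennreal (exp (- (?nb * f (empirical n x))))
        \<le> ennreal (exp (- ?nb * J)) * ennreal (exp (real n * ?H x))"
      using AE_cells_nonzero[where E = E, OF \<pi> E] AE_space
    proof eventually_elim
      case (elim x)
      then have x: "x \<in> configs n" by (simp add: space)
      show ?case
      proof (cases "Wn n x")
        case (real w)
        have "J \<le> f (empirical n x) + ?H x / b n + w"
          using J[OF x elim(1)] by (simp add: real)
        then have "?nb * J \<le> ?nb * (f (empirical n x) + ?H x / b n + w)"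
          using nb by (intro mult_left_mono) auto
        also have "\<dots> = ?nb * f (empirical n x) + real n * ?H x + ?nb * w"
          using b by (simp add: field_simps)
        finally have "exp (- (?nb * w)) * exp (- (?nb * f (empirical n x)))
            \<le> exp (- ?nb * J) * exp (real n * ?H x)"
          by (simp flip: exp_add)
        then show ?thesis
          by (simp add: real eexp_ereal ennreal_leI flip: ennreal_mult)
      next
        case PInf
        then show ?thesis using n b by (simp add: eexp_def)
      next
        case MInf
        then show ?thesis using Wn_values[OF x] by simp
      qed
    qed
  qed
  also have "\<dots> \<le> ennreal (exp (- ?nb * J)) * ennreal ((real n + 1) ^ 2 ^ m)"
  proof -
    have "(\<lambda>x. exp (real n * ?H x)) \<in> borel_measurable (power_measure n \<pi>)"
    proof -
      have "(\<lambda>x. card {i\<in>{..<n}. label E m (x i) = j}) = (\<lambda>x. \<Sum>i<n. if label E m (x i) = j then 1 else 0)" for j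
        by (auto simp: fun_eq_iff sum.If_cases Int_def)
      moreover have [measurable]: "label E m \<in> measurable \<pi> (count_space UNIV)"
        by (rule measurable_label) (simp add: E sets)
      ultimately show ?thesis
        unfolding cell_entropy_def cells_empirical[where E = E, OF n E] by measurable
    qed
    then show ?thesis
      by (subst nn_integral_cmult) (auto intro!: mult_left_mono nn_integral_exp_cell_entropy_le[where E = E, OF \<pi> E n])
  qed
  also have "\<dots> = ennreal (exp (- ?nb * J) * (real n + 1) ^ 2 ^ m)"
    by (simp flip: ennreal_mult)
  finally have "elog (\<integral>\<^sup>+x. ennreal (exp (- (?nb * f (empirical n x)))) \<partial>gibbs_measure \<pi> Wn b n)
      \<le> elog (ennreal (exp (- ?nb * J) * (real n + 1) ^ 2 ^ m))"
    by (rule elog_mono)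
  also have "\<dots> = ereal (2 ^ m * ln (real n + 1) - ?nb * J)"
  proof -
    have "0 < exp (- ?nb * J) * (real n + 1) ^ 2 ^ m"
      by (intro mult_pos_pos zero_less_power) auto
    then show ?thesis by (simp add: elog_ennreal ln_mult ln_realpow)
  qed
  finally have "ereal (1 / ?nb) * elog (\<integral>\<^sup>+x. ennreal (exp (- (?nb * f (empirical n x)))) \<partial>gibbs_measure \<pi> Wn b n)
      \<le> ereal (1 / ?nb) * ereal (2 ^ m * ln (real n + 1) - ?nb * J)"
    using nb by (intro ereal_mult_left_mono) auto
  also have "\<dots> = ereal (2 ^ m * ln (real n + 1) / ?nb - J)"
    using n b by (simp add: diff_divide_distrib)
  finally show ?thesis .
qed

text \<open>The variational inequality with exponent - n b (W + f), W the real part of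
  \<open>Wn n\<close>: finite mean energy makes the energy finite almost everywhere and integrable
  under the trial measure. Dividing by n b turns the entropy cost n d into d / b.\<close>

lemma partition_function_lower:
  fixes \<pi> :: "'a::{metric_space, second_countable_topology} measure"
  assumes \<pi>: "\<pi> \<in> prob_measures" and n: "n \<ge> 1" and b: "0 < b n"
    and Wn: "Wn n \<in> borel_measurable (power_measure n borel)"
    and C: "\<And>x. x \<in> configs n \<Longrightarrow> ereal C \<le> Wn n x"
    and f: "continuous_map weak_topology euclidean f" and f_bdd: "bounded (f ` prob_measures)"
    and \<mu>: "\<mu> \<in> prob_measures" and d: "relative_entropy \<mu> \<pi> = ereal d"
    and r: "eintegral (power_measure n \<mu>) (Wn n) \<le> ereal r"
  shows "ereal (- (\<integral>x. f (empirical n x) \<partial>power_measure n \<mu>) - r - d * (1 / b n))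
    \<le> ereal (1 / (real n * b n)) *
      elog (\<integral>\<^sup>+x. ennreal (exp (- (real n * b n * f (empirical n x)))) \<partial>gibbs_measure \<pi> Wn b n)"
proof -
  let ?nb = "real n * b n"
  have nb: "?nb > 0" using n b by simp
  have ps: "prob_space \<pi>" "prob_space \<mu>" and sets: "sets \<pi> = sets borel" "sets \<mu> = sets borel"
    using \<pi> \<mu> by (simp_all add: prob_measures_iff)
  interpret M: prob_space \<mu> by fact
  interpret Q: prob_space "power_measure n \<mu>" by (intro prob_space_PiM M.prob_space_axioms)
  have "relative_entropy \<mu> \<pi> < \<infinity>" using d by simp
  then obtain h :: "'a \<Rightarrow> real" where h: "h \<in> borel_measurable \<pi>" "\<And>x. 0 \<le> h x"
    "\<mu> = density \<pi> (\<lambda>x. ennreal (h x))" "integrable \<pi> (\<lambda>x. h x * ln (h x))"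
    "relative_entropy \<mu> \<pi> = ereal (\<integral>x. h x * ln (h x) \<partial>\<pi>)"
    using relative_entropy_finiteE[OF ps] sets by metis
  have dh: "(\<integral>x. h x * ln (h x) \<partial>\<pi>) = d" using h(5) d by simp
  have setsQ: "sets (power_measure n \<mu>) = sets (power_measure n borel)"
    by (rule sets_PiM_cong) (simp_all add: sets)
  have WnQ: "Wn n \<in> borel_measurable (power_measure n \<mu>)"
    using Wn by (simp only: measurable_cong_sets[OF setsQ refl])
  have CQ: "ereal C \<le> Wn n x" if "x \<in> space (power_measure n \<mu>)" for x
    using that C by (simp add: sets_eq_imp_space_eq[OF setsQ])
  have fin: "eintegral (power_measure n \<mu>) (Wn n) < \<infinity>"
    using r by (rule order_le_less_trans) simp
  have W: "AE x in power_measure n \<mu>. Wn n x \<noteq> \<infinity>"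
    "integrable (power_measure n \<mu>) (\<lambda>x. real_of_ereal (Wn n x))"
    "eintegral (power_measure n \<mu>) (Wn n) = ereal (\<integral>x. real_of_ereal (Wn n x) \<partial>power_measure n \<mu>)"
    by (rule eintegral_bounded_below[where C = C, OF Q.finite_measure_axioms WnQ _ fin], erule CQ)+
  define w where "w = (\<integral>x. real_of_ereal (Wn n x) \<partial>power_measure n \<mu>)"
  have wr: "w \<le> r" using r W(3) by (simp add: w_def)
  obtain B where B: "\<And>\<nu>. \<nu> \<in> prob_measures \<Longrightarrow> \<bar>f \<nu>\<bar> \<le> B"
    using f_bdd by (auto simp: bounded_iff)
  have f_int: "integrable (power_measure n \<mu>) (\<lambda>x. f (empirical n x))"
    using B[OF empirical_in_prob_measures[OF n]] borel_measurable_empirical[OF n f sets(2)]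
    by (intro Q.integrable_const_bound[where B = B]) auto
  let ?T = "\<lambda>x. - (?nb * real_of_ereal (Wn n x)) - ?nb * f (empirical n x)"
  have T_int: "integrable (power_measure n \<mu>) ?T"
    using W(2) f_int by (intro Bochner_Integration.integrable_diff Bochner_Integration.integrable_minus integrable_mult_right)
  have "ennreal (exp ((\<integral>x. ?T x \<partial>power_measure n \<mu>) - real n * (\<integral>x. h x * ln (h x) \<partial>\<pi>)))
    \<le> (\<integral>\<^sup>+x. eexp (- (ereal ?nb * Wn n x)) * ennreal (exp (- (?nb * f (empirical n x)))) \<partial>power_measure n \<pi>)"
  proof (rule gibbs_variational_lower[OF ps(1) h(1,2,3) ps(2) h(4) partition_function_eq(1)[where Wn = Wn and b = b, OF \<pi> n Wn f] T_int])
    show "AE x in power_measure n \<mu>. ennreal (exp (?T x))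
        \<le> eexp (- (ereal ?nb * Wn n x)) * ennreal (exp (- (?nb * f (empirical n x))))"
      using W(1) AE_space
    proof eventually_elim
      case (elim x)
      then obtain v where v: "Wn n x = ereal v" using CQ[of x] by (cases "Wn n x") auto
      show ?case by (simp add: v eexp_ereal flip: ennreal_mult exp_add)
    qed
  qed
  also have "\<dots> = (\<integral>\<^sup>+x. ennreal (exp (- (?nb * f (empirical n x)))) \<partial>gibbs_measure \<pi> Wn b n)"
    by (rule partition_function_eq(2)[where Wn = Wn and b = b, OF \<pi> n Wn f, symmetric])
  also have "(\<integral>x. ?T x \<partial>power_measure n \<mu>) - real n * (\<integral>x. h x * ln (h x) \<partial>\<pi>)
      = - (?nb * w) - ?nb * (\<integral>x. f (empirical n x) \<partial>power_measure n \<mu>) - real n * d"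
    using W(2) f_int by (simp add: w_def dh)
  finally have "elog (ennreal (exp (- (?nb * w) - ?nb * (\<integral>x. f (empirical n x) \<partial>power_measure n \<mu>) - real n * d)))
      \<le> elog (\<integral>\<^sup>+x. ennreal (exp (- (?nb * f (empirical n x)))) \<partial>gibbs_measure \<pi> Wn b n)"
    by (rule elog_mono)
  then have le: "ereal (- (?nb * w) - ?nb * (\<integral>x. f (empirical n x) \<partial>power_measure n \<mu>) - real n * d)
      \<le> elog (\<integral>\<^sup>+x. ennreal (exp (- (?nb * f (empirical n x)))) \<partial>gibbs_measure \<pi> Wn b n)"
    by (simp add: elog_ennreal)
  have "ereal (- (\<integral>x. f (empirical n x) \<partial>power_measure n \<mu>) - r - d * (1 / b n))
      \<le> ereal (- (\<integral>x. f (empirical n x) \<partial>power_measure n \<mu>) - w - d * (1 / b n))"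
    using wr by simp
  also have "\<dots> = ereal (1 / ?nb) * ereal (- (?nb * w) - ?nb * (\<integral>x. f (empirical n x) \<partial>power_measure n \<mu>) - real n * d)"
    using n b by (simp add: field_simps)
  also have "\<dots> \<le> ereal (1 / ?nb) * elog (\<integral>\<^sup>+x. ennreal (exp (- (?nb * f (empirical n x)))) \<partial>gibbs_measure \<pi> Wn b n)"
    using le nb by (intro ereal_mult_left_mono) auto
  finally show ?thesis .
qed

section \<open>The limit of the free energies\<close>

lemma ereal_add_le_iff: "ereal a + w \<le> ereal c \<longleftrightarrow> w \<le> ereal (c - a)"
  by (cases w) auto

text \<open>The assumption speaks of full sequences, so the missing indices are filled with
  \<open>\<mu>\<close> itself. This keeps convergence, and passing to a subsequence can only raise
  the lower limit.\<close>

lemma lower_limit_subsequence: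
  fixes \<mu> :: "'a::t2_space measure"
  assumes low: "lower_limit Wn W" and sym: "\<And>n. n \<ge> 1 \<Longrightarrow> symmetric_fun n (Wn n)"
    and r: "strict_mono r" "\<And>k. r k \<ge> 1" and x: "\<And>k. x k \<in> configs (r k)"
    and lim: "limitin weak_topology (\<lambda>k. empirical (r k) (x k)) \<mu> sequentially"
  shows "W \<mu> \<le> liminf (\<lambda>k. Wn (r k) (x k))"
proof -
  have \<mu>: "\<mu> \<in> prob_measures" using lim by (simp add: limitin_def)
  define \<nu> where "\<nu> n = (if n \<in> range r then empirical n (x (inv r n)) else \<mu>)" for n
  have inj: "inj r" by (rule strict_mono_imp_inj_on[OF r(1)])
  have \<nu>r: "\<nu> (r k) = empirical (r k) (x k)" for k by (simp add: \<nu>_def inv_f_f[OF inj])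
  have \<nu>: "\<nu> n \<in> prob_measures" for n
  proof (cases "n \<in> range r")
    case True
    then obtain k where "n = r k" by blast
    then show ?thesis using empirical_in_prob_measures[OF r(2)] by (simp add: \<nu>r)
  next
    case False
    then show ?thesis using \<mu> by (simp add: \<nu>_def)
  qed
  have "limitin weak_topology \<nu> \<mu> sequentially"
    unfolding limitin_def topspace_weak_topology
  proof (intro conjI allI impI \<mu>)
    fix U assume U: "openin weak_topology U \<and> \<mu> \<in> U"
    then have "\<forall>\<^sub>F k in sequentially. empirical (r k) (x k) \<in> U"
      using lim by (simp add: limitin_def)
    then obtain K where K: "\<And>k. K \<le> k \<Longrightarrow> empirical (r k) (x k) \<in> U"
      by (auto simp: eventually_sequentially)
    have "\<nu> n \<in> U" if n: "r K \<le> n" for n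
    proof (cases "n \<in> range r")
      case True
      then obtain k where k: "n = r k" by blast
      then have "K \<le> k" using n strict_mono_less_eq[OF r(1)] by simp
      then show ?thesis using K by (simp add: k \<nu>r)
    next
      case False
      then show ?thesis using U by (simp add: \<nu>_def)
    qed
    then show "\<forall>\<^sub>F n in sequentially. \<nu> n \<in> U"
      by (auto simp: eventually_sequentially)
  qed
  then have "W \<mu> \<le> liminf (\<lambda>n. W_tilde Wn n (\<nu> n))"
    using low \<nu> unfolding lower_limit_def by blast
  also have "\<dots> \<le> liminf ((\<lambda>n. W_tilde Wn n (\<nu> n)) \<circ> r)"
    by (rule liminf_subseq_mono[OF r(1)])
  also have "(\<lambda>n. W_tilde Wn n (\<nu> n)) \<circ> r = (\<lambda>k. Wn (r k) (x k))"
    using W_tilde_empirical[where Wn = Wn, OF r(2) sym[OF r(2)] x] by (simp add: fun_eq_iff \<nu>r)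
  finally show ?thesis .
qed

text \<open>All convergent real terms are moved to the right-hand side, so that the lower limit is
  taken of the energies alone and no sum of lower limits occurs.\<close>

lemma lower_limit_energy_le:
  fixes \<mu> :: "'a::t2_space measure"
  assumes low: "lower_limit Wn W" and sym: "\<And>n. n \<ge> 1 \<Longrightarrow> symmetric_fun n (Wn n)"
    and r: "strict_mono r" "\<And>k. r k \<ge> 1" and x: "\<And>k. x k \<in> configs (r k)"
    and lim: "limitin weak_topology (\<lambda>k. empirical (r k) (x k)) \<mu> sequentially"
    and f: "continuous_map weak_topology euclidean f"
    and e: "e \<longlonglongrightarrow> e'" and c: "c \<longlonglongrightarrow> c'"
    and le: "\<forall>\<^sub>F k in sequentially. ereal (f (empirical (r k) (x k)) + e k) + Wn (r k) (x k) \<le> ereal (c k)"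
  shows "ereal (f \<mu> + e') + W \<mu> \<le> ereal c'"
proof -
  have "(\<lambda>k. f (empirical (r k) (x k))) \<longlonglongrightarrow> f \<mu>"
    using continuous_map_limit[OF f lim] by (simp add: o_def)
  then have "(\<lambda>k. ereal (c k - (f (empirical (r k) (x k)) + e k))) \<longlonglongrightarrow> ereal (c' - (f \<mu> + e'))"
    by (intro tendsto_intros e c)
  then have "liminf (\<lambda>k. ereal (c k - (f (empirical (r k) (x k)) + e k))) = ereal (c' - (f \<mu> + e'))"
    by (intro lim_imp_Liminf) simp_all
  moreover have "W \<mu> \<le> liminf (\<lambda>k. Wn (r k) (x k))"
    by (rule lower_limit_subsequence[OF low sym r x lim])
  moreover have "\<dots> \<le> liminf (\<lambda>k. ereal (c k - (f (empirical (r k) (x k)) + e k)))"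
    using le by (intro Liminf_mono) (simp add: ereal_add_le_iff)
  ultimately show ?thesis by (simp add: ereal_add_le_iff)
qed

text \<open>Cells of zero reference mass contribute nothing by domination; elsewhere the continuity
  of t ln t at the density q / p applies.\<close>

lemma tendsto_cell_entropy:
  assumes q: "\<And>j. (\<lambda>k. q k m j) \<longlonglongrightarrow> q' m j" and nn: "\<And>k j. 0 \<le> q k m j" "\<And>j. 0 \<le> p m j"
    and dom: "\<And>k j. p m j = 0 \<Longrightarrow> q k m j = 0"
  shows "(\<lambda>k. cell_entropy p (q k) m) \<longlonglongrightarrow> cell_entropy p q' m"
  unfolding cell_entropy_def
proof (rule tendsto_sum)
  fix j
  show "(\<lambda>k. q k m j * ln (q k m j / p m j)) \<longlonglongrightarrow> q' m j * ln (q' m j / p m j)"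
  proof (cases "p m j = 0")
    case True
    then have "q' m j = 0"
      using q[of j] LIMSEQ_unique[of "\<lambda>k. q k m j" "q' m j" 0] by (simp add: dom)
    then show ?thesis by (simp add: dom[OF True])
  next
    case False
    have "(\<lambda>k. p m j * (q k m j / p m j * ln (q k m j / p m j))) \<longlonglongrightarrow>
        p m j * (q' m j / p m j * ln (q' m j / p m j))"
      by (intro tendsto_mult_left tendsto_mult_ln tendsto_divide q tendsto_const) (use False nn in auto)
    then show ?thesis using False by simp
  qed
qed

text \<open>For \<open>n\<close> at least 1, the largest \<open>m\<close> with 4 ^ m at most
  \<open>n\<close>: it tends to infinity while 2 ^ m stays below sqrt n.\<close>

definition refinement_level :: "nat \<Rightarrow> nat" where
  "refinement_level n = floor_log n div 2"

lemma refinement_level_ge: "2 ^ (2 * M) \<le> n \<Longrightarrow> M \<le> refinement_level n"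
proof -
  assume "2 ^ (2 * M) \<le> n"
  then have "floor_log (2 ^ (2 * M)) \<le> floor_log n" by (rule floor_log_le_iff)
  then show ?thesis by (simp add: refinement_level_def)
qed

lemma power_refinement_level_le:
  assumes "n \<ge> 1"
  shows "(2::real) ^ refinement_level n \<le> sqrt (real n)"
proof -
  have "((2::nat) ^ refinement_level n)\<^sup>2 = 2 ^ (floor_log n div 2 * 2)"
    by (simp add: refinement_level_def power_mult)
  also have "\<dots> \<le> 2 ^ floor_log n" by (rule power_increasing) auto
  also have "\<dots> \<le> n" using assms by (intro floor_log_exp2_le) simp
  finally have "real ((2 ^ refinement_level n)\<^sup>2) \<le> real n" by (simp only: of_nat_le_iff)
  then show ?thesis by (intro real_le_rsqrt) simp
qed

text \<open>The limiting temperature \<open>\<tau>\<close> replaces \<open>\<beta>\<close>, so that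
  both regimes are treated together, with \<open>\<tau>\<close> = 0 for infinite
  \<open>\<beta>\<close>.\<close>

locale gibbs_model =
  fixes \<pi> :: "'a::polish_space measure"
    and Wn :: "nat \<Rightarrow> (nat \<Rightarrow> 'a) \<Rightarrow> ereal" and C :: real
    and \<beta>n :: "nat \<Rightarrow> real" and \<tau> :: real
    and f :: "'a measure \<Rightarrow> real"
  assumes pi: "\<pi> \<in> prob_measures"
    and Wn_measurable: "\<And>n. n \<ge> 1 \<Longrightarrow> Wn n \<in> borel_measurable (power_measure n borel)"
    and Wn_symmetric: "\<And>n. n \<ge> 1 \<Longrightarrow> symmetric_fun n (Wn n)"
    and Wn_ge: "\<And>n x. n \<ge> 1 \<Longrightarrow> x \<in> configs n \<Longrightarrow> ereal C \<le> Wn n x"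
    and beta_n_pos: "\<And>n. n \<ge> 1 \<Longrightarrow> \<beta>n n > 0"
    and temperature_lim: "(\<lambda>n. 1 / \<beta>n n) \<longlonglongrightarrow> \<tau>"
    and f_continuous: "continuous_map weak_topology euclidean f"
    and f_bounded: "bounded (f ` prob_measures)"
begin

definition log_partition :: "nat \<Rightarrow> ereal" where
  "log_partition n = ereal (1 / (real n * \<beta>n n)) *
     elog (\<integral>\<^sup>+x. ennreal (exp (- (real n * \<beta>n n * f (empirical n x)))) \<partial>gibbs_measure \<pi> Wn \<beta>n n)"

lemma Wn_not_MInf: "n \<ge> 1 \<Longrightarrow> x \<in> configs n \<Longrightarrow> Wn n x \<noteq> -\<infinity>"
  using Wn_ge[of n x] by auto

text \<open>A real \<open>r\<close> strictly above the limiting mean energy bounds the mean energies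
  for all large \<open>n\<close>, whereupon the trial bound passes to the limit by the weak
  law.\<close>

lemma liminf_log_partition_ge:
  assumes \<mu>: "\<mu> \<in> prob_measures" and d: "relative_entropy \<mu> \<pi> = ereal d"
    and r: "limsup (\<lambda>n. eintegral (power_measure n \<mu>) (Wn n)) < ereal r"
  shows "ereal (- f \<mu> - r - d * \<tau>) \<le> liminf log_partition"
proof -
  have lim: "(\<lambda>n. ereal (- (\<integral>x. f (empirical n x) \<partial>power_measure n \<mu>) - r - d * (1 / \<beta>n n)))
      \<longlonglongrightarrow> ereal (- f \<mu> - r - d * \<tau>)"
    by (intro tendsto_intros tendsto_expectation_empirical[OF \<mu> f_continuous f_bounded] temperature_lim)
  have "\<forall>\<^sub>F n in sequentially. eintegral (power_measure n \<mu>) (Wn n) < ereal r"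
    by (rule Limsup_lessD[OF r])
  then have "\<forall>\<^sub>F n in sequentially.
      ereal (- (\<integral>x. f (empirical n x) \<partial>power_measure n \<mu>) - r - d * (1 / \<beta>n n)) \<le> log_partition n"
    using eventually_ge_at_top[of 1]
  proof eventually_elim
    case (elim n)
    then show ?case
      unfolding log_partition_def
      using partition_function_lower[where C = C and Wn = Wn and b = \<beta>n, OF pi elim(2) beta_n_pos[OF elim(2)]
          Wn_measurable[OF elim(2)] Wn_ge[OF elim(2)] f_continuous f_bounded \<mu> d, of r]
      by simp
  qed
  then have "liminf (\<lambda>n. ereal (- (\<integral>x. f (empirical n x) \<partial>power_measure n \<mu>) - r - d * (1 / \<beta>n n)))
      \<le> liminf log_partition"
    by (rule Liminf_mono)
  then show ?thesis using lim_imp_Liminf[OF _ lim] by simp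
qed

text \<open>The cost of counting types at the level used for \<open>n\<close> particles, on the
  scale of \<open>log_partition\<close>.\<close>

definition error :: "nat \<Rightarrow> real" where
  "error n = 2 ^ refinement_level n * ln (real n + 1) / (real n * \<beta>n n)"

lemma error_tendsto: "error \<longlonglongrightarrow> 0"
proof (rule tendsto_sandwich[where f = "\<lambda>_. 0" and h = "\<lambda>n. ln (real n + 1) / sqrt (real n) * (1 / \<beta>n n)"])
  have "(\<lambda>n::nat. ln (real n + 1) / sqrt (real n)) \<longlonglongrightarrow> 0" by real_asymp
  from tendsto_mult[OF this temperature_lim]
  show "(\<lambda>n. ln (real n + 1) / sqrt (real n) * (1 / \<beta>n n)) \<longlonglongrightarrow> 0" by simp
  show "\<forall>\<^sub>F n in sequentially. 0 \<le> error n"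
    using eventually_ge_at_top[of 1]
  proof eventually_elim
    case (elim n)
    then show ?case using beta_n_pos[OF elim] by (simp add: error_def)
  qed
  show "\<forall>\<^sub>F n in sequentially. error n \<le> ln (real n + 1) / sqrt (real n) * (1 / \<beta>n n)"
    using eventually_ge_at_top[of 1]
  proof eventually_elim
    case (elim n)
    have "error n = 2 ^ refinement_level n * (ln (real n + 1) / (real n * \<beta>n n))"
      by (simp add: error_def)
    also have "\<dots> \<le> sqrt (real n) * (ln (real n + 1) / (real n * \<beta>n n))"
      using elim beta_n_pos[OF elim] by (intro mult_right_mono power_refinement_level_le) auto
    also have "\<dots> = sqrt (real n) / real n * (ln (real n + 1) * (1 / \<beta>n n))" by simp
    also have "sqrt (real n) / real n = 1 / sqrt (real n)"
      using elim by (simp add: field_simps)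
    also have "1 / sqrt (real n) * (ln (real n + 1) * (1 / \<beta>n n)) =
        ln (real n + 1) / sqrt (real n) * (1 / \<beta>n n)" by simp
    finally show ?case .
  qed
qed simp

text \<open>Contrapositive of the upper estimate: a large partition function forces an admissible
  configuration of low discretised free energy. Admissible means that no point lies in a null cell,
  at any level.\<close>

lemma low_energy_configs:
  assumes a: "\<exists>\<^sub>F n in sequentially. ereal a < log_partition n"
    and E: "\<And>i. E i \<in> sets borel"
  obtains r x where "strict_mono (r :: nat \<Rightarrow> nat)" "\<And>k. r k \<ge> 1" "\<And>k. x k \<in> configs (r k)"
    "\<And>k m i. i < r k \<Longrightarrow> cells E \<pi> m (label E m (x k i)) \<noteq> 0"
    "\<And>k. ereal (f (empirical (r k) (x k)) +
        cell_entropy (cells E \<pi>) (cells E (empirical (r k) (x k))) (refinement_level (r k)) / \<beta>n (r k))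
      + Wn (r k) (x k) \<le> ereal (error (r k) - a)"
proof -
  let ?good = "\<lambda>n x. x \<in> configs n \<and> (\<forall>i<n. \<forall>m. cells E \<pi> m (label E m (x i)) \<noteq> 0) \<and>
    ereal (f (empirical n x) +
        cell_entropy (cells E \<pi>) (cells E (empirical n x)) (refinement_level n) / \<beta>n n) + Wn n x
      \<le> ereal (error n - a)"
  define S where "S = {n. n \<ge> 1 \<and> ereal a < log_partition n}"
  have "\<exists>\<^sub>F n in sequentially. n \<ge> 1 \<and> ereal a < log_partition n"
    using frequently_eventually_frequently[OF a eventually_ge_at_top[of 1]]
    by (rule frequently_elim1) simp
  then have inf: "infinite S"
    unfolding S_def by (simp add: frequently_cofinite[symmetric] cofinite_eq_sequentially)
  have ex: "\<exists>x. ?good n x" if "n \<in> S" for n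
  proof (rule ccontr)
    assume no: "\<not> ?thesis"
    from that have n: "n \<ge> 1" and an: "ereal a < log_partition n" by (simp_all add: S_def)
    \<comment> \<open>With J = \<open>error n - a\<close> the counting cost cancels and the bound is
      exactly \<open>a\<close>, contradicting the choice of \<open>n\<close>.\<close>
    have "log_partition n \<le> ereal (2 ^ refinement_level n * ln (real n + 1) / (real n * \<beta>n n) - (error n - a))"
      unfolding log_partition_def
    proof (rule partition_function_upper[where Wn = Wn and b = \<beta>n, OF pi n beta_n_pos[OF n] Wn_measurable[OF n]
          Wn_not_MInf[OF n] f_continuous E])
      fix x assume "x \<in> configs n" "\<forall>i<n. \<forall>m. cells E \<pi> m (label E m (x i)) \<noteq> 0"
      with no show "ereal (error n - a) \<le> ereal (f (empirical n x) +
          cell_entropy (cells E \<pi>) (cells E (empirical n x)) (refinement_level n) / \<beta>n n) + Wn n x"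
        using linear by blast
    qed
    then have "log_partition n \<le> ereal a" by (simp add: error_def)
    with an show False by simp
  qed
  have mem: "enumerate S k \<in> S" for k by (rule enumerate_in_set[OF inf])
  then have "\<exists>x. ?good (enumerate S k) x" for k using ex by blast
  then obtain x where x: "\<And>k. ?good (enumerate S k) (x k)" by metis
  show thesis
  proof (rule that[of "enumerate S" x])
    show "strict_mono (enumerate S)" by (rule strict_mono_enumerate[OF inf])
    show "enumerate S k \<ge> 1" for k using mem[of k] by (simp add: S_def)
  qed (use x in auto)
qed

lemma f_ge:
  obtains B where "\<And>\<nu>. \<nu> \<in> prob_measures \<Longrightarrow> - B \<le> f \<nu>"
proof -
  obtain B where "\<And>\<nu>. \<nu> \<in> prob_measures \<Longrightarrow> \<bar>f \<nu>\<bar> \<le> B"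
    using f_bounded by (auto simp: bounded_iff)
  then have "- B \<le> f \<nu>" if "\<nu> \<in> prob_measures" for \<nu> using that by fastforce
  then show thesis by (rule that)
qed

text \<open>The level at which the configurations satisfy their bound grows, so every fixed level is
  eventually covered and one diagonal subsequence serves all of them. The lower limit is taken level
  by level at the same \<open>\<mu>\<close>, and the supremum over levels comes last.\<close>

lemma positive_temperature_upper:
  assumes \<tau>: "\<tau> > 0" and low: "lower_limit Wn W"
    and a: "\<exists>\<^sub>F n in sequentially. ereal a < log_partition n"
  obtains \<mu> d where "\<mu> \<in> prob_measures" "relative_entropy \<mu> \<pi> = ereal d"
    "ereal (f \<mu> + d * \<tau>) + W \<mu> \<le> ereal (- a)"
proof -
  interpret prob_space \<pi> using pi by (simp add: prob_measures_iff)
  have sets: "sets \<pi> = sets borel" using pi by (simp add: prob_measures_iff)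
  obtain E :: "nat \<Rightarrow> 'a set" where E_open: "\<And>i. open (E i)"
    and E_base: "\<And>U. open U \<Longrightarrow> \<exists>s. incseq (\<lambda>n. E (s n)) \<and> U = (\<Union>n. E (s n))"
    using open_set_sequence by blast
  have E: "E i \<in> sets borel" for i using E_open by simp
  define p where "p = cells E \<pi>"
  have p: "dyadic p" unfolding p_def by (rule dyadic_cells[OF pi E])
  obtain r0 x0 where r0: "strict_mono (r0 :: nat \<Rightarrow> nat)" "\<And>k. r0 k \<ge> 1"
    and x0: "\<And>k. x0 k \<in> configs (r0 k)"
    and good0: "\<And>k m i. i < r0 k \<Longrightarrow> cells E \<pi> m (label E m (x0 k i)) \<noteq> 0"
    and le0: "\<And>k. ereal (f (empirical (r0 k) (x0 k)) +
        cell_entropy (cells E \<pi>) (cells E (empirical (r0 k) (x0 k))) (refinement_level (r0 k)) / \<beta>n (r0 k))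
      + Wn (r0 k) (x0 k) \<le> ereal (error (r0 k) - a)"
    by (rule low_energy_configs[where E = E, OF a E]) (rule that)
  have "\<bar>(\<lambda>(m, j). cells E (empirical (r0 k) (x0 k)) m j) i\<bar> \<le> 1" for k i
  proof -
    interpret N: prob_space "empirical (r0 k) (x0 k)"
      using empirical_in_prob_measures[OF r0(2)] by (simp add: prob_measures_iff)
    show ?thesis by (cases i) (simp add: cells_def)
  qed
  then obtain t l where t: "strict_mono t"
    and l: "\<And>i. (\<lambda>k. (\<lambda>(m, j). cells E (empirical (r0 (t k)) (x0 (t k))) m j) i) \<longlonglongrightarrow> l i"
    using bounded_sequences_convergent_subsequence[of "\<lambda>k (m, j). cells E (empirical (r0 k) (x0 k)) m j"]
    by blast
  define r x q where "r k = r0 (t k)" and "x k = x0 (t k)" and "q m j = l (m, j)" for k m j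
  define \<nu> where "\<nu> k = empirical (r k) (x k)" for k
  have r: "strict_mono r" "\<And>k. r k \<ge> 1"
    using strict_mono_o[OF r0(1) t] r0(2) by (simp_all add: r_def o_def strict_mono_def)
  have x: "x k \<in> configs (r k)" for k using x0 by (simp add: r_def x_def)
  have q_lim: "(\<lambda>k. cells E (\<nu> k) m j) \<longlonglongrightarrow> q m j" for m j
    using l[of "(m, j)"] by (simp add: q_def \<nu>_def r_def x_def)
  have \<nu>: "\<nu> k \<in> prob_measures" for k unfolding \<nu>_def by (rule empirical_in_prob_measures[OF r(2)])
  have \<nu>_dyadic: "dyadic (cells E (\<nu> k))" for k by (rule dyadic_cells[OF \<nu> E])
  \<comment> \<open>Only admissible configurations were selected, so no point lies in a cell that is
    null for \<open>\<pi>\<close>.\<close>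
  have \<nu>_dom: "cells E (\<nu> k) m j = 0" if "p m j = 0" for k m j
  proof -
    have "{i \<in> {..<r k}. label E m (x k i) = j} = {}"
      using good0[of _ "t k" m] that by (auto simp: p_def r_def x_def)
    then show ?thesis
      unfolding \<nu>_def cells_empirical[where E = E, OF r(2) E] by (simp only: card.empty)
  qed
  have q: "dyadic q"
  proof (rule dyadicI)
    show "q 0 0 = 1"
      using LIMSEQ_unique[OF q_lim[of 0 0]] by (simp add: dyadic_root[OF \<nu>_dyadic])
    show "0 \<le> q m j" for m j
      using q_lim by (rule LIMSEQ_le_const) (simp add: dyadic_nonneg[OF \<nu>_dyadic])
    fix m j :: nat assume j: "j < 2 ^ m"
    have "(\<lambda>k. cells E (\<nu> k) (Suc m) j + cells E (\<nu> k) (Suc m) (j + 2 ^ m))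
        \<longlonglongrightarrow> q (Suc m) j + q (Suc m) (j + 2 ^ m)"
      by (intro tendsto_add q_lim)
    then have "(\<lambda>k. cells E (\<nu> k) m j) \<longlonglongrightarrow> q (Suc m) j + q (Suc m) (j + 2 ^ m)"
      by (simp only: dyadic_split[OF \<nu>_dyadic j])
    then show "q m j = q (Suc m) j + q (Suc m) (j + 2 ^ m)"
      using q_lim LIMSEQ_unique by blast
  qed
  have q_dom: "q m j = 0" if "p m j = 0" for m j
    using LIMSEQ_unique[OF q_lim[of m j]] by (simp add: \<nu>_dom[OF that])
  have H_lim: "(\<lambda>k. cell_entropy p (cells E (\<nu> k)) m) \<longlonglongrightarrow> cell_entropy p q m" for m
    by (rule tendsto_cell_entropy)
      (auto intro: q_lim dyadic_nonneg[OF \<nu>_dyadic] dyadic_nonneg[OF p] \<nu>_dom)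
  have r_top: "filterlim r at_top sequentially" by (rule filterlim_subseq[OF r(1)])
  have e_lim: "(\<lambda>k. cell_entropy p (cells E (\<nu> k)) m / \<beta>n (r k)) \<longlonglongrightarrow> cell_entropy p q m * \<tau>" for m
    using tendsto_mult[OF H_lim filterlim_compose[OF temperature_lim r_top]] by simp
  have c_lim: "(\<lambda>k. error (r k) - a) \<longlonglongrightarrow> - a"
    using tendsto_diff[OF filterlim_compose[OF error_tendsto r_top] tendsto_const[of a]] by simp
  \<comment> \<open>For large \<open>k\<close> the level \<open>refinement_level (r k)\<close>
    exceeds \<open>m\<close>, and coarsening to \<open>m\<close> decreases the entropy term.\<close>
  have le: "\<forall>\<^sub>F k in sequentially. ereal (f (\<nu> k) + cell_entropy p (cells E (\<nu> k)) m / \<beta>n (r k))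
      + Wn (r k) (x k) \<le> ereal (error (r k) - a)" for m
  proof -
    have "\<forall>\<^sub>F k in sequentially. 2 ^ (2 * m) \<le> r k"
      using r_top by (simp add: filterlim_at_top)
    then show ?thesis
    proof eventually_elim
      case (elim k)
      have "cell_entropy p (cells E (\<nu> k)) m \<le> cell_entropy p (cells E (\<nu> k)) (refinement_level (r k))"
        by (rule cell_entropy_mono[OF p \<nu>_dyadic \<nu>_dom refinement_level_ge[OF elim]])
      then have "cell_entropy p (cells E (\<nu> k)) m / \<beta>n (r k)
          \<le> cell_entropy p (cells E (\<nu> k)) (refinement_level (r k)) / \<beta>n (r k)"
        using beta_n_pos[OF r(2), of k] by (intro divide_right_mono) auto
      then have "ereal (f (\<nu> k) + cell_entropy p (cells E (\<nu> k)) m / \<beta>n (r k)) + Wn (r k) (x k) \<le>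
          ereal (f (\<nu> k) + cell_entropy p (cells E (\<nu> k)) (refinement_level (r k)) / \<beta>n (r k)) + Wn (r k) (x k)"
        by (intro add_right_mono) simp
      also have "\<dots> \<le> ereal (error (r k) - a)"
        using le0[of "t k"] by (simp add: \<nu>_def r_def x_def p_def)
      finally show ?case .
    qed
  qed
  obtain B where B: "\<And>\<nu>. \<nu> \<in> prob_measures \<Longrightarrow> - B \<le> f \<nu>" using f_ge by blast
  \<comment> \<open>The lower bounds -B of \<open>f\<close> and C of the energies leave a bounded
    amount for the entropy term; \<open>\<tau>\<close> > 0 allows dividing by the
    temperature.\<close>
  have H_bound: "cell_entropy p q m \<le> (- a + B - C) / \<tau>" for m
  proof -
    have "cell_entropy p q m * \<tau> \<le> - a + B - C"
    proof (rule tendsto_le[OF _ _ e_lim])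
      show "(\<lambda>k. error (r k) - a + B - C) \<longlonglongrightarrow> - a + B - C"
        by (intro tendsto_diff tendsto_add c_lim tendsto_const)
      show "\<forall>\<^sub>F k in sequentially. cell_entropy p (cells E (\<nu> k)) m / \<beta>n (r k) \<le> error (r k) - a + B - C"
        using le[of m]
      proof eventually_elim
        case (elim k)
        have "ereal C \<le> Wn (r k) (x k)" by (rule Wn_ge[OF r(2) x])
        also have "\<dots> \<le> ereal (error (r k) - a - (f (\<nu> k) + cell_entropy p (cells E (\<nu> k)) m / \<beta>n (r k)))"
          using elim by (simp only: ereal_add_le_iff)
        finally show ?case using B[OF \<nu>[of k]] by simp
      qed
    qed simp
    then show ?thesis using \<tau> by (simp add: field_simps)
  qed
  \<comment> \<open>The supremum, not the crude bound just found, must control the entropy of the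
    limit: it is what the level-by-level energy inequalities bound sharply.\<close>
  define L where "L = (SUP m. cell_entropy p q m)"
  have "bdd_above (range (cell_entropy p q))"
    by (rule bdd_aboveI[of _ "(- a + B - C) / \<tau>"]) (use H_bound in blast)
  then have H_L: "cell_entropy p q m \<le> L" for m unfolding L_def by (intro cSUP_upper) auto
  obtain h :: "'a \<Rightarrow> real" where h [measurable]: "h \<in> borel_measurable \<pi>" and h0: "\<And>x. 0 \<le> h x"
    and h_int: "integrable \<pi> h"
    and h_cell: "\<And>m j. j < 2 ^ m \<Longrightarrow> (\<integral>x. h x * indicator {x. label E m x = j} x \<partial>\<pi>) = q m j"
    and h_ent: "integrable \<pi> (\<lambda>x. h x * ln (h x))" "(\<integral>x. h x * ln (h x) \<partial>\<pi>) \<le> L"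
    using dyadic_density[where E = E, OF pi E q q_dom[unfolded p_def] H_L[unfolded p_def]] by blast
  define \<mu> where "\<mu> = density \<pi> (\<lambda>x. ennreal (h x))"
  have \<mu>_sets: "sets \<mu> = sets borel" by (simp add: \<mu>_def sets)
  have \<mu>_meas: "emeasure \<mu> A = ennreal (\<integral>x. h x * indicator A x \<partial>\<pi>)" if "A \<in> sets borel" for A
  proof -
    have A: "A \<in> sets \<pi>" using that by (simp add: sets)
    have "emeasure \<mu> A = (\<integral>\<^sup>+x. ennreal (h x * indicator A x) \<partial>\<pi>)"
      unfolding \<mu>_def using A by (subst emeasure_density) (auto intro!: nn_integral_cong simp: indicator_def)
    also have "\<dots> = ennreal (\<integral>x. h x * indicator A x \<partial>\<pi>)"
      by (rule nn_integral_eq_integral) (use h_int A h0 in \<open>auto intro: integrable_real_mult_indicator\<close>)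
    finally show ?thesis .
  qed
  have cell_sets: "{x. label E m x = j} \<in> sets borel" for m j by (rule sets_label[OF E])
  have \<mu>_cells: "cells E \<mu> m j = q m j" if "j < 2 ^ m" for m j
    using \<mu>_meas[OF cell_sets, of m j] dyadic_nonneg[OF q, of m j]
    by (simp add: cells_def measure_def h_cell[OF that])
  have "emeasure \<mu> (space \<mu>) = 1"
    using \<mu>_meas[OF cell_sets, of 0 0] h_cell[of 0 0] dyadic_root[OF q]
    by (simp add: sets_eq_imp_space_eq[OF \<mu>_sets])
  then have \<mu>: "\<mu> \<in> prob_measures" using \<mu>_sets by (simp add: prob_measures_iff prob_spaceI)
  have base_lim: "(\<lambda>k. measure (\<nu> k) (E i)) \<longlonglongrightarrow> measure \<mu> (E i)" for i
  proof -
    have "(\<lambda>k. \<Sum>j<2 ^ Suc i. cells E (\<nu> k) (Suc i) j * (if 2 ^ i \<le> j then 1 else 0))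
        \<longlonglongrightarrow> (\<Sum>j<2 ^ Suc i. q (Suc i) j * (if 2 ^ i \<le> j then 1 else 0))"
      by (intro tendsto_sum tendsto_mult_right q_lim)
    also have "(\<Sum>j<2 ^ Suc i. q (Suc i) j * (if 2 ^ i \<le> j then 1 else 0)) = measure \<mu> (E i)"
      unfolding measure_base_eq_cells[where E = E, OF \<mu> E] by (intro sum.cong refl) (simp add: \<mu>_cells)
    finally show ?thesis
      by (simp only: measure_base_eq_cells[where E = E, OF \<nu> E])
  qed
  have lim: "limitin weak_topology \<nu> \<mu> sequentially"
    by (rule limitin_weak_topology_baseI[OF \<mu> \<nu> E_open E_base order_tendstoD(1)[OF base_lim]])
  define d where "d = (\<integral>x. h x * ln (h x) \<partial>\<pi>)"
  have d: "relative_entropy \<mu> \<pi> = ereal d"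
    unfolding \<mu>_def d_def by (rule relative_entropy_density[OF prob_space_axioms h h0 h_ent(1)])
  \<comment> \<open>The limit in \<open>k\<close> is taken at fixed \<open>m\<close>, where the cell
    entropies converge.\<close>
  have closure: "W \<mu> \<le> ereal (- a - (f \<mu> + cell_entropy p q m * \<tau>))" for m
  proof -
    have "ereal (f \<mu> + cell_entropy p q m * \<tau>) + W \<mu> \<le> ereal (- a)"
    proof (rule lower_limit_energy_le[where r = r and x = x, OF low Wn_symmetric r x _ f_continuous e_lim c_lim])
      show "limitin weak_topology (\<lambda>k. empirical (r k) (x k)) \<mu> sequentially"
        using lim by (simp only: \<nu>_def[abs_def])
      show "\<forall>\<^sub>F k in sequentially. ereal (f (empirical (r k) (x k)) + cell_entropy p (cells E (\<nu> k)) m / \<beta>n (r k))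
          + Wn (r k) (x k) \<le> ereal (error (r k) - a)"
        using le[of m] by (simp only: \<nu>_def)
    qed
    then show ?thesis by (simp only: ereal_add_le_iff)
  qed
  have "W \<mu> \<le> ereal (- a - (f \<mu> + d * \<tau>))"
  proof (cases "W \<mu>")
    case (real w)
    have "cell_entropy p q m \<le> (- a - f \<mu> - w) / \<tau>" for m
      using closure[of m] \<tau> by (simp add: real pos_le_divide_eq)
    then have "L \<le> (- a - f \<mu> - w) / \<tau>" unfolding L_def by (intro cSUP_least) auto
    then have "d \<le> (- a - f \<mu> - w) / \<tau>" using h_ent(2) by (simp add: d_def)
    then have "d * \<tau> \<le> - a - f \<mu> - w" using \<tau> by (simp add: pos_le_divide_eq)
    then show ?thesis by (simp add: real)
  next
    case PInf
    then show ?thesis using closure[of 0] by simp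
  next
    case MInf
    then show ?thesis by simp
  qed
  then show thesis
    by (intro that[OF \<mu> d]) (simp only: ereal_add_le_iff)
qed

text \<open>Only nonnegativity of the entropy term is used, and it is discarded. What remains bounds
  the energies along the selected configurations, which is what confinement asks for.\<close>

lemma zero_temperature_upper:
  assumes low: "lower_limit Wn W" and conf: "confining Wn"
    and a: "\<exists>\<^sub>F n in sequentially. ereal a < log_partition n"
  obtains \<mu> where "\<mu> \<in> prob_measures" "ereal (f \<mu>) + W \<mu> \<le> ereal (- a)"
proof -
  \<comment> \<open>All sets empty: every point has code 0, so the partition is trivial at each
    level and \<open>low_energy_configs\<close> can be reused.\<close>
  define E :: "nat \<Rightarrow> 'a set" where "E = (\<lambda>_. {})"
  have E: "E i \<in> sets borel" for i by (simp add: E_def)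
  have p: "dyadic (cells E \<pi>)" by (rule dyadic_cells[OF pi E])
  obtain r x where r: "strict_mono (r :: nat \<Rightarrow> nat)" "\<And>k. r k \<ge> 1"
    and x: "\<And>k. x k \<in> configs (r k)"
    and good: "\<And>k m i. i < r k \<Longrightarrow> cells E \<pi> m (label E m (x k i)) \<noteq> 0"
    and le: "\<And>k. ereal (f (empirical (r k) (x k)) +
        cell_entropy (cells E \<pi>) (cells E (empirical (r k) (x k))) (refinement_level (r k)) / \<beta>n (r k))
      + Wn (r k) (x k) \<le> ereal (error (r k) - a)"
    by (rule low_energy_configs[where E = E, OF a E]) (rule that)
  define \<nu> where "\<nu> k = empirical (r k) (x k)" for k
  have \<nu>: "\<nu> k \<in> prob_measures" for k unfolding \<nu>_def by (rule empirical_in_prob_measures[OF r(2)])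
  have le': "ereal (f (\<nu> k)) + Wn (r k) (x k) \<le> ereal (error (r k) - a)" for k
  proof -
    have "cells E (\<nu> k) m j = 0" if "cells E \<pi> m j = 0" for m j
    proof -
      have "{i \<in> {..<r k}. label E m (x k i) = j} = {}"
        using good[of _ k m] that by auto
      then show ?thesis
        unfolding \<nu>_def cells_empirical[where E = E, OF r(2) E] by (simp only: card.empty)
    qed
    then have "0 \<le> cell_entropy (cells E \<pi>) (cells E (\<nu> k)) (refinement_level (r k))"
      by (intro cell_entropy_nonneg p dyadic_cells[OF \<nu> E])
    then have "0 \<le> cell_entropy (cells E \<pi>) (cells E (\<nu> k)) (refinement_level (r k)) / \<beta>n (r k)"
      using beta_n_pos[OF r(2), of k] by (intro divide_nonneg_pos)
    then have "ereal (f (\<nu> k)) + Wn (r k) (x k) \<le> ereal (f (\<nu> k) +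
        cell_entropy (cells E \<pi>) (cells E (\<nu> k)) (refinement_level (r k)) / \<beta>n (r k)) + Wn (r k) (x k)"
      by (intro add_right_mono) simp
    also have "\<dots> \<le> ereal (error (r k) - a)" using le[of k] by (simp add: \<nu>_def)
    finally show ?thesis .
  qed
  obtain B where B: "\<And>\<nu>. \<nu> \<in> prob_measures \<Longrightarrow> - B \<le> f \<nu>" using f_ge by blast
  obtain e where e: "\<And>n. error n \<le> e"
  proof -
    have "Bseq error" using error_tendsto by (intro convergent_imp_Bseq convergentI)
    then obtain e where "\<And>n. \<bar>error n\<bar> \<le> e" by (auto simp: Bseq_def)
    then show thesis using that abs_le_D1 by blast
  qed
  \<comment> \<open>The constant combines the bound \<open>e\<close> of the convergent error
    sequence, the level \<open>a\<close> and the lower bound -B of \<open>f\<close>.\<close>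
  have "W_tilde Wn (r k) (\<nu> k) \<le> ereal (e - a + B)" for k
  proof -
    have "W_tilde Wn (r k) (\<nu> k) = Wn (r k) (x k)"
      unfolding \<nu>_def by (rule W_tilde_empirical[where Wn = Wn, OF r(2) Wn_symmetric[OF r(2)] x])
    also have "\<dots> \<le> ereal (error (r k) - a - f (\<nu> k))"
      using le'[of k] by (simp only: ereal_add_le_iff)
    also have "\<dots> \<le> ereal (e - a + B)" using e[of "r k"] B[OF \<nu>[of k]] by simp
    finally show ?thesis .
  qed
  then have "relatively_compact_in weak_topology (range \<nu>)"
    using conf r \<nu> unfolding confining_def by blast
  then obtain t \<mu> where t: "strict_mono t" and \<mu>: "\<mu> \<in> prob_measures"
    and lim: "limitin weak_topology (\<nu> \<circ> t) \<mu> sequentially"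
    by (rule relatively_compact_in_weak_topology_subsequence)
  have rt: "strict_mono (\<lambda>k. r (t k))" using strict_mono_o[OF r(1) t] by (simp add: o_def)
  have "(\<lambda>k. error (r (t k)) - a) \<longlonglongrightarrow> 0 - a"
    by (intro tendsto_diff tendsto_const filterlim_compose[OF error_tendsto filterlim_subseq[OF rt]])
  then have c_lim: "(\<lambda>k. error (r (t k)) - a) \<longlonglongrightarrow> - a" by simp
  have "limitin weak_topology (\<lambda>k. empirical (r (t k)) (x (t k))) \<mu> sequentially"
    using lim by (simp add: o_def \<nu>_def)
  from lower_limit_energy_le[OF low Wn_symmetric rt r(2) x this f_continuous tendsto_const[of 0] c_lim]
  have "ereal (f \<mu> + 0) + W \<mu> \<le> ereal (- a)"
    using le' by (simp add: \<nu>_def)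
  then show thesis using that[OF \<mu>] by simp
qed

end

text \<open>Let the real bound in \<open>liminf_log_partition_ge\<close> decrease to
  \<open>w\<close>; for infinite \<open>w\<close> nothing is claimed.\<close>

lemma (in gibbs_model) regular_measure_upper:
  assumes \<mu>: "\<mu> \<in> prob_measures" and d: "relative_entropy \<mu> \<pi> = ereal d"
    and lim: "limsup (\<lambda>n. eintegral (power_measure n \<mu>) (Wn n)) \<le> w" and w: "w \<noteq> -\<infinity>"
  shows "- liminf log_partition \<le> ereal (f \<mu> + d * \<tau>) + w"
proof (cases w)
  case (real v)
  show ?thesis
  proof (rule ereal_le_epsilon2)
    fix e :: real assume "e > 0"
    then have "limsup (\<lambda>n. eintegral (power_measure n \<mu>) (Wn n)) < ereal (v + e)"
      using lim by (intro order_le_less_trans[OF lim]) (simp add: real)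
    from liminf_log_partition_ge[OF \<mu> d this]
    have "- liminf log_partition \<le> - ereal (- f \<mu> - (v + e) - d * \<tau>)"
      by (simp only: ereal_minus_le_minus)
    then show "- liminf log_partition \<le> ereal (f \<mu> + d * \<tau>) + w + ereal e"
      by (simp add: real algebra_simps)
  qed
qed (use w in auto)

theorem theorem1p2:
  fixes \<pi> :: "'a::polish_space measure"
    and Wn :: "nat \<Rightarrow> (nat \<Rightarrow> 'a) \<Rightarrow> ereal"
    and W :: "'a measure \<Rightarrow> ereal"
    and \<beta>n :: "nat \<Rightarrow> real"
    and \<beta> :: ereal
    and f :: "'a measure \<Rightarrow> real"
  assumes pi: "\<pi> \<in> prob_measures"
    and Wn_measurable: "\<And>n. n \<ge> 1 \<Longrightarrow> Wn n \<in> borel_measurable (power_measure n borel)"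
    and Wn_values: "\<And>n x. n \<ge> 1 \<Longrightarrow> x \<in> configs n \<Longrightarrow> Wn n x \<noteq> -\<infinity>"
    and Wn_symmetric: "\<And>n. n \<ge> 1 \<Longrightarrow> symmetric_fun n (Wn n)"
    and Wn_stable: "stable Wn"
    and W_measurable: "W \<in> borel_measurable (borel_of weak_topology)"
    and W_values: "\<And>\<mu>. \<mu> \<in> prob_measures \<Longrightarrow> W \<mu> \<noteq> -\<infinity>"
    and beta_n_pos: "\<And>n. n \<ge> 1 \<Longrightarrow> \<beta>n n > 0"
    and beta_pos: "\<beta> > 0"
    and beta_lim: "(\<lambda>n. ereal (\<beta>n n)) \<longlonglongrightarrow> \<beta>"
    and finite_beta: "\<beta> < \<infinity> \<Longrightarrow> positive_temperature_limit Wn W"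
    and infinite_beta: "\<beta> = \<infinity> \<Longrightarrow> zero_temperature_limit \<pi> Wn W \<and> confining Wn"
    and f_continuous: "continuous_map weak_topology euclidean f"
    and f_bounded: "bounded (f ` prob_measures)"
  shows "(\<lambda>n. ereal (1 / (real n * \<beta>n n)) *
            elog (\<integral>\<^sup>+x. ennreal (exp (- (real n * \<beta>n n * f (empirical n x))))
                    \<partial>gibbs_measure \<pi> Wn \<beta>n n))
         \<longlonglongrightarrow> - (INF \<mu>\<in>prob_measures. ereal (f \<mu>) + free_energy \<pi> W \<beta> \<mu>)"
proof -
  obtain C where C: "\<And>n x. n \<ge> 1 \<Longrightarrow> x \<in> configs n \<Longrightarrow> ereal C \<le> Wn n x"
    using Wn_stable unfolding stable_def by blast
  obtain \<tau> where temperature_lim: "(\<lambda>n. 1 / \<beta>n n) \<longlonglongrightarrow> \<tau>" and \<tau>: "1 / \<beta> = ereal \<tau>"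
    and \<tau>_pos: "\<beta> < \<infinity> \<Longrightarrow> \<tau> > 0" and \<tau>_0: "\<beta> = \<infinity> \<Longrightarrow> \<tau> = 0"
  proof (cases \<beta>)
    case (real b)
    then have b: "b > 0" "\<beta>n \<longlonglongrightarrow> b" using beta_pos beta_lim by simp_all
    show thesis
    proof (rule that[of "1 / b"])
      show "(\<lambda>n. 1 / \<beta>n n) \<longlonglongrightarrow> 1 / b" using b by (intro tendsto_intros) auto
      show "1 / \<beta> = ereal (1 / b)" using b by (simp add: real one_ereal_def)
    qed (use b real in auto)
  next
    case PInf
    then have "filterlim \<beta>n at_top sequentially"
      using beta_lim by (simp add: tendsto_PInfty_eq_at_top)
    then have "(\<lambda>n. 1 / \<beta>n n) \<longlonglongrightarrow> 0"
      using tendsto_divide_0[OF tendsto_const filterlim_at_top_imp_at_infinity] by blast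
    then show thesis by (rule that) (simp_all add: PInf)
  next
    case MInf
    then show thesis using beta_pos by simp
  qed
  interpret gibbs_model \<pi> Wn C \<beta>n \<tau> f
    by unfold_locales (fact pi Wn_measurable Wn_symmetric C beta_n_pos temperature_lim f_continuous f_bounded)+
  define G where "G \<mu> = ereal (f \<mu>) + free_energy \<pi> W \<beta> \<mu>" for \<mu>
  have G: "G \<mu> = ereal (f \<mu>) + (W \<mu> + ereal \<tau> * relative_entropy \<mu> \<pi>)" for \<mu>
    by (simp add: G_def free_energy_def \<tau>)
  have G_real: "G \<mu> = ereal (f \<mu> + d * \<tau>) + W \<mu>" if "relative_entropy \<mu> \<pi> = ereal d" for \<mu> d
    using that by (cases "W \<mu>") (simp_all add: G algebra_simps)
  have G_inf: "G \<mu> = ereal (f \<mu>) + W \<mu>" if "\<beta> = \<infinity>" for \<mu>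
    using that by (simp add: G_def free_energy_infinity)
  have entropy: "\<exists>d. relative_entropy \<mu> \<pi> = ereal d"
    if "\<mu> \<in> prob_measures" "relative_entropy \<mu> \<pi> < \<infinity>" for \<mu>
  proof -
    have "prob_space \<pi>" "prob_space \<mu>" "sets \<mu> = sets \<pi>"
      using pi that(1) by (simp_all add: prob_measures_iff)
    from relative_entropy_finiteE[OF this that(2)] show ?thesis by metis
  qed
  have lower: "- liminf log_partition \<le> G \<mu>" if \<mu>: "\<mu> \<in> prob_measures" for \<mu>
  proof (cases "\<beta> = \<infinity>")
    case False
    then have fin: "\<beta> < \<infinity>" by simp
    show ?thesis
    proof (cases "relative_entropy \<mu> \<pi> < \<infinity>")
      case True
      then obtain d where d: "relative_entropy \<mu> \<pi> = ereal d" using entropy[OF \<mu>] by blast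
      have "limsup (\<lambda>n. eintegral (power_measure n \<mu>) (Wn n)) \<le> W \<mu>"
        using finite_beta[OF fin] \<mu> by (simp add: positive_temperature_limit_def upper_limit_def)
      from regular_measure_upper[OF \<mu> d this W_values[OF \<mu>]] show ?thesis by (simp add: G_real[OF d])
    next
      case False
      then have "relative_entropy \<mu> \<pi> = \<infinity>" by simp
      \<comment> \<open>Positive \<open>\<tau>\<close> turns infinite entropy into infinite free
        energy, as \<open>W \<mu>\<close> is not -\<infinity>.\<close>
      then have "G \<mu> = \<infinity>"
        unfolding G using \<tau>_pos[OF fin] W_values[OF \<mu>] by (cases "W \<mu>") simp_all
      then show ?thesis by simp
    qed
  next
    case True
    show ?thesis
    proof (cases "W \<mu>")
      case (real w)
      \<comment> \<open>Regularity supplies trial measures of finite entropy. At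
        \<open>\<tau>\<close> = 0 this entropy costs nothing for each fixed \<open>k\<close>,
        however large it becomes along the approximating sequence.\<close>
      then obtain \<mu>k where \<mu>k: "\<And>k. \<mu>k k \<in> regular_measures \<pi> Wn W"
        and lim: "limitin weak_topology \<mu>k \<mu> sequentially" and lim_W: "limsup (\<lambda>k. W (\<mu>k k)) \<le> W \<mu>"
        using infinite_beta[OF True] \<mu> unfolding zero_temperature_limit_def regularity_def by fastforce
      have f_lim: "(\<lambda>k. f (\<mu>k k)) \<longlonglongrightarrow> f \<mu>"
        using continuous_map_limit[OF f_continuous lim] by (simp add: o_def)
      have le: "- liminf log_partition \<le> ereal (f (\<mu>k k)) + W (\<mu>k k)" for k
      proof -
        have *: "\<mu>k k \<in> prob_measures" "relative_entropy (\<mu>k k) \<pi> < \<infinity>"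
          "limsup (\<lambda>n. eintegral (power_measure n (\<mu>k k)) (Wn n)) \<le> W (\<mu>k k)"
          using \<mu>k[of k] by (simp_all add: regular_measures_def)
        then obtain d where d: "relative_entropy (\<mu>k k) \<pi> = ereal d" using entropy by blast
        from regular_measure_upper[OF *(1) d *(3) W_values[OF *(1)]] show ?thesis
          by (simp add: \<tau>_0[OF True])
      qed
      have "- liminf log_partition \<le> ereal (f \<mu> + w)"
      proof (rule ereal_le_epsilon2)
        fix e :: real assume "e > 0"
        have "limsup (\<lambda>k. W (\<mu>k k)) < ereal (w + e)"
          using \<open>e > 0\<close> by (intro order_le_less_trans[OF lim_W]) (simp add: real)
        then have "\<forall>\<^sub>F k in sequentially. W (\<mu>k k) < ereal (w + e)" by (rule Limsup_lessD)
        then have ev: "\<forall>\<^sub>F k in sequentially. - liminf log_partition \<le> ereal (f (\<mu>k k) + (w + e))"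
        proof eventually_elim
          case (elim k)
          have "- liminf log_partition \<le> ereal (f (\<mu>k k)) + W (\<mu>k k)" by (rule le)
          also have "\<dots> \<le> ereal (f (\<mu>k k)) + ereal (w + e)" using elim by (intro add_left_mono) simp
          finally show ?case by simp
        qed
        have "(\<lambda>k. ereal (f (\<mu>k k) + (w + e))) \<longlonglongrightarrow> ereal (f \<mu> + (w + e))"
          by (intro tendsto_intros f_lim)
        from tendsto_lowerbound[OF this ev] show "- liminf log_partition \<le> ereal (f \<mu> + w) + ereal e"
          by (simp add: add.assoc)
      qed
      then show ?thesis by (simp add: G_inf[OF True] real)
    qed (use W_values[OF \<mu>] in \<open>simp_all add: G_inf[OF True]\<close>)
  qed
  have upper: "limsup log_partition \<le> - (INF \<mu>\<in>prob_measures. G \<mu>)"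
  proof (rule ccontr)
    assume "\<not> ?thesis"
    \<comment> \<open>A real \<open>a\<close> in the gap turns failure of the bound into infinitely
      many \<open>n\<close> with \<open>log_partition n\<close> above \<open>a\<close>, the common
      hypothesis of the two upper estimates.\<close>
    then obtain a where a1: "- (INF \<mu>\<in>prob_measures. G \<mu>) < ereal a" and a2: "ereal a < limsup log_partition"
      using ereal_dense2 by (metis not_le)
    have a: "\<exists>\<^sub>F n in sequentially. ereal a < log_partition n"
    proof (rule ccontr)
      assume "\<not> ?thesis"
      then have "\<forall>\<^sub>F n in sequentially. log_partition n \<le> ereal a"
        by (simp add: not_frequently not_less)
      from Limsup_bounded[OF this] a2 show False by simp
    qed
    have "\<exists>\<mu>\<in>prob_measures. G \<mu> \<le> ereal (- a)"
    proof (cases "\<beta> = \<infinity>")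
      case True
      then have "lower_limit Wn W" "confining Wn"
        using infinite_beta by (simp_all add: zero_temperature_limit_def)
      then obtain \<mu> where "\<mu> \<in> prob_measures" "ereal (f \<mu>) + W \<mu> \<le> ereal (- a)"
        by (rule zero_temperature_upper[OF _ _ a])
      then show ?thesis by (auto simp: G_inf[OF True])
    next
      case False
      then have fin: "\<beta> < \<infinity>" by simp
      have "lower_limit Wn W" using finite_beta[OF fin] by (simp add: positive_temperature_limit_def)
      then obtain \<mu> d where "\<mu> \<in> prob_measures" "relative_entropy \<mu> \<pi> = ereal d"
        "ereal (f \<mu> + d * \<tau>) + W \<mu> \<le> ereal (- a)"
        by (rule positive_temperature_upper[OF \<tau>_pos[OF fin] _ a])
      then show ?thesis using G_real by metis
    qed
    then have "(INF \<mu>\<in>prob_measures. G \<mu>) \<le> ereal (- a)" by (auto intro: INF_lower2)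
    then have "- ereal (- a) \<le> - (INF \<mu>\<in>prob_measures. G \<mu>)"
      by (simp only: ereal_minus_le_minus)
    with a1 show False by simp
  qed
  have "- liminf log_partition \<le> (INF \<mu>\<in>prob_measures. G \<mu>)"
    by (intro INF_greatest lower)
  then have lower': "- (INF \<mu>\<in>prob_measures. G \<mu>) \<le> liminf log_partition"
    by (simp add: ereal_uminus_le_reorder)
  have "liminf log_partition \<le> limsup log_partition"
    by (rule Liminf_le_Limsup) simp
  then have "log_partition \<longlonglongrightarrow> - (INF \<mu>\<in>prob_measures. G \<mu>)"
    using upper lower' by (intro Liminf_eq_Limsup) auto
  then show ?thesis
    unfolding log_partition_def[abs_def] G_def .
qed

end
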